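(* Let $(\mathcal{X}_1\times\mathcal{X}_2\times\mathcal{X}_r,\,p(y_1,y_2,y_r|x_1,x_2,x_r),\,\mathcal{Y}_1\times\mathcal{Y}_2\times\mathcal{Y}_r)$ be a discrete memoryless two-way relay channel. Let $\hat{\mathcal{Y}}_r$ be a finite set, and let $p(x_1)$, $p(x_2)$, $p(x_r)$ and $p(\hat y_r|x_r,y_r)$ be (conditional) probability mass functions, with $\hat y_r\in\hat{\mathcal{Y}}_r$. Let $(X_1,X_2,X_r,Y_1,Y_2,Y_r,\hat Y_r)$ have joint distribution $p(x_1)p(x_2)p(x_r)p(y_1,y_2,y_r|x_1,x_2,x_r)p(\hat y_r|x_r,y_r)$, and suppose that $$I(\hat{Y}_r;Y_r|X_1,X_2,X_r,Y_1)\leq I(X_r;Y_1|X_1),\qquad I(\hat{Y}_r;Y_r|X_1,X_2,X_r,Y_2)\leq I(X_r;Y_2|X_2).$$ Then every rate pair $(R_1,R_2)$ with $R_1,R_2\ge0$ and $$R_1 \leq \min\{\,I(X_1;Y_2,\hat{Y}_r|X_2,X_r),\ \ I(X_1,X_r;Y_2|X_2)-I(\hat{Y}_r;Y_r|X_1,X_2,X_r,Y_2)\,\},$$ $$R_2 \leq \min\{\,I(X_2;Y_1,\hat{Y}_r|X_1,X_r),\ \ I(X_2,X_r;Y_1|X_1)-I(\hat{Y}_r;Y_r|X_1,X_2,X_r,Y_1)\,\}$$ is achievable for the two-way relay channel (achieved by compress-forward without binning at the relay and with joint decoding of the message and compression index at each user).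
   Context: All alphabets are finite. The channel is memoryless and full-duplex: given inputs $(x_{1,i},x_{2,i},x_{r,i})$ at time $i$, the outputs $(Y_{1,i},Y_{2,i},Y_{r,i})$ are drawn from $p(y_1,y_2,y_r|x_1,x_2,x_r)$, independently of the past. User $k\in\{1,2\}$ has input $x_k$ and output $y_k$; the relay has input $x_r$ and output $y_r$. User 1 wants to send $M_1$ to user 2, and user 2 wants to send $M_2$ to user 1. An $(n,2^{nR_1},2^{nR_2},P_e)$ code consists of message sets $\mathcal{M}_1=[1:2^{nR_1}]$ and $\mathcal{M}_2=[1:2^{nR_2}]$ (sizes rounded to integers if necessary), encoding functions, for $i=1,\dots,n$, $$x_{1,i}=f_{1,i}(M_1,Y_{1,1},\dots,Y_{1,i-1}),\quad x_{2,i}=f_{2,i}(M_2,Y_{2,1},\dots,Y_{2,i-1}),\quad x_{r,i}=f_{r,i}(Y_{r,1},\dots,Y_{r,i-1}),$$ and decoding functions $g_1:\mathcal{Y}_1^n\times\mathcal{M}_1\to\mathcal{M}_2$ and $g_2:\mathcal{Y}_2^n\times\mathcal{M}_2\to\mathcal{M}_1$. With $M_1,M_2$ independent and uniform, the average error probability is $P_e=\Pr\{g_1(Y_1^n,M_1)\ne M_2\text{ or }g_2(Y_2^n,M_2)\neq M_1\}$. A rate pair $(R_1,R_2)$ is achievable if there are such codes with $P_e\to0$ as $n\to\infty$; as is customary, limits of achievable pairs are also counted as achievable (closure). $I(\cdot;\cdot|\cdot)$ denotes (conditional) mutual information. *)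

theory Defs
  imports "HOL-Probability.Probability" "HOL-Library.Monad_Syntax"
begin

definition cond_mutual_info ::
    "'w pmf \<Rightarrow> ('w \<Rightarrow> 'a::finite) \<Rightarrow> ('w \<Rightarrow> 'b::finite) \<Rightarrow> ('w \<Rightarrow> 'c::finite) \<Rightarrow> real" where
  "cond_mutual_info P X Y Z =
     prob_space.conditional_mutual_information (measure_pmf P) 2
       (count_space UNIV) (count_space UNIV) (count_space UNIV) X Y Z"

type_synonym ('x1, 'x2, 'xr, 'y1, 'y2, 'yr) twrc =
  "'x1 \<times> 'x2 \<times> 'xr \<Rightarrow> ('y1 \<times> 'y2 \<times> 'yr) pmf"

text \<open>
  Encoders receive the list of past outputs, oldest first; its length determines the
  time index, so one function on lists represents the whole family of encoding functions.
\<close>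

record ('x1, 'x2, 'xr, 'y1, 'y2, 'yr) twrc_code =
  enc1 :: "nat \<Rightarrow> 'y1 list \<Rightarrow> 'x1"
  enc2 :: "nat \<Rightarrow> 'y2 list \<Rightarrow> 'x2"
  encr :: "'yr list \<Rightarrow> 'xr"
  dec1 :: "'y1 list \<Rightarrow> nat \<Rightarrow> nat"
  dec2 :: "'y2 list \<Rightarrow> nat \<Rightarrow> nat"

definition messages :: "nat \<Rightarrow> real \<Rightarrow> nat set" where
  "messages n R = {1..nat \<lceil>2 powr (real n * R)\<rceil>}"

definition is_code ::
    "nat \<Rightarrow> real \<Rightarrow> real \<Rightarrow> ('x1, 'x2, 'xr, 'y1, 'y2, 'yr) twrc_code \<Rightarrow> bool" where
  "is_code n R1 R2 C \<longleftrightarrow>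
     (\<forall>ys m. length ys = n \<and> m \<in> messages n R1 \<longrightarrow> dec1 C ys m \<in> messages n R2) \<and>
     (\<forall>ys m. length ys = n \<and> m \<in> messages n R2 \<longrightarrow> dec2 C ys m \<in> messages n R1)"

fun outputs ::
    "('x1, 'x2, 'xr, 'y1, 'y2, 'yr) twrc \<Rightarrow> ('x1, 'x2, 'xr, 'y1, 'y2, 'yr) twrc_code \<Rightarrow>
     nat \<Rightarrow> nat \<Rightarrow> nat \<Rightarrow> ('y1 \<times> 'y2 \<times> 'yr) list pmf" where
  "outputs W C m1 m2 0 = return_pmf []"
| "outputs W C m1 m2 (Suc i) = do {
     ys \<leftarrow> outputs W C m1 m2 i;
     y \<leftarrow> W (enc1 C m1 (map (\<lambda>(y1, y2, yr). y1) ys),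
            enc2 C m2 (map (\<lambda>(y1, y2, yr). y2) ys),
            encr C (map (\<lambda>(y1, y2, yr). yr) ys));
     return_pmf (ys @ [y])
   }"

definition transmission ::
    "('x1, 'x2, 'xr, 'y1, 'y2, 'yr) twrc \<Rightarrow> nat \<Rightarrow> real \<Rightarrow> real \<Rightarrow>
     ('x1, 'x2, 'xr, 'y1, 'y2, 'yr) twrc_code \<Rightarrow> (nat \<times> nat \<times> ('y1 \<times> 'y2 \<times> 'yr) list) pmf" where
  "transmission W n R1 R2 C = do {
     m1 \<leftarrow> pmf_of_set (messages n R1);
     m2 \<leftarrow> pmf_of_set (messages n R2);
     ys \<leftarrow> outputs W C m1 m2 n;
     return_pmf (m1, m2, ys)
   }"

definition error_prob ::
    "('x1, 'x2, 'xr, 'y1, 'y2, 'yr) twrc \<Rightarrow> nat \<Rightarrow> real \<Rightarrow> real \<Rightarrow>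
     ('x1, 'x2, 'xr, 'y1, 'y2, 'yr) twrc_code \<Rightarrow> real" where
  "error_prob W n R1 R2 C =
     measure_pmf.prob (transmission W n R1 R2 C)
       {(m1, m2, ys).
          dec1 C (map (\<lambda>(y1, y2, yr). y1) ys) m1 \<noteq> m2 \<or>
          dec2 C (map (\<lambda>(y1, y2, yr). y2) ys) m2 \<noteq> m1}"

definition vanishing_error_rates :: "('x1, 'x2, 'xr, 'y1, 'y2, 'yr) twrc \<Rightarrow> (real \<times> real) set" where
  "vanishing_error_rates W =
     {(R1, R2). R1 \<ge> 0 \<and> R2 \<ge> 0 \<and>
        (\<exists>C. (\<forall>n. is_code n R1 R2 (C n)) \<and> (\<lambda>n. error_prob W n R1 R2 (C n)) \<longlonglongrightarrow> 0)}"

definition achievable :: "('x1, 'x2, 'xr, 'y1, 'y2, 'yr) twrc \<Rightarrow> real \<Rightarrow> real \<Rightarrow> bool" where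
  "achievable W R1 R2 \<longleftrightarrow> (R1, R2) \<in> closure (vanishing_error_rates W)"

definition cf_joint ::
    "'x1 pmf \<Rightarrow> 'x2 pmf \<Rightarrow> 'xr pmf \<Rightarrow> ('x1, 'x2, 'xr, 'y1, 'y2, 'yr) twrc \<Rightarrow>
     ('xr \<Rightarrow> 'yr \<Rightarrow> 'yh pmf) \<Rightarrow> ('x1 \<times> 'x2 \<times> 'xr \<times> 'y1 \<times> 'y2 \<times> 'yr \<times> 'yh) pmf" where
  "cf_joint p1 p2 pr W q = do {
     x1 \<leftarrow> p1;
     x2 \<leftarrow> p2;
     xr \<leftarrow> pr;
     (y1, y2, yr) \<leftarrow> W (x1, x2, xr);
     yh \<leftarrow> q xr yr;
     return_pmf (x1, x2, xr, y1, y2, yr, yh)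
   }"

end

theory Submission
  imports Defs "HOL-Real_Asymp.Real_Asymp"
begin

text \<open>
  The code is that of noisy network coding. A single message is repeated over \<open>b\<close> blocks of \<open>n\<close>
  letters, with a fresh random codebook in every block. At the end of a block the relay picks from a
  quantization codebook a word that matches what it sent and received, and in the next block it sends
  the codeword of the index of that word. A user searches for the unique message for which \<^emph>\<open>some\<close>
  sequence of relay indices makes every block typical.

  The expected number of such sequences for a wrong message is controlled by a potential in which a
  sequence ending in a wrong index has the weight \<open>2 powr - (n * k)\<close>. Each block multiplies the
  potential by about \<open>2 powr - (n * d)\<close>, where \<open>d\<close> is the minimum in the rate condition. The weight costs
  a factor \<open>2 powr (n * k)\<close> once, which does not matter if \<open>b\<close> is large. The quantization costs a
  factor \<open>2 powr (3 * n * \<delta>)\<close> per block, which the exponentially small probability of atypical blocks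
  absorbs for small \<open>\<delta>\<close>.

  This shows that rates are achievable if they are strictly smaller than \<open>d\<close>, or zero; the closure in the
  definition of achievability gives the rest.
\<close>

subsection \<open>Entropy and conditional mutual information\<close>

text \<open>The obstacle is the relay's choice. The picked index depends on the relay word, the
  received word and the whole quantization codebook, so given the choice the codewords lose their
  laws. Inequalities replace conditioning: a change of measure turns the picked word into an output
  of the test channel \<open>q\<close>, and the weight of wrong indices is summed over all indices,
  the picked one included, so that each codeword in the sum keeps its unconditional law. One
  quantization codebook is fixed for all blocks and both users before the block codebooks are drawn.
  Given it, the relay index is a Markov chain, and only six one-block costs need control.
  Quantization codewords follow the marginal of \<open>Yh\<close>, independently of the relay word.
  The codebook rate is therefore about I(Yh; Xr, Yr), but a wrong codeword is also independent of a
  wrong relay word, and the entropy of \<open>Yh\<close> cancels in the final exponent. The constant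
  k makes the return to the true index cost exactly what the potential allows; that leaving it is
  affordable follows from the nonnegativity of a conditional mutual information.\<close>

lemma distributed_pmf:
  "distributed (measure_pmf P) (count_space UNIV) X (\<lambda>x. ennreal (pmf (map_pmf X P) x))"
  unfolding distributed_def by (simp add: map_pmf_rep_eq[symmetric] measure_pmf_eq_density[symmetric])

text \<open>The sum runs over the sample space, not over the range of \<open>f\<close>. Entropies of
  tuples of any type are then sums over one index set with the same weights and combine term by
  term.\<close>

definition ent :: "'z::finite pmf \<Rightarrow> ('z \<Rightarrow> 'a) \<Rightarrow> real" where
  "ent J f = - (\<Sum>z\<in>UNIV. pmf J z * log 2 (pmf (map_pmf f J) (f z)))"

lemma sum_pmf_map:
  fixes J :: "'z::finite pmf" and f :: "'z \<Rightarrow> 'a::finite" and \<phi> :: "'a \<Rightarrow> real"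
  shows "(\<Sum>x\<in>UNIV. pmf (map_pmf f J) x * \<phi> x) = (\<Sum>z\<in>UNIV. pmf J z * \<phi> (f z))"
proof -
  have "measure_pmf.expectation (map_pmf f J) \<phi> = measure_pmf.expectation J (\<lambda>z. \<phi> (f z))"
    by simp
  thus ?thesis
    by (subst (asm) (1 2) integral_measure_pmf_real[where A=UNIV]) (simp_all add: mult.commute)
qed

lemma information_space_pmf: "information_space (measure_pmf P) 2"
  by standard auto

lemma entropy_pmf:
  fixes V :: "'w \<Rightarrow> 'z::finite" and f :: "'z \<Rightarrow> 'a::finite"
  shows "prob_space.entropy (measure_pmf P) 2 (count_space UNIV) (\<lambda>w. f (V w)) = ent (map_pmf V P) f"
proof -
  interpret information_space "measure_pmf P" 2 by (rule information_space_pmf)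
  have "prob_space.entropy (measure_pmf P) 2 (count_space UNIV) (\<lambda>w. f (V w)) =
      - (\<Sum>x\<in>UNIV. pmf (map_pmf f (map_pmf V P)) x * log 2 (pmf (map_pmf f (map_pmf V P)) x))"
    by (subst entropy_distr[OF distributed_pmf])
      (simp_all add: lebesgue_integral_count_space_finite map_pmf_comp)
  thus ?thesis
    unfolding sum_pmf_map ent_def .
qed

lemma pair_count_space_finite:
  "(count_space UNIV :: 'a::finite measure) \<Otimes>\<^sub>M (count_space UNIV :: 'b::finite measure) = count_space UNIV"
  by (simp add: pair_measure_count_space)

lemma mutual_information_pmf:
  fixes V :: "'w \<Rightarrow> 'z::finite" and f :: "'z \<Rightarrow> 'a::finite" and g :: "'z \<Rightarrow> 'b::finite"
  shows "prob_space.mutual_information (measure_pmf P) 2 (count_space UNIV) (count_space UNIV)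
     (\<lambda>w. f (V w)) (\<lambda>w. g (V w)) =
    ent (map_pmf V P) f + ent (map_pmf V P) g - ent (map_pmf V P) (\<lambda>z. (f z, g z))"
proof -
  interpret information_space "measure_pmf P" 2 by (rule information_space_pmf)
  have "distributed (measure_pmf P) (count_space UNIV \<Otimes>\<^sub>M count_space UNIV) (\<lambda>w. (f (V w), g (V w)))
      (\<lambda>x. ennreal (pmf (map_pmf (\<lambda>w. (f (V w), g (V w))) P) x))"
    unfolding pair_count_space_finite by (rule distributed_pmf)
  from mutual_information_eq_entropy_conditional_entropy_distr[OF _ _ distributed_pmf _ distributed_pmf _ this]
  show ?thesis
    by (simp add: pair_count_space_finite sigma_finite_measure_count_space_finite integrable_count_space entropy_pmf entropy_pmf[where f="\<lambda>z. (f z, g z)"])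
qed

text \<open>The sample space of \<open>P\<close> may be infinite, so all variables factor through a
  finite-valued \<open>V\<close>. The identity unfolds I(X;Y|Z) = I(X;Y,Z) - I(X;Z).\<close>

lemma cond_mutual_info_ent:
  fixes V :: "'w \<Rightarrow> 'z::finite" and f :: "'z \<Rightarrow> 'a::finite" and g :: "'z \<Rightarrow> 'b::finite"
    and h :: "'z \<Rightarrow> 'c::finite"
  shows "cond_mutual_info P (\<lambda>w. f (V w)) (\<lambda>w. g (V w)) (\<lambda>w. h (V w)) =
    ent (map_pmf V P) (\<lambda>z. (g z, h z)) + ent (map_pmf V P) (\<lambda>z. (f z, h z))
      - ent (map_pmf V P) (\<lambda>z. (f z, g z, h z)) - ent (map_pmf V P) h"
proof -
  interpret information_space "measure_pmf P" 2 by (rule information_space_pmf)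
  show ?thesis
    unfolding cond_mutual_info_def prob_space.conditional_mutual_information_def[OF measure_pmf.prob_space_axioms] pair_count_space_finite
    by (simp add: mutual_information_pmf mutual_information_pmf[where g="\<lambda>z. (g z, h z)"])
qed

lemma cond_mutual_info_nonneg:
  fixes X :: "'w \<Rightarrow> 'a::finite" and Y :: "'w \<Rightarrow> 'b::finite" and Z :: "'w \<Rightarrow> 'c::finite"
  shows "0 \<le> cond_mutual_info P X Y Z"
proof -
  interpret information_space "measure_pmf P" 2 by (rule information_space_pmf)
  note d = distributed_pmf[of P]
  have yz: "distributed (measure_pmf P) (count_space UNIV \<Otimes>\<^sub>M count_space UNIV) (\<lambda>w. (Y w, Z w))
      (\<lambda>x. ennreal (pmf (map_pmf (\<lambda>w. (Y w, Z w)) P) x))"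
    unfolding pair_count_space_finite by (rule d)
  have xz: "distributed (measure_pmf P) (count_space UNIV \<Otimes>\<^sub>M count_space UNIV) (\<lambda>w. (X w, Z w))
      (\<lambda>x. ennreal (pmf (map_pmf (\<lambda>w. (X w, Z w)) P) x))"
    unfolding pair_count_space_finite by (rule d)
  have xyz: "distributed (measure_pmf P) (count_space UNIV \<Otimes>\<^sub>M count_space UNIV \<Otimes>\<^sub>M count_space UNIV) (\<lambda>w. (X w, Y w, Z w))
      (\<lambda>x. ennreal (pmf (map_pmf (\<lambda>w. (X w, Y w, Z w)) P) x))"
    unfolding pair_count_space_finite by (rule d)
  show ?thesis
    unfolding cond_mutual_info_def
    by (rule conditional_mutual_information_generic_nonneg[OF _ _ _ d _ d _ yz _ xz _ xyz])
      (simp_all add: pair_count_space_finite sigma_finite_measure_count_space_finite integrable_count_space)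
qed

subsection \<open>Chernoff bounds\<close>

lemma nn_integral_replicate_pmf_prod_list:
  "(\<integral>\<^sup>+zs. prod_list (map \<phi> zs) \<partial>replicate_pmf n p) = (\<integral>\<^sup>+z. (\<phi> z :: ennreal) \<partial>measure_pmf p) ^ n"
  by (induction n) (simp_all add: nn_integral_cmult nn_integral_multc)

text \<open>At s = 0 the exponential moment is 1 and its derivative is the mean of \<open>f\<close>,
  so it drops below 1 just to the right of 0.\<close>

lemma exp_moment_less_1:
  fixes J :: "'z::finite pmf" and f :: "'z \<Rightarrow> real"
  assumes "(\<Sum>z\<in>UNIV. pmf J z * f z) < 0"
  shows "\<exists>s>0. (\<Sum>z\<in>UNIV. pmf J z * exp (s * f z)) < 1"
proof -
  define \<psi> where "\<psi> = (\<lambda>s. \<Sum>z\<in>UNIV. pmf J z * exp (s * f z))"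
  have "(\<psi> has_real_derivative (\<Sum>z\<in>UNIV. pmf J z * f z)) (at 0)"
    unfolding \<psi>_def by (auto intro!: derivative_eq_intros sum.cong)
  from DERIV_neg_dec_right[OF this assms] obtain d where "d > 0" and
    d: "\<And>h. h > 0 \<Longrightarrow> h < d \<Longrightarrow> \<psi> (0 + h) < \<psi> 0" by auto
  have "\<psi> 0 = 1"
    unfolding \<psi>_def by (simp add: sum_pmf_eq_1)
  with d[of "d/2"] \<open>d > 0\<close> show ?thesis
    unfolding \<psi>_def by (intro exI[of _ "d/2"]) auto
qed

lemma chernoff_replicate_pmf:
  fixes J :: "'z::finite pmf" and f :: "'z \<Rightarrow> real"
  assumes "(\<Sum>z\<in>UNIV. pmf J z * f z) < 0"
  shows "\<exists>\<rho>. 0 < \<rho> \<and> \<rho> < 1 \<and>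
    (\<forall>n. emeasure (replicate_pmf n J) {zs. 0 \<le> sum_list (map f zs)} \<le> ennreal (\<rho> ^ n))"
proof -
  from exp_moment_less_1[OF assms] obtain s where "s > 0" and
    s: "(\<Sum>z\<in>UNIV. pmf J z * exp (s * f z)) < 1" by auto
  define \<rho> where "\<rho> = (\<Sum>z\<in>UNIV. pmf J z * exp (s * f z))"
  have "\<rho> > 0"
  proof -
    obtain z where "z \<in> set_pmf J" using set_pmf_not_empty[of J] by blast
    hence "0 < pmf J z * exp (s * f z)" by (simp add: pmf_positive)
    also have "\<dots> \<le> \<rho>" unfolding \<rho>_def by (rule member_le_sum) auto
    finally show ?thesis .
  qed
  have \<rho>: "(\<integral>\<^sup>+z. ennreal (exp (s * f z)) \<partial>J) = ennreal \<rho>"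
    unfolding \<rho>_def
    by (subst nn_integral_measure_pmf_support[of UNIV])
      (auto simp: ennreal_mult' sum_ennreal[symmetric] mult.commute simp del: sum_ennreal)
  have "emeasure (replicate_pmf n J) {zs. 0 \<le> sum_list (map f zs)} \<le> ennreal (\<rho> ^ n)" for n
  proof -
    have eq: "prod_list (map (\<lambda>z. ennreal (exp (s * f z))) zs) = ennreal (exp (s * sum_list (map f zs)))" for zs
      by (induction zs) (simp_all add: ennreal_mult[symmetric] exp_add[symmetric] algebra_simps)
    have "emeasure (replicate_pmf n J) {zs. 0 \<le> sum_list (map f zs)} =
        (\<integral>\<^sup>+zs. indicator {zs. 0 \<le> sum_list (map f zs)} zs \<partial>replicate_pmf n J)"
      by simp
    also have "\<dots> \<le> (\<integral>\<^sup>+zs. prod_list (map (\<lambda>z. ennreal (exp (s * f z))) zs) \<partial>replicate_pmf n J)"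
      unfolding eq using \<open>s > 0\<close> by (intro nn_integral_mono) (auto simp: indicator_def)
    also have "\<dots> = ennreal (\<rho> ^ n)"
      using \<open>\<rho> > 0\<close> by (simp add: nn_integral_replicate_pmf_prod_list \<rho> ennreal_power)
    finally show ?thesis .
  qed
  with \<open>\<rho> > 0\<close> s show ?thesis unfolding \<rho>_def by blast
qed

text \<open>Chernoff's bound for the sum over the letters of d minus the log ratio, which has
  negative mean by \<open>D\<close>. The event is stated with products, not quotients, because
  positivity is only available on the support.\<close>

lemma chernoff_log_ratio:
  fixes J :: "'z::finite pmf" and \<alpha> \<beta> :: "'z \<Rightarrow> real"
  assumes "\<And>z. z \<in> set_pmf J \<Longrightarrow> \<alpha> z > 0" "\<And>z. z \<in> set_pmf J \<Longrightarrow> \<beta> z > 0"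
    and D: "d < (\<Sum>z\<in>UNIV. pmf J z * (log 2 (\<alpha> z) - log 2 (\<beta> z)))"
  shows "\<exists>\<rho>. 0 < \<rho> \<and> \<rho> < 1 \<and>
    (\<forall>n. emeasure (replicate_pmf n J)
       {zs. prod_list (map \<alpha> zs) < 2 powr (real n * d) * prod_list (map \<beta> zs)} \<le> ennreal (\<rho> ^ n))"
proof -
  define f where "f = (\<lambda>z. d - (log 2 (\<alpha> z) - log 2 (\<beta> z)))"
  have "(\<Sum>z\<in>UNIV. pmf J z * f z) = d - (\<Sum>z\<in>UNIV. pmf J z * (log 2 (\<alpha> z) - log 2 (\<beta> z)))"
    unfolding f_def right_diff_distrib[of _ d] sum_subtractf sum_distrib_right[symmetric]
    by (simp add: sum_pmf_eq_1)
  hence "(\<Sum>z\<in>UNIV. pmf J z * f z) < 0" using D by simp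
  from chernoff_replicate_pmf[OF this] obtain \<rho> where \<rho>: "0 < \<rho>" "\<rho> < 1"
    "\<And>n. emeasure (replicate_pmf n J) {zs. 0 \<le> sum_list (map f zs)} \<le> ennreal (\<rho> ^ n)"
    by blast
  have pos: "prod_list (map \<alpha> zs) > 0 \<and> prod_list (map \<beta> zs) > 0 \<and>
     sum_list (map f zs) = real (length zs) * d - (log 2 (prod_list (map \<alpha> zs)) - log 2 (prod_list (map \<beta> zs)))"
    if "set zs \<subseteq> set_pmf J" for zs
    using that
  proof (induction zs)
    case (Cons z zs)
    thus ?case using assms(1,2)[of z] by (auto simp: f_def log_mult algebra_simps)
  qed simp
  have "emeasure (replicate_pmf n J)
       {zs. prod_list (map \<alpha> zs) < 2 powr (real n * d) * prod_list (map \<beta> zs)} \<le>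
     emeasure (replicate_pmf n J) {zs. 0 \<le> sum_list (map f zs)}" for n
  proof (rule emeasure_mono_AE, unfold AE_measure_pmf_iff, intro ballI impI)
    fix zs assume "zs \<in> set_pmf (replicate_pmf n J)"
      and lt: "zs \<in> {zs. prod_list (map \<alpha> zs) < 2 powr (real n * d) * prod_list (map \<beta> zs)}"
    hence zs: "set zs \<subseteq> set_pmf J" "length zs = n" by (auto simp: set_replicate_pmf)
    note p = pos[OF zs(1)]
    have "log 2 (prod_list (map \<alpha> zs)) < log 2 (2 powr (real n * d) * prod_list (map \<beta> zs))"
      using p lt by (subst log_less_cancel_iff) auto
    also have "\<dots> = real n * d + log 2 (prod_list (map \<beta> zs))"
      using p by (subst log_mult) auto
    finally show "zs \<in> {zs. 0 \<le> sum_list (map f zs)}" using p zs(2) by simp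
  qed simp
  with \<rho> show ?thesis by (meson order_trans)
qed

subsection \<open>Paths of relay indices\<close>

text \<open>The head of the list is the latest block. Paths start at index 0, and
  \<open>T z l l'\<close> means that block \<open>z\<close> is consistent with the relay sending
  index \<open>l\<close> in it and quantizing it to \<open>l'\<close>. Counting paths instead of
  asking for one makes the first moment linear.\<close>

primrec path_count :: "nat \<Rightarrow> ('z \<Rightarrow> nat \<Rightarrow> nat \<Rightarrow> bool) \<Rightarrow> 'z list \<Rightarrow> nat \<Rightarrow> nat" where
  "path_count L T [] l' = of_bool (l' = 0)"
| "path_count L T (z # zs) l' = (\<Sum>l\<le>L. path_count L T zs l * of_bool (T z l l'))"

text \<open>The index is the only memory from one block to the next: \<open>K l\<close> is the law
  of a block in which index \<open>l\<close> is sent, and \<open>nx\<close> gives the index that the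
  relay derives from it.\<close>

primrec chain :: "(nat \<Rightarrow> 'z pmf) \<Rightarrow> (nat \<Rightarrow> 'z \<Rightarrow> nat) \<Rightarrow> nat \<Rightarrow> ('z list \<times> nat) pmf" where
  "chain K nx 0 = return_pmf ([], 0)"
| "chain K nx (Suc j) = bind_pmf (chain K nx j) (\<lambda>(zs, l). map_pmf (\<lambda>z. (z # zs, nx l z)) (K l))"

lemma path_count_map: "path_count L T (map f zs) = path_count L (\<lambda>z. T (f z)) zs"
  by (induction zs) (auto simp: fun_eq_iff)

lemma chain_state_le:
  assumes "\<And>l z. nx l z \<le> L" "s \<in> set_pmf (chain K nx j)"
  shows "snd s \<le> L"
  using assms by (induction j arbitrary: s) auto

text \<open>It suffices to watch the path of the relay's own indices. While the count at the current
  index is positive, it can only become zero in a block that rejects the true transition; a union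
  bound over the blocks follows.\<close>

lemma chain_path_lost:
  assumes le: "\<And>l z. nx l z \<le> L"
    and e: "\<And>l. l \<le> L \<Longrightarrow> emeasure (measure_pmf (K l)) {z. \<not> T z l (nx l z)} \<le> e"
  shows "emeasure (chain K nx j) {(zs, l). path_count L T zs l = 0} \<le> of_nat j * e"
proof (induction j)
  case (Suc j)
  let ?A = "{(zs, l). path_count L T zs l = 0}"
  have step: "emeasure (K l) {z. path_count L T (z # zs) (nx l z) = 0}
      \<le> indicator ?A (zs, l) + e" if "l \<le> L" for zs l
  proof (cases "path_count L T zs l = 0")
    case True
    thus ?thesis
      by (intro order.trans[OF measure_pmf.emeasure_le_1]) (auto intro: add_increasing2)
  next
    case False
    have "{z. path_count L T (z # zs) (nx l z) = 0} \<subseteq> {z. \<not> T z l (nx l z)}"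
      using False that by auto
    hence "emeasure (K l) {z. path_count L T (z # zs) (nx l z) = 0} \<le>
        emeasure (K l) {z. \<not> T z l (nx l z)}"
      by (rule emeasure_mono) simp
    also have "\<dots> \<le> e" by (rule e[OF that])
    finally have "emeasure (K l) {z. path_count L T (z # zs) (nx l z) = 0} \<le> e" .
    thus ?thesis by (intro add_increasing) auto
  qed
  have "emeasure (chain K nx (Suc j)) ?A =
      (\<integral>\<^sup>+(zs, l). emeasure (K l) {z. path_count L T (z # zs) (nx l z) = 0}
         \<partial>chain K nx j)"
    by (simp add: case_prod_unfold vimage_def)
  also have "\<dots> \<le> (\<integral>\<^sup>+s. indicator ?A s + e \<partial>chain K nx j)"
    using chain_state_le[where nx=nx, OF le]
    by (intro nn_integral_mono_AE) (fastforce simp: AE_measure_pmf_iff simp del: path_count.simps intro: step)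
  also have "\<dots> = emeasure (chain K nx j) ?A + e"
    by (simp add: nn_integral_add)
  also have "\<dots> \<le> of_nat j * e + e"
    using Suc by (intro add_right_mono)
  finally show ?case by (simp add: algebra_simps)
qed simp

text \<open>
  The potential weights a path through a wrong index by \<open>\<kappa>\<close>, which balances the gain of leaving the
  true path against the loss of returning to it.
\<close>

lemma chain_wrong_paths:
  fixes \<kappa> \<Lambda> :: ennreal
  assumes le: "\<And>l z. nx l z \<le> L"
    and right: "\<And>l. l \<le> L \<Longrightarrow>
       (\<integral>\<^sup>+z. of_bool (T z l (nx l z)) + \<kappa> * (\<Sum>l'\<le>L. of_bool (T z l l')) \<partial>measure_pmf (K l)) \<le> \<Lambda>"
    and wrong: "\<And>l m. l \<le> L \<Longrightarrow> m \<le> L \<Longrightarrow> m \<noteq> l \<Longrightarrow>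
       (\<integral>\<^sup>+z. of_bool (T z m (nx l z)) + \<kappa> * (\<Sum>l'\<le>L. of_bool (T z m l')) \<partial>measure_pmf (K l)) \<le> \<kappa> * \<Lambda>"
  shows "(\<integral>\<^sup>+(zs, l). of_nat (path_count L T zs l) + \<kappa> * (\<Sum>l'\<le>L. of_nat (path_count L T zs l'))
       \<partial>chain K nx j) \<le> (1 + \<kappa>) * \<Lambda> ^ j"
proof (induction j)
  case 0
  show ?case by simp
next
  case (Suc j)
  let ?\<phi> = "\<lambda>(zs, l). of_nat (path_count L T zs l) + \<kappa> * (\<Sum>l'\<le>L. of_nat (path_count L T zs l')) :: ennreal"
  have step: "(\<integral>\<^sup>+z. ?\<phi> (z # zs, nx l z) \<partial>K l) \<le> \<Lambda> * ?\<phi> (zs, l)" if "l \<le> L" for zs l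
  proof -
    let ?N = "\<lambda>m. of_nat (path_count L T zs m) :: ennreal"
    have "(\<integral>\<^sup>+z. ?\<phi> (z # zs, nx l z) \<partial>K l) =
      (\<integral>\<^sup>+z. (\<Sum>m\<le>L. ?N m * (of_bool (T z m (nx l z)) + \<kappa> * (\<Sum>l'\<le>L. of_bool (T z m l')))) \<partial>K l)"
    proof (intro nn_integral_cong)
      fix z
      have swap: "(\<Sum>l'\<le>L. \<Sum>m\<le>L. ?N m * of_bool (T z m l')) = (\<Sum>m\<le>L. ?N m * (\<Sum>l'\<le>L. of_bool (T z m l')))"
        by (subst sum.swap) (simp only: sum_distrib_left)
      have "?\<phi> (z # zs, nx l z) = (\<Sum>m\<le>L. ?N m * of_bool (T z m (nx l z)))
          + \<kappa> * (\<Sum>l'\<le>L. \<Sum>m\<le>L. ?N m * of_bool (T z m l'))"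
        by (simp only: path_count.simps of_nat_sum of_nat_mult of_nat_of_bool prod.case)
      also have "\<dots> = (\<Sum>m\<le>L. ?N m * (of_bool (T z m (nx l z)) + \<kappa> * (\<Sum>l'\<le>L. of_bool (T z m l'))))"
        by (simp only: swap sum_distrib_left[of \<kappa>] sum.distrib[symmetric] distrib_left mult.left_commute[of \<kappa>])
      finally show "?\<phi> (z # zs, nx l z) = (\<Sum>m\<le>L. ?N m * (of_bool (T z m (nx l z)) + \<kappa> * (\<Sum>l'\<le>L. of_bool (T z m l'))))" .
    qed
    also have "\<dots> = (\<Sum>m\<le>L. ?N m * (\<integral>\<^sup>+z. of_bool (T z m (nx l z)) + \<kappa> * (\<Sum>l'\<le>L. of_bool (T z m l')) \<partial>K l))"
      by (simp add: nn_integral_sum nn_integral_cmult)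
    also have "\<dots> \<le> (\<Sum>m\<le>L. ?N m * (if m = l then \<Lambda> else \<kappa> * \<Lambda>))"
      using right[OF that] wrong[OF that] by (intro sum_mono mult_left_mono) auto
    also have "\<dots> \<le> (\<Sum>m\<le>L. (if m = l then ?N m * \<Lambda> else 0) + ?N m * (\<kappa> * \<Lambda>))"
      by (intro sum_mono) auto
    also have "\<dots> = \<Lambda> * ?\<phi> (zs, l)"
      using that by (simp add: sum.distrib sum_distrib_left algebra_simps)
    finally show ?thesis .
  qed
  have "(\<integral>\<^sup>+s. ?\<phi> s \<partial>chain K nx (Suc j)) =
      (\<integral>\<^sup>+(zs, l). (\<integral>\<^sup>+z. ?\<phi> (z # zs, nx l z) \<partial>K l) \<partial>chain K nx j)"
    by (simp add: case_prod_unfold)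
  also have "\<dots> \<le> (\<integral>\<^sup>+s. \<Lambda> * ?\<phi> s \<partial>chain K nx j)"
    using step chain_state_le[where nx=nx, OF le]
    by (intro nn_integral_mono_AE) (fastforce simp: AE_measure_pmf_iff simp del: path_count.simps)
  also have "\<dots> = \<Lambda> * (\<integral>\<^sup>+s. ?\<phi> s \<partial>chain K nx j)"
    by (simp add: nn_integral_cmult)
  also have "\<dots> \<le> \<Lambda> * ((1 + \<kappa>) * \<Lambda> ^ j)"
    using Suc by (intro mult_left_mono) auto
  finally show ?case by (simp add: mult_ac)
qed

subsection \<open>Random quantization codebooks\<close>

lemma emeasure_pmf_of_bool:
  "emeasure (measure_pmf p) {x. Q x} = (\<integral>\<^sup>+x. of_bool (Q x) \<partial>measure_pmf p)"
proof -
  have "emeasure p {x. Q x} = (\<integral>\<^sup>+x. indicator {x. Q x} x \<partial>p)"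
    by (rule nn_integral_indicator[symmetric]) simp
  thus ?thesis by (simp add: indicator_def)
qed

lemma nn_integral_pmf_commute:
  "(\<integral>\<^sup>+x. \<integral>\<^sup>+y. f x y \<partial>measure_pmf B \<partial>measure_pmf A) = (\<integral>\<^sup>+y. \<integral>\<^sup>+x. (f x y :: ennreal) \<partial>measure_pmf A \<partial>measure_pmf B)"
proof -
  have "(\<integral>\<^sup>+z. case_prod f z \<partial>pair_pmf A B) = (\<integral>\<^sup>+z. case_prod f z \<partial>map_pmf (\<lambda>(x, y). (y, x)) (pair_pmf B A))"
    by (simp add: pair_commute_pmf[symmetric])
  thus ?thesis by (simp add: nn_integral_pair_pmf' case_prod_unfold)
qed

lemma nn_integral_Pi_pmf_component:
  assumes "finite A" "x \<in> A"
  shows "(\<integral>\<^sup>+f. \<phi> (f x) \<partial>Pi_pmf A d p) = (\<integral>\<^sup>+y. (\<phi> y :: ennreal) \<partial>measure_pmf (p x))"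
proof -
  have "(\<integral>\<^sup>+f. \<phi> (f x) \<partial>Pi_pmf A d p) = (\<integral>\<^sup>+y. \<phi> y \<partial>map_pmf (\<lambda>f. f x) (Pi_pmf A d p))"
    by simp
  also have "\<dots> = (\<integral>\<^sup>+y. \<phi> y \<partial>p x)"
    by (subst Pi_pmf_component) (use assms in auto)
  finally show ?thesis .
qed

lemma nn_integral_Pi_pmf_two_components:
  assumes "finite A" "x \<in> A" "x' \<in> A" "x \<noteq> x'"
  shows "(\<integral>\<^sup>+f. \<phi> (f x) (f x') \<partial>Pi_pmf A d p) =
    (\<integral>\<^sup>+y. \<integral>\<^sup>+y'. (\<phi> y y' :: ennreal) \<partial>measure_pmf (p x') \<partial>measure_pmf (p x))"
proof -
  have "Pi_pmf A d p = Pi_pmf (insert x (A - {x})) d p"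
    using assms by (simp add: insert_absorb)
  also have "\<dots> = map_pmf (\<lambda>(y, f). f(x := y)) (pair_pmf (p x) (Pi_pmf (A - {x}) d p))"
    using assms by (intro Pi_pmf_insert) auto
  finally have "(\<integral>\<^sup>+f. \<phi> (f x) (f x') \<partial>Pi_pmf A d p) =
      (\<integral>\<^sup>+y. \<integral>\<^sup>+f. \<phi> y (f x') \<partial>Pi_pmf (A - {x}) d p \<partial>p x)"
    using assms by (simp add: nn_integral_pair_pmf' case_prod_unfold)
  also have "\<dots> = (\<integral>\<^sup>+y. \<integral>\<^sup>+y'. \<phi> y y' \<partial>p x' \<partial>p x)"
    using assms by (intro nn_integral_cong nn_integral_Pi_pmf_component) auto
  finally show ?thesis .
qed

text \<open>Change of measure: where \<open>T\<close> holds, \<open>p\<close> has density at most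
  1/t with respect to \<open>q\<close>. A codeword drawn blindly from \<open>p\<close> thus behaves,
  when accepted, like an output of the test channel, up to the factor 1/t.\<close>

lemma nn_integral_pmf_density_mono:
  assumes "t > 0" "\<And>h. T h \<Longrightarrow> t * pmf p h \<le> pmf q h"
  shows "(\<integral>\<^sup>+h. of_bool (T h) * \<phi> h \<partial>measure_pmf p) \<le> ennreal (1 / t) * (\<integral>\<^sup>+h. \<phi> h \<partial>measure_pmf q)"
proof -
  have "(\<integral>\<^sup>+h. of_bool (T h) * \<phi> h \<partial>p) = (\<integral>\<^sup>+h. ennreal (pmf p h) * (of_bool (T h) * \<phi> h) \<partial>count_space UNIV)"
    by (rule nn_integral_measure_pmf)
  also have "\<dots> \<le> (\<integral>\<^sup>+h. ennreal (1 / t) * (ennreal (pmf q h) * \<phi> h) \<partial>count_space UNIV)"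
  proof (intro nn_integral_mono)
    fix h
    show "ennreal (pmf p h) * (of_bool (T h) * \<phi> h) \<le> ennreal (1 / t) * (ennreal (pmf q h) * \<phi> h)"
    proof (cases "T h")
      case True
      have "pmf p h \<le> 1 / t * pmf q h"
        using assms(2)[OF True] assms(1) by (simp add: field_simps)
      hence "ennreal (pmf p h) \<le> ennreal (1 / t) * ennreal (pmf q h)"
        using assms(1) by (simp add: ennreal_mult[symmetric] ennreal_leI del: ennreal_mult)
      thus ?thesis using True by (simp add: mult_right_mono flip: mult.assoc)
    qed simp
  qed
  also have "\<dots> = ennreal (1 / t) * (\<integral>\<^sup>+h. \<phi> h \<partial>q)"
    by (simp add: nn_integral_cmult nn_integral_measure_pmf[of q])
  finally show ?thesis .
qed

lemma emeasure_pmf_density_le: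
  assumes "t > 0" "\<And>z. z \<in> S \<Longrightarrow> t * pmf p z \<le> pmf q z"
  shows "emeasure (measure_pmf p) S \<le> ennreal (1 / t)"
proof -
  have "emeasure p S = (\<integral>\<^sup>+z. of_bool (z \<in> S) * 1 \<partial>p)"
    using emeasure_pmf_of_bool[of p "\<lambda>z. z \<in> S"] by simp
  also have "\<dots> \<le> ennreal (1 / t) * (\<integral>\<^sup>+z. 1 \<partial>q)"
    by (rule nn_integral_pmf_density_mono) (use assms in auto)
  also have "(\<integral>\<^sup>+z. 1 \<partial>q) = 1" by simp
  finally show ?thesis by simp
qed

text \<open>Index 0 reports that no codeword was accepted; it lies outside the domain {1..L} of the
  codebook.\<close>

definition pick :: "('r \<Rightarrow> 'w \<Rightarrow> 'h \<Rightarrow> bool) \<Rightarrow> nat \<Rightarrow> (nat \<Rightarrow> 'h) \<Rightarrow> 'r \<Rightarrow> 'w \<Rightarrow> nat" where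
  "pick T L c r w = (if \<exists>l\<in>{1..L}. T r w (c l) then SOME l. l \<in> {1..L} \<and> T r w (c l) else 0)"

lemma pick_accepted:
  assumes "pick T L c r w \<noteq> 0"
  shows "pick T L c r w \<in> {1..L}" "T r w (c (pick T L c r w))"
proof -
  have ex: "\<exists>l. l \<in> {1..L} \<and> T r w (c l)" using assms by (auto simp: pick_def split: if_splits)
  hence "pick T L c r w = (SOME l. l \<in> {1..L} \<and> T r w (c l))" by (auto simp: pick_def)
  with someI_ex[OF ex] show "pick T L c r w \<in> {1..L}" "T r w (c (pick T L c r w))" by auto
qed

lemma pick_le: "pick T L c r w \<le> L"
  using pick_accepted(1)[of T L c r w] by (cases "pick T L c r w = 0") auto

lemma pick_eq_0_iff: "pick T L c r w = 0 \<longleftrightarrow> (\<forall>l\<in>{1..L}. \<not> T r w (c l))"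
proof
  assume "pick T L c r w = 0"
  moreover have "(SOME l. l \<in> {1..L} \<and> T r w (c l)) \<in> {1..L}" if "\<exists>l\<in>{1..L}. T r w (c l)"
    by (rule someI2_ex) (use that in auto)
  ultimately show "\<forall>l\<in>{1..L}. \<not> T r w (c l)"
    by (auto simp: pick_def split: if_splits)
qed (auto simp: pick_def)

abbreviation codebook_pmf :: "nat \<Rightarrow> 'h pmf \<Rightarrow> (nat \<Rightarrow> 'h) pmf" where
  "codebook_pmf L p \<equiv> Pi_pmf {1..L} undefined (\<lambda>_. p)"

lemma nn_integral_codebook_sum:
  "(\<integral>\<^sup>+c. (\<Sum>l\<in>{1..L}. \<phi> (c l)) \<partial>codebook_pmf L p) = of_nat L * (\<integral>\<^sup>+h. (\<phi> h :: ennreal) \<partial>measure_pmf p)"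
  by (simp add: nn_integral_sum nn_integral_Pi_pmf_component[where p="\<lambda>_. p"])

text \<open>
  Dropping the requirement that the other codewords are rejected makes the picked codeword
  independent of them, at the price of the factor \<open>L / t\<close>.
\<close>

lemma picked_codeword_bound:
  fixes U :: "'u pmf"
  assumes t: "t > 0" and T: "\<And>r w h. T r w h \<Longrightarrow> t * pmf p h \<le> pmf (q r w) h"
  shows "(\<integral>\<^sup>+c. \<integral>\<^sup>+u. of_bool (pick T L c (r u) (w u) \<noteq> 0) * \<phi> u (c (pick T L c (r u) (w u))) \<partial>U
       \<partial>codebook_pmf L p)
    \<le> ennreal (real L / t) * (\<integral>\<^sup>+u. \<integral>\<^sup>+h. \<phi> u h \<partial>q (r u) (w u) \<partial>U)"
proof -
  let ?pk = "\<lambda>c u. pick T L c (r u) (w u)"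
  have "(\<integral>\<^sup>+c. \<integral>\<^sup>+u. of_bool (?pk c u \<noteq> 0) * \<phi> u (c (?pk c u)) \<partial>U \<partial>codebook_pmf L p)
     = (\<integral>\<^sup>+u. \<integral>\<^sup>+c. of_bool (?pk c u \<noteq> 0) * \<phi> u (c (?pk c u)) \<partial>codebook_pmf L p \<partial>U)"
    by (rule nn_integral_pmf_commute)
  also have "\<dots> \<le> (\<integral>\<^sup>+u. ennreal (real L / t) * (\<integral>\<^sup>+h. \<phi> u h \<partial>q (r u) (w u)) \<partial>U)"
  proof (intro nn_integral_mono)
    fix u
    have "(\<integral>\<^sup>+c. of_bool (?pk c u \<noteq> 0) * \<phi> u (c (?pk c u)) \<partial>codebook_pmf L p)
      \<le> (\<integral>\<^sup>+c. (\<Sum>l\<in>{1..L}. of_bool (T (r u) (w u) (c l)) * \<phi> u (c l)) \<partial>codebook_pmf L p)"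
    proof (intro nn_integral_mono)
      fix c
      show "of_bool (?pk c u \<noteq> 0) * \<phi> u (c (?pk c u)) \<le> (\<Sum>l\<in>{1..L}. of_bool (T (r u) (w u) (c l)) * \<phi> u (c l))"
      proof (cases "?pk c u = 0")
        case False
        have "of_bool (?pk c u \<noteq> 0) * \<phi> u (c (?pk c u)) = of_bool (T (r u) (w u) (c (?pk c u))) * \<phi> u (c (?pk c u))"
          using pick_accepted(2)[OF False] False by simp
        also have "\<dots> \<le> (\<Sum>l\<in>{1..L}. of_bool (T (r u) (w u) (c l)) * \<phi> u (c l))"
          by (rule member_le_sum[where f="\<lambda>l. of_bool (T (r u) (w u) (c l)) * \<phi> u (c l)"])
            (use pick_accepted(1)[OF False] in auto)
        finally show ?thesis .
      qed simp
    qed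
    also have "\<dots> = of_nat L * (\<integral>\<^sup>+h. of_bool (T (r u) (w u) h) * \<phi> u h \<partial>p)"
      by (rule nn_integral_codebook_sum)
    also have "\<dots> \<le> of_nat L * (ennreal (1 / t) * (\<integral>\<^sup>+h. \<phi> u h \<partial>q (r u) (w u)))"
      by (intro mult_left_mono nn_integral_pmf_density_mono t T) auto
    also have "\<dots> = ennreal (real L / t) * (\<integral>\<^sup>+h. \<phi> u h \<partial>q (r u) (w u))"
      using t by (simp add: ennreal_of_nat_eq_real_of_nat ennreal_mult[symmetric] flip: mult.assoc)
    finally show "(\<integral>\<^sup>+c. of_bool (?pk c u \<noteq> 0) * \<phi> u (c (?pk c u)) \<partial>codebook_pmf L p) \<le> \<dots>" .
  qed
  also have "\<dots> = ennreal (real L / t) * (\<integral>\<^sup>+u. \<integral>\<^sup>+h. \<phi> u h \<partial>q (r u) (w u) \<partial>U)"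
    by (simp add: nn_integral_cmult)
  finally show ?thesis .
qed

text \<open>Convexity of the exponential: the chord between 0 and \<open>- s\<close> with weights 1
  - A and A, where the second weight is then bounded by 1.\<close>

lemma exp_chord_bound:
  fixes s A :: real
  assumes "0 \<le> A" "A \<le> 1"
  shows "exp (- (s * A)) \<le> (1 - A) + exp (- s)"
proof -
  have "exp ((1 - A) *\<^sub>R 0 + A *\<^sub>R (- s)) \<le> (1 - A) * exp 0 + A * exp (- s)"
    using assms by (intro convex_onD[OF exp_convex]) auto
  also have "\<dots> \<le> (1 - A) + 1 * exp (- s)"
    using assms by (intro add_mono mult_right_mono) auto
  finally show ?thesis by (simp add: mult.commute)
qed

text \<open>A covering bound averaged over \<open>U\<close>, so that no typicality of the individual
  source word is required. With A the mass of \<open>T'\<close> under the test channel, one random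
  codeword is accepted with probability at least A/t'. All L fail with probability at most
  exp(-(L/t')A), and the chord bound separates the failure 1 - A of the test channel from
  exp(-L/t').\<close>

lemma pick_fails_bound:
  fixes U :: "'u pmf"
  assumes t': "t' > 0" and T': "\<And>r w h. T' r w h \<Longrightarrow> T r w h \<and> pmf (q r w) h \<le> t' * pmf p h"
  shows "(\<integral>\<^sup>+c. emeasure (measure_pmf U) {u. pick T L c (r u) (w u) = 0} \<partial>codebook_pmf L p)
    \<le> (\<integral>\<^sup>+u. emeasure (measure_pmf (q (r u) (w u))) {h. \<not> T' (r u) (w u) h} \<partial>U)
      + ennreal (exp (- (real L / t')))"
proof -
  let ?pk = "\<lambda>c u. pick T L c (r u) (w u)"
  have "(\<integral>\<^sup>+c. emeasure U {u. ?pk c u = 0} \<partial>codebook_pmf L p)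
     = (\<integral>\<^sup>+u. emeasure (codebook_pmf L p) {c. ?pk c u = 0} \<partial>U)"
    unfolding emeasure_pmf_of_bool by (rule nn_integral_pmf_commute)
  also have "\<dots> \<le> (\<integral>\<^sup>+u. emeasure (q (r u) (w u)) {h. \<not> T' (r u) (w u) h} + ennreal (exp (- (real L / t'))) \<partial>U)"
  proof (intro nn_integral_mono)
    fix u
    define A where "A = measure_pmf.prob (q (r u) (w u)) {h. T' (r u) (w u) h}"
    define x where "x = measure_pmf.prob p {h. T (r u) (w u) h}"
    have A01: "0 \<le> A" "A \<le> 1" and x01: "0 \<le> x" "x \<le> 1" by (auto simp: A_def x_def)
    have "ennreal A = emeasure (q (r u) (w u)) {h. T' (r u) (w u) h}"
      by (simp add: A_def measure_pmf.emeasure_eq_measure)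
    also have "\<dots> = (\<integral>\<^sup>+h. of_bool (T' (r u) (w u) h) * of_bool (T (r u) (w u) h) \<partial>q (r u) (w u))"
      unfolding emeasure_pmf_of_bool using T' by (intro nn_integral_cong) auto
    \<comment> \<open>The change of measure is used backwards here, from the test channel to the
      codeword law, with threshold 1/t'.\<close>
    also have "\<dots> \<le> ennreal (1 / (1 / t')) * (\<integral>\<^sup>+h. of_bool (T (r u) (w u) h) \<partial>p)"
      using t' T' by (intro nn_integral_pmf_density_mono) (auto simp: field_simps)
    also have "(\<integral>\<^sup>+h. of_bool (T (r u) (w u) h) \<partial>p) = ennreal x"
      unfolding emeasure_pmf_of_bool[symmetric]
      by (simp add: x_def measure_pmf.emeasure_eq_measure)
    finally have "A \<le> t' * x"
      using t' x01 by (simp add: ennreal_mult[symmetric] ennreal_le_iff)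
    hence "A / t' \<le> x" using t' by (simp add: field_simps)
    have "emeasure (codebook_pmf L p) {c. ?pk c u = 0}
        = emeasure (codebook_pmf L p) (Pi {1..L} (\<lambda>_. - {h. T (r u) (w u) h}))"
      by (rule arg_cong[where f="emeasure _"]) (auto simp: pick_eq_0_iff Pi_def)
    also have "\<dots> = ennreal ((1 - x) ^ L)"
      by (simp add: measure_pmf.emeasure_eq_measure measure_Pi_pmf_Pi x_def measure_pmf.prob_compl[of _ p, simplified] Compl_eq_Diff_UNIV)
    also have "\<dots> \<le> ennreal (exp (- (real L / t' * A)))"
    proof (intro ennreal_leI)
      have "(1 - x) ^ L \<le> exp (- x) ^ L"
        using x01 exp_ge_add_one_self[of "- x"] by (intro power_mono) auto
      also have "\<dots> = exp (- (real L * x))" by (simp add: exp_of_nat_mult[symmetric])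
      also have "\<dots> \<le> exp (- (real L / t' * A))"
        using mult_left_mono[OF \<open>A / t' \<le> x\<close>, of "real L"] by simp
      finally show "(1 - x) ^ L \<le> exp (- (real L / t' * A))" .
    qed
    also have "\<dots> \<le> ennreal ((1 - A) + exp (- (real L / t')))"
      by (intro ennreal_leI exp_chord_bound A01)
    also have "\<dots> = ennreal (1 - A) + ennreal (exp (- (real L / t')))"
      using A01 by (intro ennreal_plus) auto
    also have "1 - A = measure_pmf.prob (q (r u) (w u)) {h. \<not> T' (r u) (w u) h}"
      unfolding A_def by (subst measure_pmf.prob_compl[symmetric]) (auto intro!: arg_cong[where f="measure _"])
    finally show "emeasure (codebook_pmf L p) {c. ?pk c u = 0}
       \<le> emeasure (q (r u) (w u)) {h. \<not> T' (r u) (w u) h} + ennreal (exp (- (real L / t')))"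
      by (simp add: measure_pmf.emeasure_eq_measure)
  qed
  also have "\<dots> = (\<integral>\<^sup>+u. emeasure (q (r u) (w u)) {h. \<not> T' (r u) (w u) h} \<partial>U)
      + ennreal (exp (- (real L / t')))"
    by (simp add: nn_integral_add)
  finally show ?thesis .
qed

subsection \<open>Costs of the transitions between right and wrong indices\<close>

text \<open>
  A user sees the law \<open>V\<close> of (desired input, side information, relay input, quantized relay output).
  The four projections below are the laws of these data along a wrong message, according to which of
  the relay input and the quantized output belong to a wrong index.
\<close>

type_synonym ('a, 's, 'r, 'h) view = "'a \<times> 's \<times> 'r \<times> 'h"

definition with_copies :: "'a pmf \<Rightarrow> 'r pmf \<Rightarrow> 'h pmf \<Rightarrow> ('a, 's, 'r, 'h) view pmf \<Rightarrow>
    ('a \<times> ('a, 's, 'r, 'h) view \<times> 'r \<times> 'h) pmf" where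
  "with_copies pa pr ph V = pair_pmf pa (pair_pmf V (pair_pmf pr ph))"

fun wrong_input :: "'a \<times> ('a, 's, 'r, 'h) view \<times> 'r \<times> 'h \<Rightarrow> 'a \<times> 's \<times> 'r \<times> 'h" where
  "wrong_input (a', (a, s, r, h), r', h') = (a', s, r, h)"
fun wrong_quantized :: "'a \<times> ('a, 's, 'r, 'h) view \<times> 'r \<times> 'h \<Rightarrow> 'a \<times> 's \<times> 'r \<times> 'h" where
  "wrong_quantized (a', (a, s, r, h), r', h') = (a', s, r, h')"
fun wrong_all :: "'a \<times> ('a, 's, 'r, 'h) view \<times> 'r \<times> 'h \<Rightarrow> 'a \<times> 's \<times> 'r \<times> 'h" where
  "wrong_all (a', (a, s, r, h), r', h') = (a', s, r', h')"
fun wrong_relay :: "'a \<times> ('a, 's, 'r, 'h) view \<times> 'r \<times> 'h \<Rightarrow> 'a \<times> 's \<times> 'r \<times> 'h" where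
  "wrong_relay (a', (a, s, r, h), r', h') = (a', s, r', h)"

text \<open>The view as it would be if the relay output went through the test channel instead of the
  codebook. The cost bounds compare the actual codewords with this ideal law.\<close>

definition quantize :: "('r \<Rightarrow> 'w \<Rightarrow> 'h pmf) \<Rightarrow> ('a \<times> 's \<times> 'r \<times> 'w) pmf \<Rightarrow> ('a, 's, 'r, 'h) view pmf" where
  "quantize q U = bind_pmf U (\<lambda>(a, s, r, w). map_pmf (\<lambda>h. (a, s, r, h)) (q r w))"

definition miss_cost :: "('a, 's, 'r, 'h) view set \<Rightarrow> ('r \<Rightarrow> 'w \<Rightarrow> nat) \<Rightarrow> (nat \<Rightarrow> 'h) \<Rightarrow>
    ('a \<times> 's \<times> 'r \<times> 'w) pmf \<Rightarrow> ennreal" where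
  "miss_cost S g c U = emeasure (measure_pmf U) {(a, s, r, w). \<not> (g r w \<noteq> 0 \<and> (a, s, r, c (g r w)) \<in> S)}"

text \<open>The weight of all one-block extensions of a path, \<open>g\<close> being the true next
  index. The sum keeps \<open>g\<close> among its indices: it is then independent of the relay's
  choice, so the codewords in it need no conditioning on not having been picked.\<close>

definition branch :: "ennreal \<Rightarrow> nat \<Rightarrow> ('a, 's, 'r, 'h) view set \<Rightarrow> (nat \<Rightarrow> 'h) \<Rightarrow> 'a \<Rightarrow> 's \<Rightarrow> 'r \<Rightarrow> nat \<Rightarrow> ennreal" where
  "branch \<kappa> L S c a s r g = of_bool (g \<noteq> 0 \<and> (a, s, r, c g) \<in> S)
      + \<kappa> * (\<Sum>l'\<le>L. of_bool (l' \<noteq> 0 \<and> (a, s, r, c l') \<in> S))"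

definition leave_cost :: "ennreal \<Rightarrow> nat \<Rightarrow> ('a, 's, 'r, 'h) view set \<Rightarrow> ('r \<Rightarrow> 'w \<Rightarrow> nat) \<Rightarrow> (nat \<Rightarrow> 'h) \<Rightarrow>
    'a pmf \<Rightarrow> ('a \<times> 's \<times> 'r \<times> 'w) pmf \<Rightarrow> ennreal" where
  "leave_cost \<kappa> L S g c pa U = (\<integral>\<^sup>+a'. \<integral>\<^sup>+(a, s, r, w). branch \<kappa> L S c a' s r (g r w) \<partial>U \<partial>pa)"

text \<open>The codeword of a wrong relay index is a copy \<open>r'\<close> independent of the sent
  word \<open>r\<close>, while the true next index is still computed from \<open>r\<close>.\<close>

definition return_cost :: "ennreal \<Rightarrow> nat \<Rightarrow> ('a, 's, 'r, 'h) view set \<Rightarrow> ('r \<Rightarrow> 'w \<Rightarrow> nat) \<Rightarrow> (nat \<Rightarrow> 'h) \<Rightarrow>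
    'a pmf \<Rightarrow> 'r pmf \<Rightarrow> ('a \<times> 's \<times> 'r \<times> 'w) pmf \<Rightarrow> ennreal" where
  "return_cost \<kappa> L S g c pa pr U =
     (\<integral>\<^sup>+a'. \<integral>\<^sup>+r'. \<integral>\<^sup>+(a, s, r, w). branch \<kappa> L S c a' s r' (g r w) \<partial>U \<partial>pr \<partial>pa)"

text \<open>Three causes add up: the test channel leaves the region \<open>T'\<close>, the codebook
  fails to cover although it should, or the accepted codeword does not fit the user's view. Only the
  last one pays the change of measure L/t.\<close>

lemma expected_miss_cost:
  fixes U :: "('a \<times> 's \<times> 'r \<times> 'w) pmf" and q :: "'r \<Rightarrow> 'w \<Rightarrow> 'h pmf"
  assumes t: "t > 0" "t' > 0" and T: "\<And>r w h. T r w h \<Longrightarrow> t * pmf p h \<le> pmf (q r w) h"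
    and T': "\<And>r w h. T' r w h \<Longrightarrow> T r w h \<and> pmf (q r w) h \<le> t' * pmf p h"
  shows "(\<integral>\<^sup>+c. miss_cost S (pick T L c) c U \<partial>codebook_pmf L p)
    \<le> (\<integral>\<^sup>+(a, s, r, w). emeasure (measure_pmf (q r w)) {h. \<not> T' r w h} \<partial>U)
      + ennreal (exp (- (real L / t'))) + ennreal (real L / t) * emeasure (quantize q U) (- S)"
proof -
  define r w where "r = (\<lambda>(a :: 'a, s :: 's, r :: 'r, w :: 'w). r)" and "w = (\<lambda>(a :: 'a, s :: 's, r :: 'r, w :: 'w). w)"
  define \<phi> where "\<phi> = (\<lambda>(a :: 'a, s :: 's, r :: 'r, w :: 'w) h. of_bool ((a, s, r, h) \<notin> S) :: ennreal)"
  let ?pk = "\<lambda>c u. pick T L c (r u) (w u)"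
  have "miss_cost S (pick T L c) c U \<le> emeasure U {u. ?pk c u = 0}
     + (\<integral>\<^sup>+u. of_bool (?pk c u \<noteq> 0) * \<phi> u (c (?pk c u)) \<partial>U)" for c
    unfolding miss_cost_def case_prod_unfold emeasure_pmf_of_bool
    by (subst nn_integral_add[symmetric], simp, simp, intro nn_integral_mono)
      (auto simp: r_def w_def \<phi>_def)
  hence "(\<integral>\<^sup>+c. miss_cost S (pick T L c) c U \<partial>codebook_pmf L p) \<le>
     (\<integral>\<^sup>+c. emeasure U {u. ?pk c u = 0} + (\<integral>\<^sup>+u. of_bool (?pk c u \<noteq> 0) * \<phi> u (c (?pk c u)) \<partial>U)
        \<partial>codebook_pmf L p)"
    by (intro nn_integral_mono)
  also have "\<dots> = (\<integral>\<^sup>+c. emeasure U {u. ?pk c u = 0} \<partial>codebook_pmf L p) +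
     (\<integral>\<^sup>+c. \<integral>\<^sup>+u. of_bool (?pk c u \<noteq> 0) * \<phi> u (c (?pk c u)) \<partial>U \<partial>codebook_pmf L p)"
    by (rule nn_integral_add) auto
  also have "\<dots> \<le> ((\<integral>\<^sup>+u. emeasure (q (r u) (w u)) {h. \<not> T' (r u) (w u) h} \<partial>U) + ennreal (exp (- (real L / t'))))
     + ennreal (real L / t) * (\<integral>\<^sup>+u. \<integral>\<^sup>+h. \<phi> u h \<partial>q (r u) (w u) \<partial>U)"
    by (intro add_mono pick_fails_bound picked_codeword_bound t T T')
  also have "(\<integral>\<^sup>+u. \<integral>\<^sup>+h. \<phi> u h \<partial>q (r u) (w u) \<partial>U) = emeasure (quantize q U) (- S)"
    unfolding Compl_eq emeasure_pmf_of_bool quantize_def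
    by (simp add: case_prod_unfold \<phi>_def r_def w_def)
  finally show ?thesis by (simp add: r_def w_def case_prod_unfold)
qed

lemma emeasure_map_with_copies:
  "emeasure (map_pmf f (with_copies pa pr ph V)) S =
    (\<integral>\<^sup>+a. \<integral>\<^sup>+v. \<integral>\<^sup>+r. \<integral>\<^sup>+h. of_bool (f (a, v, r, h) \<in> S) \<partial>measure_pmf ph \<partial>measure_pmf pr \<partial>measure_pmf V \<partial>measure_pmf pa)"
  using emeasure_pmf_of_bool[of "map_pmf f (with_copies pa pr ph V)" "\<lambda>x. x \<in> S"]
  by (simp add: with_copies_def nn_integral_pair_pmf')

lemma sum_atMost_codewords:
  fixes L :: nat
  shows "(\<Sum>l\<le>L. of_bool (l \<noteq> 0 \<and> P l)) = (\<Sum>l\<in>{1..L}. of_bool (P l) :: ennreal)"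
proof -
  have "(\<Sum>l\<in>{1..L}. of_bool (P l) :: ennreal) = (\<Sum>l\<in>{1..L}. of_bool (l \<noteq> 0 \<and> P l))"
    by (intro sum.cong) auto
  also have "\<dots> = (\<Sum>l\<le>L. of_bool (l \<noteq> 0 \<and> P l))"
    by (intro sum.mono_neutral_left) auto
  finally show ?thesis ..
qed

text \<open>The term of the true index pays L/t for the dependence on the choice. In the sum over
  all indices, \<open>U\<close> is independent of the codebook, so each codeword simply has law
  \<open>p\<close>.\<close>

lemma expected_branch:
  fixes U :: "'u pmf" and q :: "'r \<Rightarrow> 'w \<Rightarrow> 'h pmf"
  assumes t: "t > 0" and T: "\<And>r w h. T r w h \<Longrightarrow> t * pmf p h \<le> pmf (q r w) h"
  shows "(\<integral>\<^sup>+c. \<integral>\<^sup>+u. branch \<kappa> L S c a' (s u) (r' u) (pick T L c (r u) (w u)) \<partial>measure_pmf U \<partial>codebook_pmf L p)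
    \<le> ennreal (real L / t) * (\<integral>\<^sup>+u. \<integral>\<^sup>+h. of_bool ((a', s u, r' u, h) \<in> S) \<partial>measure_pmf (q (r u) (w u)) \<partial>measure_pmf U)
      + \<kappa> * (of_nat L * (\<integral>\<^sup>+u. \<integral>\<^sup>+h. of_bool ((a', s u, r' u, h) \<in> S) \<partial>measure_pmf p \<partial>measure_pmf U))"
proof -
  let ?pk = "\<lambda>c u. pick T L c (r u) (w u)"
  have "(\<integral>\<^sup>+c. \<integral>\<^sup>+u. branch \<kappa> L S c a' (s u) (r' u) (?pk c u) \<partial>U \<partial>codebook_pmf L p) =
    (\<integral>\<^sup>+c. \<integral>\<^sup>+u. of_bool (?pk c u \<noteq> 0) * of_bool ((a', s u, r' u, c (?pk c u)) \<in> S) \<partial>U \<partial>codebook_pmf L p)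
    + \<kappa> * (\<integral>\<^sup>+c. \<integral>\<^sup>+u. (\<Sum>l\<in>{1..L}. of_bool ((a', s u, r' u, c l) \<in> S)) \<partial>U \<partial>codebook_pmf L p)"
    unfolding branch_def sum_atMost_codewords
    by (simp add: nn_integral_add nn_integral_cmult of_bool_conj del: sum_of_bool_eq)
  also have "(\<integral>\<^sup>+c. \<integral>\<^sup>+u. (\<Sum>l\<in>{1..L}. of_bool ((a', s u, r' u, c l) \<in> S)) \<partial>U \<partial>codebook_pmf L p)
    = (\<integral>\<^sup>+u. of_nat L * (\<integral>\<^sup>+h. of_bool ((a', s u, r' u, h) \<in> S) \<partial>p) \<partial>U)"
    by (subst nn_integral_pmf_commute) (intro nn_integral_cong nn_integral_codebook_sum)
  also have "\<dots> = of_nat L * (\<integral>\<^sup>+u. \<integral>\<^sup>+h. of_bool ((a', s u, r' u, h) \<in> S) \<partial>p \<partial>U)"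
    by (simp add: nn_integral_cmult)
  finally show ?thesis
    using picked_codeword_bound[where T=T and q=q and t=t and p=p and U=U and r=r and w=w and L=L
        and \<phi>="\<lambda>u h. of_bool ((a', s u, r' u, h) \<in> S)", OF t T]
    by (simp add: add_right_mono)
qed

text \<open>The path is at the true index, so the relay word is right: it stays on the true path
  (\<open>wrong_input\<close>) or takes an unrelated codeword
  (\<open>wrong_quantized\<close>).\<close>

lemma expected_leave_cost:
  fixes U :: "('a \<times> 's \<times> 'r \<times> 'w) pmf" and q :: "'r \<Rightarrow> 'w \<Rightarrow> 'h pmf"
  assumes t: "t > 0" and T: "\<And>r w h. T r w h \<Longrightarrow> t * pmf p h \<le> pmf (q r w) h"
  shows "(\<integral>\<^sup>+c. leave_cost \<kappa> L S (pick T L c) c pa U \<partial>codebook_pmf L p)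
    \<le> ennreal (real L / t) * emeasure (map_pmf wrong_input (with_copies pa pr p (quantize q U))) S
      + \<kappa> * (of_nat L * emeasure (map_pmf wrong_quantized (with_copies pa pr p (quantize q U))) S)"
proof -
  have "(\<integral>\<^sup>+c. leave_cost \<kappa> L S (pick T L c) c pa U \<partial>codebook_pmf L p) =
    (\<integral>\<^sup>+a'. \<integral>\<^sup>+c. \<integral>\<^sup>+u. branch \<kappa> L S c a' (fst (snd u)) (fst (snd (snd u))) (pick T L c (fst (snd (snd u))) (snd (snd (snd u))))
       \<partial>U \<partial>codebook_pmf L p \<partial>pa)"
    unfolding leave_cost_def case_prod_unfold by (rule nn_integral_pmf_commute)
  also have "\<dots> \<le> (\<integral>\<^sup>+a'. ennreal (real L / t) * (\<integral>\<^sup>+u. \<integral>\<^sup>+h. of_bool ((a', fst (snd u), fst (snd (snd u)), h) \<in> S)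
         \<partial>q (fst (snd (snd u))) (snd (snd (snd u))) \<partial>U)
      + \<kappa> * (of_nat L * (\<integral>\<^sup>+u. \<integral>\<^sup>+h. of_bool ((a', fst (snd u), fst (snd (snd u)), h) \<in> S) \<partial>p \<partial>U)) \<partial>pa)"
    by (intro nn_integral_mono expected_branch t T)
  also have "\<dots> = ennreal (real L / t) * emeasure (map_pmf wrong_input (with_copies pa pr p (quantize q U))) S
      + \<kappa> * (of_nat L * emeasure (map_pmf wrong_quantized (with_copies pa pr p (quantize q U))) S)"
    unfolding emeasure_map_with_copies quantize_def
    by (simp add: nn_integral_add nn_integral_cmult case_prod_unfold)
  finally show ?thesis .
qed

text \<open>The path enters the block with an unrelated relay word: it rejoins the true index
  (\<open>wrong_relay\<close>) or takes an unrelated codeword as well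
  (\<open>wrong_all\<close>).\<close>

lemma expected_return_cost:
  fixes U :: "('a \<times> 's \<times> 'r \<times> 'w) pmf" and q :: "'r \<Rightarrow> 'w \<Rightarrow> 'h pmf"
  assumes t: "t > 0" and T: "\<And>r w h. T r w h \<Longrightarrow> t * pmf p h \<le> pmf (q r w) h"
  shows "(\<integral>\<^sup>+c. return_cost \<kappa> L S (pick T L c) c pa pr U \<partial>codebook_pmf L p)
    \<le> ennreal (real L / t) * emeasure (map_pmf wrong_relay (with_copies pa pr p (quantize q U))) S
      + \<kappa> * (of_nat L * emeasure (map_pmf wrong_all (with_copies pa pr p (quantize q U))) S)"
proof -
  have "(\<integral>\<^sup>+c. return_cost \<kappa> L S (pick T L c) c pa pr U \<partial>codebook_pmf L p) =
    (\<integral>\<^sup>+a'. \<integral>\<^sup>+r'. \<integral>\<^sup>+c. \<integral>\<^sup>+u. branch \<kappa> L S c a' (fst (snd u)) r' (pick T L c (fst (snd (snd u))) (snd (snd (snd u))))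
       \<partial>U \<partial>codebook_pmf L p \<partial>pr \<partial>pa)"
    unfolding return_cost_def case_prod_unfold
    by (subst nn_integral_pmf_commute, intro nn_integral_cong nn_integral_pmf_commute)
  also have "\<dots> \<le> (\<integral>\<^sup>+a'. \<integral>\<^sup>+r'. ennreal (real L / t) * (\<integral>\<^sup>+u. \<integral>\<^sup>+h. of_bool ((a', fst (snd u), r', h) \<in> S)
         \<partial>q (fst (snd (snd u))) (snd (snd (snd u))) \<partial>U)
      + \<kappa> * (of_nat L * (\<integral>\<^sup>+u. \<integral>\<^sup>+h. of_bool ((a', fst (snd u), r', h) \<in> S) \<partial>p \<partial>U)) \<partial>pr \<partial>pa)"
    by (intro nn_integral_mono expected_branch t T)
  also have "\<dots> = ennreal (real L / t) * emeasure (map_pmf wrong_relay (with_copies pa pr p (quantize q U))) S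
      + \<kappa> * (of_nat L * emeasure (map_pmf wrong_all (with_copies pa pr p (quantize q U))) S)"
    unfolding emeasure_map_with_copies quantize_def
    by (simp add: nn_integral_add nn_integral_cmult case_prod_unfold nn_integral_pmf_commute[where A=pr])
  finally show ?thesis .
qed

subsection \<open>Random block codes\<close>

type_synonym ('a, 'b, 'r) block_code = "(nat \<Rightarrow> 'a) \<times> (nat \<Rightarrow> 'b) \<times> (nat \<Rightarrow> 'r)"

text \<open>The relay codebook has a word for index 0, which is sent in the first block and after a
  failed quantization. The values \<open>da\<close>, \<open>db\<close> and \<open>dr\<close> only
  fill the functions outside the codebooks.\<close>

definition block_code_pmf :: "nat \<Rightarrow> nat \<Rightarrow> nat \<Rightarrow> 'a pmf \<Rightarrow> 'b pmf \<Rightarrow> 'r pmf \<Rightarrow> 'a \<Rightarrow> 'b \<Rightarrow> 'r \<Rightarrow>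
    ('a, 'b, 'r) block_code pmf" where
  "block_code_pmf M1 M2 L p1 p2 pr da db dr =
     pair_pmf (Pi_pmf {1..M1} da (\<lambda>_. p1)) (pair_pmf (Pi_pmf {1..M2} db (\<lambda>_. p2)) (Pi_pmf {..L} dr (\<lambda>_. pr)))"

lemma nn_integral_block_code:
  assumes "m1 \<in> {1..M1}" "m2 \<in> {1..M2}" "l \<le> L"
  shows "(\<integral>\<^sup>+(f1, f2, F). G (f1 m1) (f2 m2) (F l) \<partial>block_code_pmf M1 M2 L p1 p2 pr da db dr) =
    (\<integral>\<^sup>+x1. \<integral>\<^sup>+x2. \<integral>\<^sup>+xr. (G x1 x2 xr :: ennreal) \<partial>pr \<partial>p2 \<partial>p1)"
proof -
  have r: "(\<integral>\<^sup>+F. G x1 x2 (F l) \<partial>Pi_pmf {..L} dr (\<lambda>_. pr)) = (\<integral>\<^sup>+xr. G x1 x2 xr \<partial>pr)" for x1 x2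
    by (rule nn_integral_Pi_pmf_component[where \<phi>="G x1 x2"]) (use assms in auto)
  have b: "(\<integral>\<^sup>+f2. \<integral>\<^sup>+xr. G x1 (f2 m2) xr \<partial>pr \<partial>Pi_pmf {1..M2} db (\<lambda>_. p2)) =
      (\<integral>\<^sup>+x2. \<integral>\<^sup>+xr. G x1 x2 xr \<partial>pr \<partial>p2)" for x1
    by (rule nn_integral_Pi_pmf_component[where \<phi>="\<lambda>x2. \<integral>\<^sup>+xr. G x1 x2 xr \<partial>pr"]) (use assms in auto)
  have "(\<integral>\<^sup>+f1. \<integral>\<^sup>+x2. \<integral>\<^sup>+xr. G (f1 m1) x2 xr \<partial>pr \<partial>p2 \<partial>Pi_pmf {1..M1} da (\<lambda>_. p1)) =
      (\<integral>\<^sup>+x1. \<integral>\<^sup>+x2. \<integral>\<^sup>+xr. G x1 x2 xr \<partial>pr \<partial>p2 \<partial>p1)"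
    by (rule nn_integral_Pi_pmf_component[where \<phi>="\<lambda>x1. \<integral>\<^sup>+x2. \<integral>\<^sup>+xr. G x1 x2 xr \<partial>pr \<partial>p2"]) (use assms in auto)
  thus ?thesis
    by (simp add: block_code_pmf_def nn_integral_pair_pmf' r b del: One_nat_def)
qed

lemma nn_integral_Pi_pmf_fresh:
  assumes "finite A" "x \<in> A" "x' \<in> A" "x \<noteq> x'"
  shows "(\<integral>\<^sup>+f. \<phi> (f x) (f x') \<partial>Pi_pmf A d p) =
    (\<integral>\<^sup>+y'. \<integral>\<^sup>+f. (\<phi> (f x) y' :: ennreal) \<partial>Pi_pmf A d p \<partial>measure_pmf (p x'))"
proof -
  have "(\<integral>\<^sup>+f. \<phi> (f x) (f x') \<partial>Pi_pmf A d p) =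
    (\<integral>\<^sup>+y'. \<integral>\<^sup>+y. \<phi> y y' \<partial>p x \<partial>p x')"
    by (subst nn_integral_Pi_pmf_two_components[OF assms]) (rule nn_integral_pmf_commute)
  also have "\<dots> = (\<integral>\<^sup>+y'. \<integral>\<^sup>+f. \<phi> (f x) y' \<partial>Pi_pmf A d p \<partial>p x')"
    by (intro nn_integral_cong nn_integral_Pi_pmf_component[symmetric, where \<phi>="\<lambda>y. \<phi> y y'" for y']) (use assms in auto)
  finally show ?thesis .
qed

text \<open>The codeword of a wrong message is independent of everything that determines the channel
  output: the true codeword and the codebooks of the other user and the relay.\<close>

lemma nn_integral_block_code_fresh:
  assumes "m1 \<in> {1..M1}" "m' \<in> {1..M1}" "m' \<noteq> m1"
  shows "(\<integral>\<^sup>+(f1, f2, F). G (f1 m1) (f1 m') f2 F \<partial>block_code_pmf M1 M2 L p1 p2 pr da db dr) =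
    (\<integral>\<^sup>+x'. \<integral>\<^sup>+(f1, f2, F). (G (f1 m1) x' f2 F :: ennreal) \<partial>block_code_pmf M1 M2 L p1 p2 pr da db dr \<partial>p1)"
  unfolding block_code_pmf_def nn_integral_pair_pmf' prod.case
  by (rule nn_integral_Pi_pmf_fresh[where p="\<lambda>_. p1" and x'=m']) (use assms in auto)

lemma nn_integral_block_code_fresh_relay:
  assumes "l \<le> L" "k \<le> L" "k \<noteq> l"
  shows "(\<integral>\<^sup>+(f1, f2, F). G f1 f2 (F l) (F k) \<partial>block_code_pmf M1 M2 L p1 p2 pr da db dr) =
    (\<integral>\<^sup>+x'. \<integral>\<^sup>+(f1, f2, F). (G f1 f2 (F l) x' :: ennreal) \<partial>block_code_pmf M1 M2 L p1 p2 pr da db dr \<partial>pr)"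
proof -
  have "(\<integral>\<^sup>+F. G f1 f2 (F l) (F k) \<partial>Pi_pmf {..L} dr (\<lambda>_. pr)) =
      (\<integral>\<^sup>+x'. \<integral>\<^sup>+F. G f1 f2 (F l) x' \<partial>Pi_pmf {..L} dr (\<lambda>_. pr) \<partial>pr)" for f1 f2
    by (rule nn_integral_Pi_pmf_fresh[where p="\<lambda>_. pr" and x'=k]) (use assms in auto)
  thus ?thesis
    unfolding block_code_pmf_def nn_integral_pair_pmf' prod.case
    by (simp add: nn_integral_pmf_commute[where B=pr] del: One_nat_def)
qed

section \<open>Blocks as a Markov chain in the relay index\<close>

definition block_kernel :: "('a \<times> 'b \<times> 'r \<Rightarrow> ('u \<times> 'v \<times> 'w) pmf) \<Rightarrow> ('a, 'b, 'r) block_code pmf \<Rightarrow>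
    nat \<Rightarrow> nat \<Rightarrow> nat \<Rightarrow> (('a, 'b, 'r) block_code \<times> ('u \<times> 'v \<times> 'w)) pmf" where
  "block_kernel W cp m1 m2 l = bind_pmf cp (\<lambda>(f1, f2, F). map_pmf (Pair (f1, f2, F)) (W (f1 m1, f2 m2, F l)))"

definition relay_next :: "('r \<Rightarrow> 'w \<Rightarrow> nat) \<Rightarrow> nat \<Rightarrow> ('a, 'b, 'r) block_code \<times> ('u \<times> 'v \<times> 'w) \<Rightarrow> nat" where
  "relay_next g l = (\<lambda>((f1, f2, F), (y1, y2, yr)). g (F l) yr)"

primrec block_run :: "('a \<times> 'b \<times> 'r \<Rightarrow> ('u \<times> 'v \<times> 'w) pmf) \<Rightarrow> ('r \<Rightarrow> 'w \<Rightarrow> nat) \<Rightarrow> nat \<Rightarrow> nat \<Rightarrow>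
    ('a, 'b, 'r) block_code list \<Rightarrow> (('u \<times> 'v \<times> 'w) list \<times> nat) pmf" where
  "block_run W g m1 m2 [] = return_pmf ([], 0)"
| "block_run W g m1 m2 (c # cs) = bind_pmf (block_run W g m1 m2 cs) (\<lambda>(ys, l).
     map_pmf (\<lambda>y. (y # ys, relay_next g l (c, y))) (W (fst c m1, fst (snd c) m2, snd (snd c) l)))"

text \<open>Earlier blocks do not depend on later codes, so drawing each code just before its block
  is the same as drawing all codes in advance. Bounds for the chain thereby become averages over
  lists of codes.\<close>

lemma chain_block_kernel:
  "chain (block_kernel W cp m1 m2) (relay_next g) b =
    bind_pmf (replicate_pmf b cp) (\<lambda>cs. map_pmf (\<lambda>(ys, l). (zip cs ys, l)) (block_run W g m1 m2 cs))"
proof (induction b)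
  case (Suc b)
  have "chain (block_kernel W cp m1 m2) (relay_next g) (Suc b) =
    bind_pmf (replicate_pmf b cp) (\<lambda>cs. bind_pmf (block_run W g m1 m2 cs) (\<lambda>(ys, l).
      bind_pmf cp (\<lambda>c. map_pmf (\<lambda>y. (zip (c # cs) (y # ys), relay_next g l (c, y))) (W (fst c m1, fst (snd c) m2, snd (snd c) l)))))"
    by (simp add: Suc.IH bind_assoc_pmf bind_map_pmf block_kernel_def map_bind_pmf map_pmf_comp o_def case_prod_unfold)
  also have "\<dots> = bind_pmf (replicate_pmf b cp) (\<lambda>cs. bind_pmf cp (\<lambda>c. bind_pmf (block_run W g m1 m2 cs) (\<lambda>(ys, l).
      map_pmf (\<lambda>y. (zip (c # cs) (y # ys), relay_next g l (c, y))) (W (fst c m1, fst (snd c) m2, snd (snd c) l)))))"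
    unfolding case_prod_unfold by (intro bind_pmf_cong refl bind_commute_pmf)
  also have "\<dots> = bind_pmf cp (\<lambda>c. bind_pmf (replicate_pmf b cp) (\<lambda>cs. bind_pmf (block_run W g m1 m2 cs) (\<lambda>(ys, l).
      map_pmf (\<lambda>y. (zip (c # cs) (y # ys), relay_next g l (c, y))) (W (fst c m1, fst (snd c) m2, snd (snd c) l)))))"
    by (rule bind_commute_pmf)
  also have "\<dots> = bind_pmf (replicate_pmf (Suc b) cp) (\<lambda>cs. map_pmf (\<lambda>(ys, l). (zip cs ys, l)) (block_run W g m1 m2 cs))"
    by (simp add: bind_assoc_pmf bind_return_pmf map_bind_pmf map_pmf_comp o_def case_prod_unfold)
  finally show ?case .
qed (simp add: bind_return_pmf)

section \<open>Exchanging the two users\<close>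

fun swap3 :: "'a \<times> 'b \<times> 'c \<Rightarrow> 'b \<times> 'a \<times> 'c" where
  "swap3 (x, y, z) = (y, x, z)"

lemma swap3_simps [simp]: "fst (swap3 x) = fst (snd x)" "fst (snd (swap3 x)) = fst x" "snd (snd (swap3 x)) = snd (snd x)"
  by (cases x; simp)+

definition swap_channel :: "('a \<times> 'b \<times> 'r \<Rightarrow> ('u \<times> 'v \<times> 'w) pmf) \<Rightarrow> 'b \<times> 'a \<times> 'r \<Rightarrow> ('v \<times> 'u \<times> 'w) pmf" where
  "swap_channel W x = map_pmf swap3 (W (swap3 x))"

lemma block_kernel_swap:
  "map_pmf (map_prod swap3 swap3) (block_kernel W cp m1 m2 l) = block_kernel (swap_channel W) (map_pmf swap3 cp) m2 m1 l"
  by (simp add: block_kernel_def swap_channel_def map_bind_pmf bind_map_pmf map_pmf_comp case_prod_unfold)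

lemma block_code_pmf_swap:
  "map_pmf swap3 (block_code_pmf M1 M2 L p1 p2 pr da db dr) = block_code_pmf M2 M1 L p2 p1 pr db da dr"
  unfolding block_code_pmf_def pair_pmf_def
  by (simp add: map_bind_pmf bind_assoc_pmf bind_return_pmf) (rule bind_commute_pmf)

lemma relay_next_swap: "relay_next g l (map_prod swap3 swap3 z) = relay_next g l z"
  by (cases z) (auto simp: relay_next_def)

text \<open>Reduces the costs of user 1, whose tests read swapped codebooks and outputs, to those of
  user 2 in the swapped channel. The relay index is the same in both.\<close>

lemma nn_integral_block_kernel_swap:
  "(\<integral>\<^sup>+z. \<phi> (map_prod swap3 swap3 z) (relay_next g l z)
      \<partial>block_kernel W (block_code_pmf M1 M2 L p1 p2 pr da db dr) m1 m2 l) =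
    (\<integral>\<^sup>+z. \<phi> z (relay_next g l z)
      \<partial>block_kernel (swap_channel W) (block_code_pmf M2 M1 L p2 p1 pr db da dr) m2 m1 l)"
  by (simp add: block_kernel_swap[symmetric] block_code_pmf_swap[symmetric, of M2] relay_next_swap)

text \<open>User 2's view before quantization: the desired input, the side information consisting of
  its own input and output, and the relay's input and output. With \<open>swap_channel\<close> the
  same definition serves user 1.\<close>

definition side_law :: "'a pmf \<Rightarrow> 'b pmf \<Rightarrow> 'r pmf \<Rightarrow> ('a \<times> 'b \<times> 'r \<Rightarrow> ('u \<times> 'v \<times> 'w) pmf) \<Rightarrow> ('a \<times> ('b \<times> 'v) \<times> 'r \<times> 'w) pmf" where
  "side_law p1 p2 pr W = do {
     x1 \<leftarrow> p1; x2 \<leftarrow> p2; xr \<leftarrow> pr; (y1, y2, yr) \<leftarrow> W (x1, x2, xr);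
     return_pmf (x1, (x2, y2), xr, yr)}"

text \<open>Index \<open>l\<close> stems from the previous block and is sent in this one;
  \<open>l'\<close> is the quantization of this block. Since \<open>c 0\<close> is not a codeword,
  l' = 0 is excluded, so a failed quantization counts as a lost path.\<close>

fun fits :: "('a \<times> ('b \<times> 'v) \<times> 'r \<times> 'h) set \<Rightarrow> (nat \<Rightarrow> 'h) \<Rightarrow> nat \<Rightarrow> nat \<Rightarrow>
    ('a, 'b, 'r) block_code \<times> 'v \<Rightarrow> nat \<Rightarrow> nat \<Rightarrow> bool" where
  "fits S c m2 m' ((f1, f2, F), y2) l l' \<longleftrightarrow> l' \<noteq> 0 \<and> (f1 m', (f2 m2, y2), F l, c l') \<in> S"

abbreviation "user_view z \<equiv> (fst z, fst (snd (snd z)))"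

lemma nn_integral_block_kernel:
  "(\<integral>\<^sup>+z. \<phi> z \<partial>block_kernel W cp m1 m2 l) =
    (\<integral>\<^sup>+(f1, f2, F). \<integral>\<^sup>+y. \<phi> ((f1, f2, F), y) \<partial>W (f1 m1, f2 m2, F l) \<partial>cp)"
  by (simp add: block_kernel_def case_prod_unfold)

lemma nn_integral_side_law:
  "(\<integral>\<^sup>+(a, s, r, w). \<phi> a s r w \<partial>side_law p1 p2 pr W) =
    (\<integral>\<^sup>+x1. \<integral>\<^sup>+x2. \<integral>\<^sup>+xr. \<integral>\<^sup>+(y1, y2, yr). \<phi> x1 (x2, y2) xr yr \<partial>W (x1, x2, xr)
       \<partial>pr \<partial>p2 \<partial>p1)"
  by (simp add: side_law_def case_prod_unfold)

section \<open>One-block costs of a random code\<close>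

context
  fixes W :: "'a \<times> 'b \<times> 'r \<Rightarrow> ('u \<times> 'v \<times> 'w) pmf" and p1 :: "'a pmf" and p2 :: "'b pmf" and pr :: "'r pmf"
    and M1 M2 L :: nat and da db dr cp
    and g :: "'r \<Rightarrow> 'w \<Rightarrow> nat"
  defines "cp \<equiv> block_code_pmf M1 M2 L p1 p2 pr da db dr"
begin

lemma block_kernel_miss:
  assumes "m1 \<in> {1..M1}" "m2 \<in> {1..M2}" "l \<le> L"
  shows "emeasure (block_kernel W cp m1 m2 l)
      {z. \<not> fits S c m2 m1 (user_view z) l (relay_next g l z)} = miss_cost S g c (side_law p1 p2 pr W)"
proof -
  define G where "G = (\<lambda>x1 x2 xr. \<integral>\<^sup>+(y1, y2, yr). of_bool (\<not> (g xr yr \<noteq> 0 \<and> (x1, (x2, y2), xr, c (g xr yr)) \<in> S))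
      \<partial>W (x1, x2, xr))"
  have "emeasure (block_kernel W cp m1 m2 l) {z. \<not> fits S c m2 m1 (user_view z) l (relay_next g l z)}
      = (\<integral>\<^sup>+(f1, f2, F). G (f1 m1) (f2 m2) (F l) \<partial>cp)"
    unfolding emeasure_pmf_of_bool nn_integral_block_kernel G_def
    by (simp add: relay_next_def case_prod_unfold)
  also have "\<dots> = (\<integral>\<^sup>+x1. \<integral>\<^sup>+x2. \<integral>\<^sup>+xr. G x1 x2 xr \<partial>pr \<partial>p2 \<partial>p1)"
    unfolding cp_def by (rule nn_integral_block_code[OF assms])
  also have "\<dots> = miss_cost S g c (side_law p1 p2 pr W)"
    unfolding miss_cost_def emeasure_pmf_of_bool G_def
    by (subst nn_integral_side_law[symmetric]) (simp add: case_prod_unfold)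
  finally show ?thesis .
qed

lemma block_kernel_leave:
  assumes m: "m1 \<in> {1..M1}" "m2 \<in> {1..M2}" "m' \<in> {1..M1}" "m' \<noteq> m1" and l: "l \<le> L"
  shows "(\<integral>\<^sup>+z. of_bool (fits S c m2 m' (user_view z) l (relay_next g l z))
      + \<kappa> * (\<Sum>l'\<le>L. of_bool (fits S c m2 m' (user_view z) l l')) \<partial>block_kernel W cp m1 m2 l)
    = leave_cost \<kappa> L S g c p1 (side_law p1 p2 pr W)"
proof -
  define G where "G = (\<lambda>a' x1 x2 xr. \<integral>\<^sup>+(y1, y2, yr). branch \<kappa> L S c a' (x2, y2) xr (g xr yr) \<partial>W (x1, x2, xr))"
  have "(\<integral>\<^sup>+z. of_bool (fits S c m2 m' (user_view z) l (relay_next g l z))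
      + \<kappa> * (\<Sum>l'\<le>L. of_bool (fits S c m2 m' (user_view z) l l')) \<partial>block_kernel W cp m1 m2 l)
      = (\<integral>\<^sup>+(f1, f2, F). G (f1 m') (f1 m1) (f2 m2) (F l) \<partial>cp)"
    unfolding nn_integral_block_kernel G_def by (simp add: relay_next_def case_prod_unfold branch_def)
  also have "\<dots> = (\<integral>\<^sup>+a'. \<integral>\<^sup>+(f1, f2, F). G a' (f1 m1) (f2 m2) (F l) \<partial>cp \<partial>p1)"
    unfolding cp_def
    by (rule nn_integral_block_code_fresh[where G="\<lambda>x1 a' f2 F. G a' x1 (f2 m2) (F l)"]) (use m in auto)
  also have "\<dots> = (\<integral>\<^sup>+a'. \<integral>\<^sup>+x1. \<integral>\<^sup>+x2. \<integral>\<^sup>+xr. G a' x1 x2 xr \<partial>pr \<partial>p2 \<partial>p1 \<partial>p1)"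
    unfolding cp_def using m l by (intro nn_integral_cong nn_integral_block_code)
  also have "\<dots> = leave_cost \<kappa> L S g c p1 (side_law p1 p2 pr W)"
    unfolding leave_cost_def nn_integral_side_law G_def by simp
  finally show ?thesis .
qed

lemma block_kernel_return:
  assumes m: "m1 \<in> {1..M1}" "m2 \<in> {1..M2}" "m' \<in> {1..M1}" "m' \<noteq> m1" and l: "l \<le> L" "k \<le> L" "k \<noteq> l"
  shows "(\<integral>\<^sup>+z. of_bool (fits S c m2 m' (user_view z) k (relay_next g l z))
      + \<kappa> * (\<Sum>l'\<le>L. of_bool (fits S c m2 m' (user_view z) k l')) \<partial>block_kernel W cp m1 m2 l)
    = return_cost \<kappa> L S g c p1 pr (side_law p1 p2 pr W)"
proof -
  define G where "G = (\<lambda>a' x1 x2 xr r'. \<integral>\<^sup>+(y1, y2, yr). branch \<kappa> L S c a' (x2, y2) r' (g xr yr) \<partial>W (x1, x2, xr))"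
  have "(\<integral>\<^sup>+z. of_bool (fits S c m2 m' (user_view z) k (relay_next g l z))
      + \<kappa> * (\<Sum>l'\<le>L. of_bool (fits S c m2 m' (user_view z) k l')) \<partial>block_kernel W cp m1 m2 l)
      = (\<integral>\<^sup>+(f1, f2, F). G (f1 m') (f1 m1) (f2 m2) (F l) (F k) \<partial>cp)"
    unfolding nn_integral_block_kernel G_def by (simp add: relay_next_def case_prod_unfold branch_def)
  also have "\<dots> = (\<integral>\<^sup>+a'. \<integral>\<^sup>+(f1, f2, F). G a' (f1 m1) (f2 m2) (F l) (F k) \<partial>cp \<partial>p1)"
    unfolding cp_def
    by (rule nn_integral_block_code_fresh[where G="\<lambda>x1 a' f2 F. G a' x1 (f2 m2) (F l) (F k)"]) (use m in auto)
  also have "\<dots> = (\<integral>\<^sup>+a'. \<integral>\<^sup>+r'. \<integral>\<^sup>+x1. \<integral>\<^sup>+x2. \<integral>\<^sup>+xr. G a' x1 x2 xr r' \<partial>pr \<partial>p2 \<partial>p1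
      \<partial>pr \<partial>p1)"
    unfolding cp_def using m l
    by (subst nn_integral_block_code_fresh_relay[where G="\<lambda>f1 f2. G a' (f1 m1) (f2 m2)" for a'])
      (auto intro!: nn_integral_cong nn_integral_block_code[where G="\<lambda>x1 x2 xr. G a' x1 x2 xr r'" for a' r'] simp del: One_nat_def)
  also have "\<dots> = return_cost \<kappa> L S g c p1 pr (side_law p1 p2 pr W)"
    unfolding return_cost_def nn_integral_side_law G_def by simp
  finally show ?thesis .
qed

end

section \<open>Error events of the decoders and the choice of the block codes\<close>

definition decodes :: "nat \<Rightarrow> ('z \<Rightarrow> nat \<Rightarrow> nat \<Rightarrow> bool) \<Rightarrow> 'z list \<Rightarrow> bool" where
  "decodes L T zs \<longleftrightarrow> (\<exists>l\<le>L. path_count L T zs l \<noteq> 0)"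

text \<open>A wrong message that decodes has a path ending at some index, possibly a wrong one, so
  its potential is at least \<open>\<kappa>\<close>. Markov's inequality costs 1/\<kappa> once for
  all blocks; times the initial potential 1 + \<kappa> this gives the constant.\<close>

lemma chain_decoding_error:
  fixes T :: "nat \<Rightarrow> 'z \<Rightarrow> nat \<Rightarrow> nat \<Rightarrow> bool" and \<kappa> :: real and \<Lambda> :: ennreal
  assumes le: "\<And>l z. nx l z \<le> L" and \<kappa>: "\<kappa> > 0" and m: "m \<in> {1..M}"
    and miss: "\<And>l. l \<le> L \<Longrightarrow> emeasure (measure_pmf (K l)) {z. \<not> T m z l (nx l z)} \<le> e"
    and right: "\<And>m' l. m' \<in> {1..M} \<Longrightarrow> m' \<noteq> m \<Longrightarrow> l \<le> L \<Longrightarrow>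
       (\<integral>\<^sup>+z. of_bool (T m' z l (nx l z)) + ennreal \<kappa> * (\<Sum>l'\<le>L. of_bool (T m' z l l')) \<partial>measure_pmf (K l)) \<le> \<Lambda>"
    and wrong: "\<And>m' l k. m' \<in> {1..M} \<Longrightarrow> m' \<noteq> m \<Longrightarrow> l \<le> L \<Longrightarrow> k \<le> L \<Longrightarrow> k \<noteq> l \<Longrightarrow>
       (\<integral>\<^sup>+z. of_bool (T m' z k (nx l z)) + ennreal \<kappa> * (\<Sum>l'\<le>L. of_bool (T m' z k l')) \<partial>measure_pmf (K l)) \<le> ennreal \<kappa> * \<Lambda>"
  shows "emeasure (chain K nx b)
      {(zs, l). \<not> decodes L (T m) zs \<or> (\<exists>m'\<in>{1..M}. m' \<noteq> m \<and> decodes L (T m') zs)}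
    \<le> of_nat b * e + of_nat (M - 1) * (ennreal (1 / \<kappa> + 1) * \<Lambda> ^ b)"
proof -
  let ?N = "{(zs, l :: nat). \<not> decodes L (T m) zs}" and ?D = "\<lambda>m'. {(zs, l :: nat). decodes L (T m') zs}"
  let ?W = "\<Union>m'\<in>{1..M} - {m}. ?D m'" and ?B = "ennreal (1 / \<kappa> + 1) * \<Lambda> ^ b"
  let ?P = "measure_pmf (chain K nx b)"
  have "emeasure ?P ?N \<le> emeasure ?P {(zs, l). path_count L (T m) zs l = 0}"
    using chain_state_le[where nx=nx, OF le]
    by (intro emeasure_mono_AE) (fastforce simp: AE_measure_pmf_iff decodes_def)+
  also have "\<dots> \<le> of_nat b * e"
    by (intro chain_path_lost le miss)
  finally have 1: "emeasure ?P ?N \<le> of_nat b * e" .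
  have 2: "emeasure ?P (?D m') \<le> ?B"
    if m': "m' \<in> {1..M}" "m' \<noteq> m" for m'
  proof -
    let ?\<phi> = "\<lambda>(zs, l). of_nat (path_count L (T m') zs l) + ennreal \<kappa> * (\<Sum>l'\<le>L. of_nat (path_count L (T m') zs l')) :: ennreal"
    have "emeasure ?P (?D m') = (\<integral>\<^sup>+s. of_bool (decodes L (T m') (fst s)) \<partial>?P)"
      unfolding case_prod_unfold emeasure_pmf_of_bool ..
    also have "\<dots> \<le> (\<integral>\<^sup>+s. ennreal (1 / \<kappa>) * ?\<phi> s \<partial>?P)"
    proof (intro nn_integral_mono)
      fix s :: "'z list \<times> nat"
      obtain zs l where s: "s = (zs, l)" by (cases s)
      show "of_bool (decodes L (T m') (fst s)) \<le> ennreal (1 / \<kappa>) * ?\<phi> s"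
      proof (cases "decodes L (T m') zs")
        case True
        then obtain l' where l': "l' \<le> L" "path_count L (T m') zs l' \<noteq> 0" by (auto simp: decodes_def)
        have "(1 :: ennreal) \<le> of_nat (path_count L (T m') zs l')"
          using l'(2) by (metis One_nat_def Suc_leI neq0_conv of_nat_1 of_nat_mono)
        also have "\<dots> \<le> (\<Sum>l'\<le>L. of_nat (path_count L (T m') zs l'))"
          by (rule member_le_sum) (use l' in auto)
        finally have "ennreal \<kappa> * 1 \<le> ennreal \<kappa> * (\<Sum>l'\<le>L. of_nat (path_count L (T m') zs l'))"
          by (rule mult_left_mono) simp
        hence "ennreal \<kappa> \<le> ?\<phi> s" unfolding s prod.case by (simp add: add_increasing)
        hence "ennreal (1 / \<kappa>) * ennreal \<kappa> \<le> ennreal (1 / \<kappa>) * ?\<phi> s" by (rule mult_left_mono) simp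
        thus ?thesis using \<kappa> by (simp add: ennreal_mult[symmetric])
      qed (simp add: s)
    qed
    also have "\<dots> = ennreal (1 / \<kappa>) * (\<integral>\<^sup>+s. ?\<phi> s \<partial>?P)"
      by (rule nn_integral_cmult) simp
    also have "\<dots> \<le> ennreal (1 / \<kappa>) * ((1 + ennreal \<kappa>) * \<Lambda> ^ b)"
      by (intro mult_left_mono chain_wrong_paths le right wrong m') auto
    also have "\<dots> = ?B"
    proof -
      have "ennreal (1 / \<kappa>) * (1 + ennreal \<kappa>) = ennreal (1 / \<kappa> * (1 + \<kappa>))"
        using \<kappa> by (subst ennreal_mult) (simp_all add: ennreal_plus)
      also have "1 / \<kappa> * (1 + \<kappa>) = 1 / \<kappa> + 1" using \<kappa> by (simp add: field_simps)
      finally show ?thesis by (simp flip: mult.assoc)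
    qed
    finally show ?thesis .
  qed
  have "emeasure ?P {(zs, l). \<not> decodes L (T m) zs \<or> (\<exists>m'\<in>{1..M}. m' \<noteq> m \<and> decodes L (T m') zs)} \<le>
     emeasure ?P (?N \<union> ?W)"
    by (rule emeasure_mono) auto
  also have "\<dots> \<le> emeasure ?P ?N + emeasure ?P ?W"
    by (rule emeasure_subadditive) auto
  also have "emeasure ?P ?W \<le>
      (\<Sum>m'\<in>{1..M} - {m}. emeasure ?P (?D m'))"
    by (rule emeasure_subadditive_finite) auto
  also have "\<dots> \<le> (\<Sum>m'\<in>{1..M} - {m}. ?B)"
    by (intro sum_mono 2) auto
  also have "\<dots> = of_nat (M - 1) * (?B)"
    using m by simp
  finally show ?thesis using 1 by (simp add: add_mono order_trans)
qed

lemma exists_le_nn_integral_pmf: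
  assumes "(\<integral>\<^sup>+x. X x \<partial>measure_pmf p) \<le> B"
  shows "\<exists>x\<in>set_pmf p. X x \<le> B"
proof (rule ccontr)
  assume "\<not> (\<exists>x\<in>set_pmf p. X x \<le> B)"
  hence gt: "X x > B" if "x \<in> set_pmf p" for x using that by force
  obtain x where "x \<in> set_pmf p" using set_pmf_not_empty[of p] by blast
  hence "B \<noteq> \<infinity>" using gt[of x] by auto
  have "(\<integral>\<^sup>+x. X x \<partial>p) = (\<integral>\<^sup>+x. B + (X x - B) \<partial>p)"
    using gt by (intro nn_integral_cong_AE) (auto simp: AE_measure_pmf_iff intro!: add_diff_inverse_ennreal[symmetric] less_imp_le)
  also have "\<dots> = B + (\<integral>\<^sup>+x. X x - B \<partial>p)"
    by (simp add: nn_integral_add)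
  finally have "B + (\<integral>\<^sup>+x. X x - B \<partial>p) \<le> B + 0" using assms by simp
  hence "(\<integral>\<^sup>+x. X x - B \<partial>p) = 0"
    using \<open>B \<noteq> \<infinity>\<close> by (simp add: ennreal_add_left_cancel_le)
  hence "AE x in measure_pmf p. X x - B = 0"
    by (subst (asm) nn_integral_0_iff_AE) auto
  hence "X x - B = 0" using \<open>x \<in> set_pmf p\<close> by (auto simp: AE_measure_pmf_iff)
  with gt[OF \<open>x \<in> set_pmf p\<close>] show False by (auto simp: diff_eq_0_iff_ennreal dest: leD)
qed

text \<open>Expressed by decodability alone, so it contains every decoding error whatever value the
  decoders return when there is no unique candidate.\<close>

definition block_error :: "nat \<Rightarrow> nat \<Rightarrow> nat \<Rightarrow> ('b \<times> ('a \<times> 'u) \<times> 'r \<times> 'h) set \<Rightarrow> ('a \<times> ('b \<times> 'v) \<times> 'r \<times> 'h) set \<Rightarrow>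
    (nat \<Rightarrow> 'h) \<Rightarrow> nat \<Rightarrow> nat \<Rightarrow> ('a, 'b, 'r) block_code list \<Rightarrow> ('u \<times> 'v \<times> 'w) list \<Rightarrow> bool" where
  "block_error M1 M2 L S1 S2 c m1 m2 cs ys \<longleftrightarrow>
     (\<not> decodes L (fits S1 c m1 m2) (zip (map swap3 cs) (map fst ys)) \<or>
       (\<exists>m'\<in>{1..M2}. m' \<noteq> m2 \<and> decodes L (fits S1 c m1 m') (zip (map swap3 cs) (map fst ys)))) \<or>
     (\<not> decodes L (fits S2 c m2 m1) (zip cs (map (\<lambda>y. fst (snd y)) ys)) \<or>
       (\<exists>m'\<in>{1..M1}. m' \<noteq> m1 \<and> decodes L (fits S2 c m2 m') (zip cs (map (\<lambda>y. fst (snd y)) ys))))"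

definition average_block_error :: "('a \<times> 'b \<times> 'r \<Rightarrow> ('u \<times> 'v \<times> 'w) pmf) \<Rightarrow> ('r \<Rightarrow> 'w \<Rightarrow> nat) \<Rightarrow> nat \<Rightarrow> nat \<Rightarrow> nat \<Rightarrow>
    ('b \<times> ('a \<times> 'u) \<times> 'r \<times> 'h) set \<Rightarrow> ('a \<times> ('b \<times> 'v) \<times> 'r \<times> 'h) set \<Rightarrow> (nat \<Rightarrow> 'h) \<Rightarrow> ('a, 'b, 'r) block_code list \<Rightarrow> ennreal" where
  "average_block_error W g M1 M2 L S1 S2 c cs =
     (\<integral>\<^sup>+m1. \<integral>\<^sup>+m2. emeasure (block_run W g m1 m2 cs) {(ys, l). block_error M1 M2 L S1 S2 c m1 m2 cs ys}
       \<partial>pmf_of_set {1..M2} \<partial>pmf_of_set {1..M1})"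

definition decoding_bound :: "nat \<Rightarrow> nat \<Rightarrow> ennreal \<Rightarrow> real \<Rightarrow> ennreal \<Rightarrow> ennreal" where
  "decoding_bound b M e \<kappa> \<Lambda> = of_nat b * e + of_nat (M - 1) * (ennreal (1 / \<kappa> + 1) * \<Lambda> ^ b)"

lemma decodes_map: "decodes L T (map f zs) \<longleftrightarrow> decodes L (\<lambda>z. T (f z)) zs"
  by (simp add: decodes_def path_count_map)

lemma zip_views:
  "zip (map swap3 cs) (map fst ys) = map (\<lambda>z. user_view (map_prod swap3 swap3 z)) (zip cs ys)"
  "zip cs (map (\<lambda>y. fst (snd y)) ys) = map user_view (zip cs ys)"
  by (simp_all add: zip_map1 zip_map2 case_prod_unfold)

lemma random_block_code_error:
  fixes W :: "'a \<times> 'b \<times> 'r \<Rightarrow> ('u \<times> 'v \<times> 'w) pmf" and \<kappa>1 \<kappa>2 :: real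
    and p1 p2 pr and M1 M2 L :: nat and da db dr
  defines "cp \<equiv> block_code_pmf M1 M2 L p1 p2 pr da db dr"
    and "U1 \<equiv> side_law p2 p1 pr (swap_channel W)" and "U2 \<equiv> side_law p1 p2 pr W"
  assumes g: "\<And>r w. g r w \<le> L" and \<kappa>: "\<kappa>1 > 0" "\<kappa>2 > 0"
    and c1: "miss_cost S1 g c U1 \<le> e1" "leave_cost \<kappa>1 L S1 g c p2 U1 \<le> \<Lambda>1"
      "return_cost \<kappa>1 L S1 g c p2 pr U1 \<le> ennreal \<kappa>1 * \<Lambda>1"
    and c2: "miss_cost S2 g c U2 \<le> e2" "leave_cost \<kappa>2 L S2 g c p1 U2 \<le> \<Lambda>2"
      "return_cost \<kappa>2 L S2 g c p1 pr U2 \<le> ennreal \<kappa>2 * \<Lambda>2"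
    and m: "m1 \<in> {1..M1}" "m2 \<in> {1..M2}"
  shows "(\<integral>\<^sup>+cs. emeasure (block_run W g m1 m2 cs) {(ys, l). block_error M1 M2 L S1 S2 c m1 m2 cs ys}
        \<partial>replicate_pmf b cp)
    \<le> decoding_bound b M2 e1 \<kappa>1 \<Lambda>1 + decoding_bound b M1 e2 \<kappa>2 \<Lambda>2"
proof -
  let ?K = "block_kernel W cp m1 m2"
  let ?P = "measure_pmf (chain ?K (relay_next g) b)"
  let ?T1 = "\<lambda>m' z. fits S1 c m1 m' (user_view (map_prod swap3 swap3 z))" and ?T2 = "\<lambda>m' z. fits S2 c m2 m' (user_view z)"
  let ?A1 = "{(zs, l :: nat). \<not> decodes L (?T1 m2) zs \<or> (\<exists>m'\<in>{1..M2}. m' \<noteq> m2 \<and> decodes L (?T1 m') zs)}"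
  let ?A2 = "{(zs, l :: nat). \<not> decodes L (?T2 m1) zs \<or> (\<exists>m'\<in>{1..M1}. m' \<noteq> m1 \<and> decodes L (?T2 m') zs)}"
  have le: "relay_next g l z \<le> L" for l and z :: "('a, 'b, 'r) block_code \<times> ('u \<times> 'v \<times> 'w)"
    using g by (auto simp: relay_next_def case_prod_unfold)
  have 1: "emeasure ?P ?A1 \<le> decoding_bound b M2 e1 \<kappa>1 \<Lambda>1"
    unfolding decoding_bound_def
  proof (rule chain_decoding_error[where m=m2 and T="?T1", OF le \<kappa>(1) m(2)])
    fix l assume l: "l \<le> L"
    show "emeasure (?K l) {z. \<not> ?T1 m2 z l (relay_next g l z)} \<le> e1"
      unfolding cp_def emeasure_pmf_of_bool
      by (rule ord_eq_le_trans[OF trans[OF nn_integral_block_kernel_swap[where \<phi>="\<lambda>z r. of_bool (\<not> fits S1 c m1 m2 (user_view z) l r)"]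
            block_kernel_miss[OF m(2,1) l, unfolded emeasure_pmf_of_bool]] c1(1)[unfolded U1_def]])
    fix m' assume m': "m' \<in> {1..M2}" "m' \<noteq> m2"
    show "(\<integral>\<^sup>+z. of_bool (?T1 m' z l (relay_next g l z)) + ennreal \<kappa>1 * (\<Sum>l'\<le>L. of_bool (?T1 m' z l l')) \<partial>?K l) \<le> \<Lambda>1"
      unfolding cp_def
      by (rule ord_eq_le_trans[OF trans[OF nn_integral_block_kernel_swap[where \<phi>="\<lambda>z r. of_bool (fits S1 c m1 m' (user_view z) l r)
            + ennreal \<kappa>1 * (\<Sum>l'\<le>L. of_bool (fits S1 c m1 m' (user_view z) l l'))"] block_kernel_leave[OF m(2,1) m' l]] c1(2)[unfolded U1_def]])
    fix k assume k: "k \<le> L" "k \<noteq> l"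
    show "(\<integral>\<^sup>+z. of_bool (?T1 m' z k (relay_next g l z)) + ennreal \<kappa>1 * (\<Sum>l'\<le>L. of_bool (?T1 m' z k l')) \<partial>?K l) \<le> ennreal \<kappa>1 * \<Lambda>1"
      unfolding cp_def
      by (rule ord_eq_le_trans[OF trans[OF nn_integral_block_kernel_swap[where \<phi>="\<lambda>z r. of_bool (fits S1 c m1 m' (user_view z) k r)
            + ennreal \<kappa>1 * (\<Sum>l'\<le>L. of_bool (fits S1 c m1 m' (user_view z) k l'))"] block_kernel_return[OF m(2,1) m' l k]] c1(3)[unfolded U1_def]])
  qed
  have 2: "emeasure ?P ?A2 \<le> decoding_bound b M1 e2 \<kappa>2 \<Lambda>2"
    unfolding decoding_bound_def
    by (rule chain_decoding_error[where m=m1 and T="?T2", OF le \<kappa>(2) m(1)])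
      (use m c2 in \<open>simp_all add: cp_def U2_def block_kernel_miss block_kernel_leave block_kernel_return del: sum_of_bool_eq One_nat_def\<close>)
  have "(\<integral>\<^sup>+cs. emeasure (block_run W g m1 m2 cs) {(ys, l). block_error M1 M2 L S1 S2 c m1 m2 cs ys}
        \<partial>replicate_pmf b cp) = emeasure ?P (?A1 \<union> ?A2)"
    unfolding chain_block_kernel block_error_def zip_views decodes_map
    by (simp add: vimage_def case_prod_unfold Un_def del: One_nat_def)
  also have "\<dots> \<le> emeasure ?P ?A1 + emeasure ?P ?A2"
    by (rule emeasure_subadditive) auto
  finally show ?thesis using add_mono[OF 1 2] by (rule order_trans)
qed

lemma block_code_exists:
  fixes W :: "'a \<times> 'b \<times> 'r \<Rightarrow> ('u \<times> 'v \<times> 'w) pmf" and \<kappa>1 \<kappa>2 :: real and p1 p2 pr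
  defines "U1 \<equiv> side_law p2 p1 pr (swap_channel W)" and "U2 \<equiv> side_law p1 p2 pr W"
  assumes g: "\<And>r w. g r w \<le> L" and \<kappa>: "\<kappa>1 > 0" "\<kappa>2 > 0"
    and c1: "miss_cost S1 g c U1 \<le> e1" "leave_cost \<kappa>1 L S1 g c p2 U1 \<le> \<Lambda>1"
      "return_cost \<kappa>1 L S1 g c p2 pr U1 \<le> ennreal \<kappa>1 * \<Lambda>1"
    and c2: "miss_cost S2 g c U2 \<le> e2" "leave_cost \<kappa>2 L S2 g c p1 U2 \<le> \<Lambda>2"
      "return_cost \<kappa>2 L S2 g c p1 pr U2 \<le> ennreal \<kappa>2 * \<Lambda>2"
    and M: "M1 > 0" "M2 > 0"
  shows "\<exists>cs\<in>set_pmf (replicate_pmf b (block_code_pmf M1 M2 L p1 p2 pr da db dr)).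
    average_block_error W g M1 M2 L S1 S2 c cs \<le> decoding_bound b M2 e1 \<kappa>1 \<Lambda>1 + decoding_bound b M1 e2 \<kappa>2 \<Lambda>2"
    (is "\<exists>cs\<in>set_pmf ?R. _ \<le> ?B")
proof (rule exists_le_nn_integral_pmf)
  let ?E = "\<lambda>m1 m2 cs. emeasure (block_run W g m1 m2 cs) {(ys, l). block_error M1 M2 L S1 S2 c m1 m2 cs ys}"
  let ?P = "\<lambda>M. measure_pmf (pmf_of_set {1..M :: nat})"
  have "(\<integral>\<^sup>+cs. average_block_error W g M1 M2 L S1 S2 c cs \<partial>?R)
     = (\<integral>\<^sup>+m1. \<integral>\<^sup>+cs. \<integral>\<^sup>+m2. ?E m1 m2 cs \<partial>?P M2 \<partial>?R \<partial>?P M1)"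
    unfolding average_block_error_def by (rule nn_integral_pmf_commute)
  also have "\<dots> = (\<integral>\<^sup>+m1. \<integral>\<^sup>+m2. \<integral>\<^sup>+cs. ?E m1 m2 cs \<partial>?R \<partial>?P M2 \<partial>?P M1)"
    by (intro nn_integral_cong nn_integral_pmf_commute)
  also have "\<dots> \<le> (\<integral>\<^sup>+m1. \<integral>\<^sup>+m2. ?B \<partial>?P M2 \<partial>?P M1)"
  proof -
    have s: "set_pmf (pmf_of_set {1..M1}) = {1..M1}" "set_pmf (pmf_of_set {1..M2}) = {1..M2}"
      using M by (auto intro!: set_pmf_of_set)
    show ?thesis
      by (intro nn_integral_mono_AE, unfold AE_measure_pmf_iff s, intro ballI nn_integral_mono_AE,
          unfold AE_measure_pmf_iff s, intro ballI)
        (rule random_block_code_error[OF g \<kappa> c1[unfolded U1_def] c2[unfolded U2_def]])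
  qed
  finally show "(\<integral>\<^sup>+cs. average_block_error W g M1 M2 L S1 S2 c cs \<partial>?R) \<le> ?B" by simp
qed

subsection \<open>From blocks to letters\<close>

abbreviation out1 :: "'u \<times> 'v \<times> 'w \<Rightarrow> 'u" where "out1 \<equiv> \<lambda>(y1, y2, yr). y1"
abbreviation out2 :: "'u \<times> 'v \<times> 'w \<Rightarrow> 'v" where "out2 \<equiv> \<lambda>(y1, y2, yr). y2"
abbreviation outr :: "'u \<times> 'v \<times> 'w \<Rightarrow> 'w" where "outr \<equiv> \<lambda>(y1, y2, yr). yr"

definition unzip3 :: "('u \<times> 'v \<times> 'w) list \<Rightarrow> 'u list \<times> 'v list \<times> 'w list" where
  "unzip3 zs = (map out1 zs, map out2 zs, map outr zs)"

primrec prod_channel :: "('x \<Rightarrow> 'y pmf) \<Rightarrow> 'x list \<Rightarrow> 'y list pmf" where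
  "prod_channel W [] = return_pmf []"
| "prod_channel W (x # xs) = do {y \<leftarrow> W x; ys \<leftarrow> prod_channel W xs; return_pmf (y # ys)}"

lemma prod_channel_snoc:
  "prod_channel W (xs @ [x]) = do {ys \<leftarrow> prod_channel W xs; y \<leftarrow> W x; return_pmf (ys @ [y])}"
  by (induction xs) (simp_all add: bind_assoc_pmf bind_return_pmf)

lemma length_prod_channel: "ys \<in> set_pmf (prod_channel W xs) \<Longrightarrow> length ys = length xs"
  by (induction xs arbitrary: ys) auto

text \<open>Presents n uses as a single use of a two-way relay channel whose letters are words, so
  that the results on blocks apply to it.\<close>

definition block_channel :: "('a \<times> 'b \<times> 'r \<Rightarrow> ('u \<times> 'v \<times> 'w) pmf) \<Rightarrow> 'a list \<times> 'b list \<times> 'r list \<Rightarrow>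
    ('u list \<times> 'v list \<times> 'w list) pmf" where
  "block_channel W = (\<lambda>(x1, x2, xr). map_pmf unzip3 (prod_channel W (zip x1 (zip x2 xr))))"

lemma length_outputs: "ys \<in> set_pmf (outputs W C m1 m2 i) \<Longrightarrow> length ys = i"
  by (induction i arbitrary: ys) auto

text \<open>Encoders see only the past, so a prefix does not depend on how long the transmission
  lasts. This is needed because the code length is in general not a multiple of the number of
  blocks.\<close>

lemma take_outputs: "map_pmf (take k) (outputs W C m1 m2 (k + i)) = outputs W C m1 m2 k"
proof (induction i)
  case 0
  have "map_pmf (take k) (outputs W C m1 m2 k) = map_pmf (\<lambda>x. x) (outputs W C m1 m2 k)"
    by (intro map_pmf_cong refl) (auto dest: length_outputs)
  thus ?case by simp
next
  case (Suc i)
  have "map_pmf (take k) (outputs W C m1 m2 (k + Suc i)) = map_pmf (take k) (outputs W C m1 m2 (k + i))"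
    unfolding add_Suc_right outputs.simps map_bind_pmf map_pmf_def[of "take k" "outputs W C m1 m2 (k + i)"]
  proof (intro bind_pmf_cong refl, goal_cases)
    case (1 ys)
    hence "length ys = k + i" by (rule length_outputs)
    thus ?case by simp
  qed
  with Suc show ?case by simp
qed

definition blocks :: "nat \<Rightarrow> nat \<Rightarrow> 'y list \<Rightarrow> 'y list list" where
  "blocks n j ys = map (\<lambda>i. take n (drop (i * n) ys)) [0..<j]"

text \<open>The relay has no memory besides its past outputs and recomputes its chain of indices
  from them.\<close>

primrec relay_state :: "('r \<Rightarrow> 'w list \<Rightarrow> nat) \<Rightarrow> nat \<Rightarrow> ('a, 'b, 'r) block_code list \<Rightarrow> nat \<Rightarrow> 'w list \<Rightarrow> nat" where
  "relay_state g n Cs 0 yr = 0"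
| "relay_state g n Cs (Suc j) yr = g (snd (snd (Cs ! j)) (relay_state g n Cs j yr)) (take n (drop (j * n) yr))"

lemma relay_state_append: "j * n \<le> length yr \<Longrightarrow> relay_state g n Cs j (yr @ zr) = relay_state g n Cs j yr"
  by (induction j) auto

lemma blocks_append:
  assumes "length ys = j * n" "length zs = n"
  shows "blocks n (Suc j) (ys @ zs) = blocks n j ys @ [zs]"
proof -
  have "take n (drop (i * n) (ys @ zs)) = take n (drop (i * n) ys)" if "i < j" for i
  proof -
    have "Suc i * n \<le> j * n" using that by (intro mult_le_mono1) simp
    thus ?thesis using assms by simp
  qed
  thus ?thesis using assms by (simp add: blocks_def)
qed

lemma blocks_map: "blocks n j (map f ys) = map (map f) (blocks n j ys)"
  by (simp add: blocks_def take_map drop_map)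

text \<open>The number of past outputs is the time; quotient and remainder by \<open>n\<close> give
  the block and the position in it. Past the last block \<open>Cs ! j\<close> is an unspecified
  value, sent when decoding no longer looks.\<close>

definition letter_code :: "('r list \<Rightarrow> 'w list \<Rightarrow> nat) \<Rightarrow> nat \<Rightarrow> ('x1 list, 'x2 list, 'r list) block_code list \<Rightarrow>
    ('u list \<Rightarrow> nat \<Rightarrow> nat) \<Rightarrow> ('v list \<Rightarrow> nat \<Rightarrow> nat) \<Rightarrow> ('x1, 'x2, 'r, 'u, 'v, 'w) twrc_code" where
  "letter_code g n Cs d1 d2 = \<lparr>
     enc1 = (\<lambda>m ys. fst (Cs ! (length ys div n)) m ! (length ys mod n)),
     enc2 = (\<lambda>m ys. fst (snd (Cs ! (length ys div n))) m ! (length ys mod n)),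
     encr = (\<lambda>ys. snd (snd (Cs ! (length ys div n))) (relay_state g n Cs (length ys div n) ys) ! (length ys mod n)),
     dec1 = d1, dec2 = d2\<rparr>"

lemma outputs_within_block:
  assumes "i \<le> n" and len: "length (fst (Cs ! j) m1) = n" "length (fst (snd (Cs ! j)) m2) = n"
    "\<And>l. l \<le> L \<Longrightarrow> length (snd (snd (Cs ! j)) l) = n" and L: "\<And>yr. relay_state g n Cs j yr \<le> L"
  shows "outputs W (letter_code g n Cs d1 d2) m1 m2 (j * n + i) =
    bind_pmf (outputs W (letter_code g n Cs d1 d2) m1 m2 (j * n)) (\<lambda>ys.
      map_pmf ((@) ys) (prod_channel W (take i (zip (fst (Cs ! j) m1) (zip (fst (snd (Cs ! j)) m2)
        (snd (snd (Cs ! j)) (relay_state g n Cs j (map outr ys))))))))"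
  using assms(1)
proof (induction i)
  case 0
  show ?case by (simp add: bind_return_pmf')
next
  case (Suc i)
  let ?C = "letter_code g n Cs d1 d2"
  let ?O = "outputs W ?C m1 m2"
  let ?X = "\<lambda>ys. zip (fst (Cs ! j) m1) (zip (fst (snd (Cs ! j)) m2) (snd (snd (Cs ! j)) (relay_state g n Cs j (map outr ys))))"
  have "?O (j * n + Suc i) = bind_pmf (?O (j * n)) (\<lambda>ys. bind_pmf (prod_channel W (take i (?X ys))) (\<lambda>zs.
      bind_pmf (W (enc1 ?C m1 (map out1 (ys @ zs)), enc2 ?C m2 (map out2 (ys @ zs)), encr ?C (map outr (ys @ zs))))
        (\<lambda>y. return_pmf ((ys @ zs) @ [y]))))"
    unfolding add_Suc_right outputs.simps using Suc by (simp add: bind_assoc_pmf bind_map_pmf)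
  also have "\<dots> = bind_pmf (?O (j * n)) (\<lambda>ys. bind_pmf (prod_channel W (take i (?X ys))) (\<lambda>zs.
      bind_pmf (W (?X ys ! i)) (\<lambda>y. return_pmf (ys @ (zs @ [y])))))"
  proof (rule bind_pmf_cong[OF refl], rule bind_pmf_cong[OF refl])
    fix ys zs assume ys: "ys \<in> set_pmf (?O (j * n))" and zs: "zs \<in> set_pmf (prod_channel W (take i (?X ys)))"
    have i: "i < n" using Suc by simp
    have lr: "length (snd (snd (Cs ! j)) (relay_state g n Cs j (map outr ys))) = n"
      using len(3) L by blast
    have l: "length ys = j * n" "length zs = i"
      using length_outputs[OF ys] length_prod_channel[OF zs] len lr i by auto
    \<comment> \<open>Causality: the outputs \<open>zs\<close> of the running block do not enter the
      index that the relay sends in it.\<close>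
    have "relay_state g n Cs j (map outr (ys @ zs)) = relay_state g n Cs j (map outr ys)"
      using l by (simp add: relay_state_append)
    moreover have "length (ys @ zs) div n = j" "length (ys @ zs) mod n = i"
      using l i by auto
    ultimately have "(enc1 ?C m1 (map out1 (ys @ zs)), enc2 ?C m2 (map out2 (ys @ zs)), encr ?C (map outr (ys @ zs))) = ?X ys ! i"
      using len lr i by (simp add: letter_code_def del: map_append length_append)
    thus "bind_pmf (W (enc1 ?C m1 (map out1 (ys @ zs)), enc2 ?C m2 (map out2 (ys @ zs)), encr ?C (map outr (ys @ zs))))
        (\<lambda>y. return_pmf ((ys @ zs) @ [y])) = bind_pmf (W (?X ys ! i)) (\<lambda>y. return_pmf (ys @ (zs @ [y])))"
      by simp
  qed
  also have "\<dots> = bind_pmf (?O (j * n)) (\<lambda>ys. map_pmf ((@) ys) (prod_channel W (take (Suc i) (?X ys))))"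
  proof -
    have "bind_pmf (prod_channel W (take i (?X ys))) (\<lambda>zs. bind_pmf (W (?X ys ! i)) (\<lambda>y. return_pmf (ys @ (zs @ [y]))))
        = map_pmf ((@) ys) (prod_channel W (take (Suc i) (?X ys)))" for ys
    proof -
      have "length (?X ys) = n" using len L by simp
      hence "take (Suc i) (?X ys) = take i (?X ys) @ [?X ys ! i]"
        using Suc by (intro take_Suc_conv_app_nth) auto
      thus ?thesis
        by (simp only: prod_channel_snoc) (simp add: map_bind_pmf)
    qed
    thus ?thesis by simp
  qed
  finally show ?case .
qed

text \<open>Letters are appended in temporal order, whereas \<open>block_run\<close> and the paths
  put the latest block first; hence the reversals on both sides.\<close>

lemma outputs_block_run:
  assumes "j \<le> length Cs"
    and len: "\<And>C. C \<in> set Cs \<Longrightarrow> length (fst C m1) = n" "\<And>C. C \<in> set Cs \<Longrightarrow> length (fst (snd C) m2) = n"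
      "\<And>C l. C \<in> set Cs \<Longrightarrow> l \<le> L \<Longrightarrow> length (snd (snd C) l) = n"
    and g: "\<And>r w. g r w \<le> L"
  shows "map_pmf (\<lambda>ys. (rev (map unzip3 (blocks n j ys)), relay_state g n Cs j (map outr ys)))
      (outputs W (letter_code g n Cs d1 d2) m1 m2 (j * n)) =
    block_run (block_channel W) g m1 m2 (rev (take j Cs))"
  using assms(1)
proof (induction j)
  case 0
  show ?case by (simp add: blocks_def)
next
  case (Suc j)
  let ?O = "outputs W (letter_code g n Cs d1 d2) m1 m2"
  let ?C = "Cs ! j"
  let ?F = "\<lambda>j ys. (rev (map unzip3 (blocks n j ys)), relay_state g n Cs j (map outr ys))"
  let ?X = "\<lambda>l. zip (fst ?C m1) (zip (fst (snd ?C) m2) (snd (snd ?C) l))"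
  have C: "?C \<in> set Cs" using Suc by simp
  have st: "relay_state g n Cs j yr \<le> L" for yr
    using g by (cases j) auto
  have lX: "length (?X l) = n" if "l \<le> L" for l
    using len(1,2)[OF C] len(3)[OF C that] by simp
  have "?O (Suc j * n) = ?O (j * n + n)" by (simp add: add.commute)
  also have "\<dots> = bind_pmf (?O (j * n)) (\<lambda>ys. map_pmf ((@) ys) (prod_channel W (take n (?X (relay_state g n Cs j (map outr ys))))))"
    by (rule outputs_within_block[where L=L]) (rule order_refl len(1)[OF C] len(2)[OF C] st | erule len(3)[OF C])+
  finally have "map_pmf (?F (Suc j)) (?O (Suc j * n)) = bind_pmf (?O (j * n)) (\<lambda>ys.
      map_pmf (\<lambda>zs. ?F (Suc j) (ys @ zs)) (prod_channel W (?X (relay_state g n Cs j (map outr ys)))))"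
    using lX st by (simp add: map_bind_pmf map_pmf_comp del: relay_state.simps)
  also have "\<dots> = bind_pmf (?O (j * n)) (\<lambda>ys. map_pmf (\<lambda>zs. (unzip3 zs # fst (?F j ys), relay_next g (snd (?F j ys)) (?C, unzip3 zs)))
      (prod_channel W (?X (snd (?F j ys)))))"
  proof (rule bind_pmf_cong[OF refl], unfold snd_conv, rule map_pmf_cong[OF refl])
    fix ys zs assume ys: "ys \<in> set_pmf (?O (j * n))" and zs: "zs \<in> set_pmf (prod_channel W (?X (relay_state g n Cs j (map outr ys))))"
    have l: "length ys = j * n" "length zs = n"
      using length_outputs[OF ys] length_prod_channel[OF zs] lX[OF st] by auto
    thus "?F (Suc j) (ys @ zs) = (unzip3 zs # fst (?F j ys), relay_next g (relay_state g n Cs j (map outr ys)) (?C, unzip3 zs))"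
      by (simp add: blocks_append relay_state_append relay_next_def unzip3_def case_prod_unfold)
  qed
  also have "\<dots> = bind_pmf (map_pmf (?F j) (?O (j * n))) (\<lambda>(ys, l). map_pmf (\<lambda>y. (y # ys, relay_next g l (?C, y)))
      (block_channel W (fst ?C m1, fst (snd ?C) m2, snd (snd ?C) l)))"
    by (simp add: bind_map_pmf block_channel_def map_pmf_comp)
  also have "map_pmf (?F j) (?O (j * n)) = block_run (block_channel W) g m1 m2 (rev (take j Cs))"
    using Suc by simp
  finally show ?case
    using Suc.prems by (simp add: take_Suc_conv_app_nth)
qed

text \<open>The fallback 1 keeps the decoder inside the nonempty message set, as
  \<open>is_code\<close> demands.\<close>

definition unique_message :: "nat \<Rightarrow> (nat \<Rightarrow> bool) \<Rightarrow> nat" where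
  "unique_message M Q = (if \<exists>!m. m \<in> {1..M} \<and> Q m then THE m. m \<in> {1..M} \<and> Q m else 1)"

lemma unique_message_in:
  assumes "M > 0"
  shows "unique_message M Q \<in> {1..M}"
proof (cases "\<exists>!m. m \<in> {1..M} \<and> Q m")
  case True
  from theI'[OF this] True show ?thesis unfolding unique_message_def by (simp only: if_True)
next
  case False
  with assms show ?thesis unfolding unique_message_def by (simp only: if_False) simp
qed

lemma unique_message_eq:
  assumes "m \<in> {1..M}" "Q m" "\<And>m'. m' \<in> {1..M} \<Longrightarrow> m' \<noteq> m \<Longrightarrow> \<not> Q m'"
  shows "unique_message M Q = m"
proof -
  have ex1: "\<exists>!m. m \<in> {1..M} \<and> Q m" using assms by blast
  have "(THE m. m \<in> {1..M} \<and> Q m) = m"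
    using assms by (intro the_equality) blast+
  with ex1 show ?thesis unfolding unique_message_def by (simp only: if_True)
qed

lemma blocks_take: "blocks n b (take (b * n) ys) = blocks n b ys"
proof -
  have "take n (drop (i * n) (take (b * n) ys)) = take n (drop (i * n) ys)" if "i < b" for i
  proof -
    have "Suc i * n \<le> b * n" using that by (intro mult_le_mono1) simp
    thus ?thesis by (simp add: drop_take min_def)
  qed
  thus ?thesis by (simp add: blocks_def)
qed

definition cf_code :: "nat \<Rightarrow> nat \<Rightarrow> nat \<Rightarrow> ('x2 list \<times> ('x1 list \<times> 'u list) \<times> 'r list \<times> 'h) set \<Rightarrow>
    ('x1 list \<times> ('x2 list \<times> 'v list) \<times> 'r list \<times> 'h) set \<Rightarrow> (nat \<Rightarrow> 'h) \<Rightarrow>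
    ('r list \<Rightarrow> 'w list \<Rightarrow> nat) \<Rightarrow> nat \<Rightarrow> ('x1 list, 'x2 list, 'r list) block_code list \<Rightarrow>
    ('x1, 'x2, 'r, 'u, 'v, 'w) twrc_code" where
  "cf_code M1 M2 L S1 S2 c g n cs = letter_code g n (rev cs)
     (\<lambda>ys m1. unique_message M2 (\<lambda>m'. decodes L (fits S1 c m1 m') (zip (map swap3 cs) (rev (blocks n (length cs) ys)))))
     (\<lambda>ys m2. unique_message M1 (\<lambda>m'. decodes L (fits S2 c m2 m') (zip cs (rev (blocks n (length cs) ys)))))"

lemma error_prob_cf_code:
  fixes W :: "('x1, 'x2, 'r, 'u, 'v, 'w) twrc" and c :: "nat \<Rightarrow> 'h"
  assumes M: "messages N R1 = {1..M1}" "messages N R2 = {1..M2}" "M1 > 0" "M2 > 0"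
    and b: "length cs * n \<le> N"
    and len: "\<And>C m. C \<in> set cs \<Longrightarrow> length (fst C m) = n" "\<And>C m. C \<in> set cs \<Longrightarrow> length (fst (snd C) m) = n"
      "\<And>C l. C \<in> set cs \<Longrightarrow> length (snd (snd C) l) = n"
    and g: "\<And>r w. g r w \<le> L"
  shows "ennreal (error_prob W N R1 R2 (cf_code M1 M2 L S1 S2 c g n cs)) \<le>
    average_block_error (block_channel W) g M1 M2 L S1 S2 c cs"
proof -
  let ?C = "cf_code M1 M2 L S1 S2 c g n cs"
  let ?b = "length cs"
  define err where "err = (\<lambda>m1 m2 (ys :: ('u \<times> 'v \<times> 'w) list). dec1 ?C (map out1 ys) m1 \<noteq> m2 \<or> dec2 ?C (map out2 ys) m2 \<noteq> m1)"
  have "ennreal (error_prob W N R1 R2 ?C) =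
    (\<integral>\<^sup>+m1. \<integral>\<^sup>+m2. emeasure (outputs W ?C m1 m2 N) {ys. err m1 m2 ys}
      \<partial>pmf_of_set {1..M2} \<partial>pmf_of_set {1..M1})"
    unfolding error_prob_def transmission_def M measure_pmf.emeasure_eq_measure[symmetric] emeasure_pmf_of_bool case_prod_unfold
    by (simp add: err_def case_prod_unfold)
  also have "\<dots> \<le> average_block_error (block_channel W) g M1 M2 L S1 S2 c cs"
  proof -
    have s: "set_pmf (pmf_of_set {1..M1}) = {1..M1}" "set_pmf (pmf_of_set {1..M2}) = {1..M2}"
      using M by (auto intro!: set_pmf_of_set)
    have "emeasure (outputs W ?C m1 m2 N) {ys. err m1 m2 ys} \<le>
       emeasure (block_run (block_channel W) g m1 m2 cs)
        {(ys, l). block_error M1 M2 L S1 S2 c m1 m2 cs ys}"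
      if m: "m1 \<in> {1..M1}" "m2 \<in> {1..M2}" for m1 m2
    proof -
      let ?E = "block_error M1 M2 L S1 S2 c m1 m2 cs"
      let ?B = "\<lambda>ys. rev (map unzip3 (blocks n ?b ys))"
      have B: "map fst (?B ys) = rev (blocks n ?b (map out1 ys))"
        "map (\<lambda>y. fst (snd y)) (?B ys) = rev (blocks n ?b (map out2 ys))" for ys
        by (simp_all add: rev_map[symmetric] blocks_map unzip3_def)
      have "err m1 m2 ys \<Longrightarrow> ?E (?B ys)" for ys
      proof (rule ccontr)
        assume e: "err m1 m2 ys" and "\<not> ?E (?B ys)"
        hence n: "decodes L (fits S1 c m1 m2) (zip (map swap3 cs) (rev (blocks n ?b (map out1 ys))))"
          "\<And>m'. m' \<in> {1..M2} \<Longrightarrow> m' \<noteq> m2 \<Longrightarrow> \<not> decodes L (fits S1 c m1 m') (zip (map swap3 cs) (rev (blocks n ?b (map out1 ys))))"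
          "decodes L (fits S2 c m2 m1) (zip cs (rev (blocks n ?b (map out2 ys))))"
          "\<And>m'. m' \<in> {1..M1} \<Longrightarrow> m' \<noteq> m1 \<Longrightarrow> \<not> decodes L (fits S2 c m2 m') (zip cs (rev (blocks n ?b (map out2 ys))))"
          unfolding block_error_def B by blast+
        have "dec1 ?C (map out1 ys) m1 = m2" "dec2 ?C (map out2 ys) m2 = m1"
          unfolding cf_code_def letter_code_def twrc_code.simps
          using m n by (intro unique_message_eq; blast)+
        with e show False unfolding err_def by blast
      qed
      hence "emeasure (outputs W ?C m1 m2 N) {ys. err m1 m2 ys} \<le>
         emeasure (outputs W ?C m1 m2 N) {ys. ?E (?B ys)}"
        by (intro emeasure_mono) auto
      \<comment> \<open>The letters after the last full block are cut off; the decoders ignore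
        them.\<close>
      also have "\<dots> = emeasure (map_pmf (take (?b * n)) (outputs W ?C m1 m2 (?b * n + (N - ?b * n)))) {ys. ?E (?B ys)}"
        using b by (simp add: blocks_take)
      also have "\<dots> = emeasure (map_pmf (\<lambda>ys. (?B ys, relay_state g n (rev cs) ?b (map outr ys))) (outputs W ?C m1 m2 (?b * n))) {(ys, l). ?E ys}"
        by (subst take_outputs) (simp add: case_prod_unfold)
      also have "\<dots> = emeasure (block_run (block_channel W) g m1 m2 cs) {(ys, l). ?E ys}"
        unfolding cf_code_def
        by (subst outputs_block_run[where L=L]) (use len g in auto)
      finally show ?thesis .
    qed
    thus ?thesis unfolding average_block_error_def
      by (intro nn_integral_mono_AE, unfold AE_measure_pmf_iff s, intro ballI nn_integral_mono_AE,
          unfold AE_measure_pmf_iff s, intro ballI)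
  qed
  finally show ?thesis .
qed

lemma is_code_cf_code:
  assumes "messages N R1 = {1..M1}" "messages N R2 = {1..M2}" "M1 > 0" "M2 > 0"
  shows "is_code N R1 R2 (cf_code M1 M2 L S1 S2 c g n cs)"
  using assms unique_message_in by (simp add: is_code_def cf_code_def letter_code_def)

subsection \<open>Block extensions of the single-letter laws\<close>

lemma prod_channel_const: "prod_channel (\<lambda>_. p) xs = replicate_pmf (length xs) p"
  by (induction xs) simp_all

lemma prod_channel_map: "prod_channel f (map g xs) = prod_channel (\<lambda>x. f (g x)) xs"
  by (induction xs) simp_all

text \<open>Independent repetition commutes with passing through a channel. Applied stage by stage,
  it carries the n-fold law through inputs, channel and quantizer.\<close>

lemma replicate_pmf_extend:
  "replicate_pmf n (bind_pmf p (\<lambda>x. map_pmf (Pair x) (f x))) =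
    bind_pmf (replicate_pmf n p) (\<lambda>xs. map_pmf (zip xs) (prod_channel f xs))"
proof (induction n)
  case (Suc n)
  have "replicate_pmf (Suc n) (bind_pmf p (\<lambda>x. map_pmf (Pair x) (f x))) =
    bind_pmf p (\<lambda>x. bind_pmf (f x) (\<lambda>y. bind_pmf (replicate_pmf n p) (\<lambda>xs.
      bind_pmf (prod_channel f xs) (\<lambda>ys. return_pmf ((x, y) # zip xs ys)))))"
    unfolding replicate_pmf.simps Suc by (simp add: bind_assoc_pmf bind_map_pmf bind_return_pmf map_pmf_def)
  also have "\<dots> = bind_pmf p (\<lambda>x. bind_pmf (replicate_pmf n p) (\<lambda>xs. bind_pmf (f x) (\<lambda>y.
      bind_pmf (prod_channel f xs) (\<lambda>ys. return_pmf ((x, y) # zip xs ys)))))"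
    by (intro bind_pmf_cong refl bind_commute_pmf)
  also have "\<dots> = bind_pmf (replicate_pmf (Suc n) p) (\<lambda>xs. map_pmf (zip xs) (prod_channel f xs))"
    by (simp add: bind_assoc_pmf bind_return_pmf map_pmf_def)
  finally show ?case .
qed (simp add: bind_return_pmf)

lemma length_replicate_pmf: "xs \<in> set_pmf (replicate_pmf n p) \<Longrightarrow> length xs = n"
  by (auto simp: set_replicate_pmf)

lemma pair_pmf_bind: "pair_pmf p q = bind_pmf p (\<lambda>x. map_pmf (Pair x) q)"
  by (simp add: pair_pmf_def map_pmf_def)

lemma replicate_pair_pmf:
  "replicate_pmf n (pair_pmf p q) = map_pmf (\<lambda>(xs, ys). zip xs ys) (pair_pmf (replicate_pmf n p) (replicate_pmf n q))"
proof -
  have "replicate_pmf n (pair_pmf p q) = bind_pmf (replicate_pmf n p) (\<lambda>xs. map_pmf (zip xs) (replicate_pmf n q))"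
    unfolding pair_pmf_bind replicate_pmf_extend
    by (intro bind_pmf_cong refl) (auto simp: prod_channel_const dest: length_replicate_pmf)
  thus ?thesis
    by (simp add: pair_pmf_bind map_bind_pmf map_pmf_comp)
qed

lemma replicate_map_pmf: "replicate_pmf n (map_pmf f p) = map_pmf (map f) (replicate_pmf n p)"
  by (induction n) (simp_all add: bind_map_pmf map_bind_pmf)

lemma pmf_bind_Cons:
  "pmf (bind_pmf p (\<lambda>x. bind_pmf Q (\<lambda>xs. return_pmf (x # xs)))) (y # ys) = pmf p y * pmf Q ys"
proof -
  have "bind_pmf p (\<lambda>x. bind_pmf Q (\<lambda>xs. return_pmf (x # xs))) = map_pmf (\<lambda>(x, xs). x # xs) (pair_pmf p Q)"
    by (simp add: pair_pmf_def map_bind_pmf)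
  moreover have "inj (\<lambda>(x :: 'a, xs). x # xs)" by (auto simp: inj_def)
  ultimately show ?thesis using pmf_map_inj'[of "\<lambda>(x, xs). x # xs" "pair_pmf p Q" "(y, ys)"] by (simp add: pmf_pair)
qed

lemma pmf_prod_channel:
  "pmf (prod_channel f (map X zs)) (map H zs) = prod_list (map (\<lambda>z. pmf (f (X z)) (H z)) zs)"
  by (induction zs) (simp_all add: pmf_bind_Cons)

lemma pmf_replicate_pmf:
  "length zs = n \<Longrightarrow> pmf (replicate_pmf n p) (map H zs) = prod_list (map (\<lambda>z. pmf p (H z)) zs)"
  using pmf_prod_channel[of "\<lambda>_. p" id zs H] by (simp add: prod_channel_const)

definition unzip4 :: "('a \<times> ('b \<times> 'y) \<times> 'r \<times> 'h) list \<Rightarrow> 'a list \<times> ('b list \<times> 'y list) \<times> 'r list \<times> 'h list" where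
  "unzip4 zs = (map fst zs, (map (\<lambda>z. fst (fst (snd z))) zs, map (\<lambda>z. snd (fst (snd z))) zs),
     map (\<lambda>z. fst (snd (snd z))) zs, map (\<lambda>z. snd (snd (snd z))) zs)"

text \<open>Injectivity, the length included, lets probabilities of tuples of words be computed on
  lists of letter tuples, where they are products.\<close>

lemma inj_unzip4: "inj unzip4"
proof (rule injI)
  fix xs ys :: "('a \<times> ('b \<times> 'c) \<times> 'd \<times> 'e) list"
  assume "unzip4 xs = unzip4 ys"
  thus "xs = ys"
  proof (induction xs arbitrary: ys)
    case (Cons x xs)
    then obtain y ys' where "ys = y # ys'" by (cases ys) (auto simp: unzip4_def)
    with Cons show ?case by (auto simp: unzip4_def prod_eq_iff)
  qed (simp add: unzip4_def)
qed

definition unzip7 where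
  "unzip7 zs = (map (\<lambda>(x1, x2, xr, y1, y2, yr, yh). x1) zs, map (\<lambda>(x1, x2, xr, y1, y2, yr, yh). x2) zs,
     map (\<lambda>(x1, x2, xr, y1, y2, yr, yh). xr) zs, map (\<lambda>(x1, x2, xr, y1, y2, yr, yh). y1) zs,
     map (\<lambda>(x1, x2, xr, y1, y2, yr, yh). y2) zs, map (\<lambda>(x1, x2, xr, y1, y2, yr, yh). yr) zs,
     map (\<lambda>(x1, x2, xr, y1, y2, yr, yh). yh) zs)"

definition block_quantizer :: "('r \<Rightarrow> 'w \<Rightarrow> 'h pmf) \<Rightarrow> 'r list \<Rightarrow> 'w list \<Rightarrow> 'h list pmf" where
  "block_quantizer q rs ws = prod_channel (\<lambda>(r, w). q r w) (zip rs ws)"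

abbreviation "block_joint n p1 p2 pr W q \<equiv>
  cf_joint (replicate_pmf n p1) (replicate_pmf n p2) (replicate_pmf n pr) (block_channel W) (block_quantizer q)"

text \<open>The bridge between the two descriptions of a block: as an instance of
  \<open>cf_joint\<close> over words it fits the coding bounds, which hold for arbitrary alphabets,
  and as an i.i.d. law it admits Chernoff bounds.\<close>

lemma cf_joint_block:
  "block_joint n p1 p2 pr W q =
    map_pmf unzip7 (replicate_pmf n (cf_joint p1 p2 pr W q))"
proof -
  define I where "I = pair_pmf p1 (pair_pmf p2 pr)"
  define A where "A = bind_pmf I (\<lambda>x. map_pmf (Pair x) (W x))"
  define f where "f = (\<lambda>((x1 :: 'a, x2 :: 'b, xr), (y1 :: 'd, y2 :: 'e, yr)). q xr yr)"
  define B where "B = bind_pmf A (\<lambda>a. map_pmf (Pair a) (f a))"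
  define fl where "fl = (\<lambda>(((x1, x2, xr), (y1, y2, yr)), yh). (x1 :: 'a, x2 :: 'b, xr :: 'c, y1 :: 'd, y2 :: 'e, yr :: 'f, yh :: 'g))"
  have J: "cf_joint p1 p2 pr W q = map_pmf fl B"
    unfolding cf_joint_def B_def A_def I_def f_def fl_def
    by (simp add: pair_pmf_def bind_assoc_pmf bind_return_pmf map_pmf_def case_prod_unfold)
  have "map_pmf unzip7 (replicate_pmf n (cf_joint p1 p2 pr W q)) = map_pmf (\<lambda>zs. unzip7 (map fl zs)) (replicate_pmf n B)"
    unfolding J replicate_map_pmf map_pmf_comp ..
  also have "\<dots> = bind_pmf (replicate_pmf n p1) (\<lambda>x1. bind_pmf (replicate_pmf n p2) (\<lambda>x2. bind_pmf (replicate_pmf n pr) (\<lambda>xr.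
     bind_pmf (prod_channel W (zip x1 (zip x2 xr))) (\<lambda>ys. bind_pmf (prod_channel f (zip (zip x1 (zip x2 xr)) ys)) (\<lambda>yh.
       return_pmf (unzip7 (map fl (zip (zip (zip x1 (zip x2 xr)) ys) yh))))))))"
    unfolding B_def replicate_pmf_extend A_def I_def replicate_pair_pmf
    by (simp add: pair_pmf_def bind_assoc_pmf bind_return_pmf map_pmf_def case_prod_unfold)
  also have "\<dots> = bind_pmf (replicate_pmf n p1) (\<lambda>x1. bind_pmf (replicate_pmf n p2) (\<lambda>x2. bind_pmf (replicate_pmf n pr) (\<lambda>xr.
     bind_pmf (prod_channel W (zip x1 (zip x2 xr))) (\<lambda>ys. bind_pmf (block_quantizer q xr (map outr ys)) (\<lambda>yh.
       return_pmf (x1, x2, xr, map out1 ys, map out2 ys, map outr ys, yh))))))"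
  proof (rule bind_pmf_cong[OF refl], rule bind_pmf_cong[OF refl], rule bind_pmf_cong[OF refl], rule bind_pmf_cong[OF refl])
    fix x1 x2 xr ys
    assume x: "x1 \<in> set_pmf (replicate_pmf n p1)" "x2 \<in> set_pmf (replicate_pmf n p2)" "xr \<in> set_pmf (replicate_pmf n pr)"
      and ys: "ys \<in> set_pmf (prod_channel W (zip x1 (zip x2 xr)))"
    \<comment> \<open>Zipping and unzipping are inverse only for equal lengths, which hold on the
      support; hence the congruence under the binds.\<close>
    have l: "length x1 = n" "length x2 = n" "length xr = n"
      using x by (auto dest: length_replicate_pmf)
    with length_prod_channel[OF ys] have l: "length x1 = n" "length x2 = n" "length xr = n" "length ys = n" by auto
    have "prod_channel f (zip (zip x1 (zip x2 xr)) ys) = prod_channel (\<lambda>(r, w). q r w) (map (\<lambda>((x1, x2, xr), (y1, y2, yr)). (xr, yr)) (zip (zip x1 (zip x2 xr)) ys))"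
      unfolding prod_channel_map by (rule arg_cong[where f="\<lambda>f. prod_channel f _"]) (auto simp: f_def)
    also have "map (\<lambda>((x1, x2, xr), (y1, y2, yr)). (xr, yr)) (zip (zip x1 (zip x2 xr)) ys) = zip xr (map outr ys)"
      using l by (intro nth_equalityI) (auto simp: case_prod_unfold)
    finally have e: "prod_channel f (zip (zip x1 (zip x2 xr)) ys) = block_quantizer q xr (map outr ys)"
      by (simp add: block_quantizer_def)
    show "bind_pmf (prod_channel f (zip (zip x1 (zip x2 xr)) ys)) (\<lambda>yh. return_pmf (unzip7 (map fl (zip (zip (zip x1 (zip x2 xr)) ys) yh)))) =
       bind_pmf (block_quantizer q xr (map outr ys)) (\<lambda>yh. return_pmf (x1, x2, xr, map out1 ys, map out2 ys, map outr ys, yh))"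
      unfolding e
    proof (rule bind_pmf_cong[OF refl])
      fix yh assume "yh \<in> set_pmf (block_quantizer q xr (map outr ys))"
      hence "length yh = n" using l by (auto simp: block_quantizer_def dest: length_prod_channel)
      hence "unzip7 (map fl (zip (zip (zip x1 (zip x2 xr)) ys) yh)) = (x1, x2, xr, map out1 ys, map out2 ys, map outr ys, yh)"
        using l unfolding unzip7_def
        by (auto intro!: nth_equalityI simp: fl_def case_prod_unfold)
      thus "return_pmf (unzip7 (map fl (zip (zip (zip x1 (zip x2 xr)) ys) yh))) = return_pmf (x1, x2, xr, map out1 ys, map out2 ys, map outr ys, yh)"
        by simp
    qed
  qed
  also have "\<dots> = block_joint n p1 p2 pr W q"
    unfolding cf_joint_def block_channel_def
    by (simp add: bind_map_pmf unzip3_def)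
  finally show ?thesis ..
qed

lemma quantize_side_law:
  "quantize q (side_law p1 p2 pr W) = map_pmf (\<lambda>(x1, x2, xr, y1, y2, yr, yh). (x1, (x2, y2), xr, yh)) (cf_joint p1 p2 pr W q)"
  unfolding quantize_def side_law_def cf_joint_def
  by (simp add: bind_assoc_pmf bind_return_pmf map_bind_pmf map_pmf_def case_prod_unfold)

lemma side_law_quantizer_event:
  "(\<integral>\<^sup>+(a, s, r, w). emeasure (measure_pmf (q r w)) {h. Q r w h} \<partial>side_law p1 p2 pr W) =
    emeasure (cf_joint p1 p2 pr W q) {(x1, x2, xr, y1, y2, yr, yh). Q xr yr yh}"
  unfolding emeasure_pmf_of_bool
  by (simp add: side_law_def cf_joint_def case_prod_unfold)

lemma cf_joint_swap:
  "cf_joint p2 p1 pr (swap_channel W) q =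
    map_pmf (\<lambda>(x1, x2, xr, y1, y2, yr, yh). (x2, x1, xr, y2, y1, yr, yh)) (cf_joint p1 p2 pr W q)"
  unfolding cf_joint_def swap_channel_def
  by (subst bind_commute_pmf[of p2 p1])
    (simp add: map_bind_pmf bind_map_pmf case_prod_unfold)

definition unzip_copies where
  "unzip_copies zs = (map fst zs, unzip4 (map (\<lambda>z. fst (snd z)) zs), map (\<lambda>z. fst (snd (snd z))) zs, map (\<lambda>z. snd (snd (snd z))) zs)"

lemma with_copies_block:
  "with_copies (replicate_pmf n pa) (replicate_pmf n pr) (replicate_pmf n ph) (map_pmf unzip4 (replicate_pmf n V)) =
    map_pmf unzip_copies (replicate_pmf n (with_copies pa pr ph V))"
proof -
  have "map_pmf unzip_copies (replicate_pmf n (with_copies pa pr ph V)) =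
    map_pmf (\<lambda>(a, v, r, h). unzip_copies (zip a (zip v (zip r h)))) (pair_pmf (replicate_pmf n pa) (pair_pmf (replicate_pmf n V)
      (pair_pmf (replicate_pmf n pr) (replicate_pmf n ph))))"
    unfolding with_copies_def replicate_pair_pmf pair_map_pmf2 map_pmf_comp
    by (simp add: case_prod_unfold apsnd_def)
  also have "\<dots> = map_pmf (\<lambda>(a, v, r, h). (a, unzip4 v, r, h)) (pair_pmf (replicate_pmf n pa) (pair_pmf (replicate_pmf n V)
      (pair_pmf (replicate_pmf n pr) (replicate_pmf n ph))))"
  proof (rule map_pmf_cong[OF refl])
    fix z assume "z \<in> set_pmf (pair_pmf (replicate_pmf n pa) (pair_pmf (replicate_pmf n V)
      (pair_pmf (replicate_pmf n pr) (replicate_pmf n ph))))"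
    moreover obtain a v r h where z: "z = (a, v, r, h)" by (cases z)
    ultimately have l: "length a = n" "length v = n" "length r = n" "length h = n"
      by (auto dest: length_replicate_pmf)
    have "map (\<lambda>z. fst (snd z)) (zip a (zip v (zip r h))) = v" "map (\<lambda>z. fst (snd (snd z))) (zip a (zip v (zip r h))) = r"
      "map (\<lambda>z. snd (snd (snd z))) (zip a (zip v (zip r h))) = h"
      using l by (auto intro!: nth_equalityI)
    thus "(case z of (a, v, r, h) \<Rightarrow> unzip_copies (zip a (zip v (zip r h)))) = (case z of (a, v, r, h) \<Rightarrow> (a, unzip4 v, r, h))"
      using l unfolding z unzip_copies_def by simp
  qed
  also have "\<dots> = with_copies (replicate_pmf n pa) (replicate_pmf n pr) (replicate_pmf n ph) (map_pmf unzip4 (replicate_pmf n V))"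
    unfolding with_copies_def pair_map_pmf1 pair_map_pmf2 map_pmf_comp
    by (simp add: case_prod_unfold apsnd_def apfst_def map_prod_def)
  finally show ?thesis ..
qed

lemma wrong_block:
  "wrong_input (unzip_copies zs) = unzip4 (map wrong_input zs)"
  "wrong_quantized (unzip_copies zs) = unzip4 (map wrong_quantized zs)"
  "wrong_all (unzip_copies zs) = unzip4 (map wrong_all zs)"
  "wrong_relay (unzip_copies zs) = unzip4 (map wrong_relay zs)"
  unfolding unzip_copies_def unzip4_def by (induction zs) auto

lemma map_with_copies_block:
  assumes "\<And>zs. f' (unzip_copies zs) = unzip4 (map f zs)"
  shows "map_pmf f' (with_copies (replicate_pmf n pa) (replicate_pmf n pr) (replicate_pmf n ph) (map_pmf unzip4 (replicate_pmf n V))) =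
    map_pmf unzip4 (replicate_pmf n (map_pmf f (with_copies pa pr ph V)))"
  unfolding with_copies_block map_pmf_comp assms replicate_map_pmf ..

text \<open>The sum in \<open>D\<close> is the relative entropy of \<open>V\<close> with respect to
  \<open>Q\<close>, the mean of the log-likelihood ratio per letter; the event asks this ratio to
  fall short of a smaller d on average.\<close>

lemma typical_set_bound:
  fixes V :: "'z::finite pmf"
  assumes "inj u" and Q: "set_pmf V \<subseteq> set_pmf Q"
    and D: "d < (\<Sum>z\<in>UNIV. pmf V z * (log 2 (pmf V z) - log 2 (pmf Q z)))"
  shows "\<exists>\<rho>. 0 < \<rho> \<and> \<rho> < 1 \<and> (\<forall>n. emeasure (map_pmf u (replicate_pmf n V))
     {z. pmf (map_pmf u (replicate_pmf n V)) z < 2 powr (real n * d) * pmf (map_pmf u (replicate_pmf n Q)) z} \<le> ennreal (\<rho> ^ n))"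
proof -
  have pos: "z \<in> set_pmf V \<Longrightarrow> pmf V z > 0" "z \<in> set_pmf V \<Longrightarrow> pmf Q z > 0" for z
    using Q by (auto simp: pmf_positive)
  from chernoff_log_ratio[OF pos D] obtain \<rho> where \<rho>: "0 < \<rho>" "\<rho> < 1"
    "\<And>n. emeasure (replicate_pmf n V) {zs. prod_list (map (pmf V) zs) < 2 powr (real n * d) * prod_list (map (pmf Q) zs)} \<le> ennreal (\<rho> ^ n)"
    by blast
  have "emeasure (map_pmf u (replicate_pmf n V))
     {z. pmf (map_pmf u (replicate_pmf n V)) z < 2 powr (real n * d) * pmf (map_pmf u (replicate_pmf n Q)) z} =
    emeasure (replicate_pmf n V) {zs. pmf (replicate_pmf n V) zs < 2 powr (real n * d) * pmf (replicate_pmf n Q) zs}" for n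
    by (simp add: vimage_def pmf_map_inj'[OF assms(1)])
  also have "\<dots> n \<le> emeasure (replicate_pmf n V) {zs. prod_list (map (pmf V) zs) < 2 powr (real n * d) * prod_list (map (pmf Q) zs)}" for n
  proof (intro emeasure_mono_AE, unfold AE_measure_pmf_iff, intro ballI impI)
    fix zs assume "zs \<in> set_pmf (replicate_pmf n V)"
    hence "length zs = n" by (rule length_replicate_pmf)
    moreover assume "zs \<in> {zs. pmf (replicate_pmf n V) zs < 2 powr (real n * d) * pmf (replicate_pmf n Q) zs}"
    ultimately show "zs \<in> {zs. prod_list (map (pmf V) zs) < 2 powr (real n * d) * prod_list (map (pmf Q) zs)}"
      using pmf_replicate_pmf[where H="\<lambda>z. z" and zs=zs and p=V] pmf_replicate_pmf[where H="\<lambda>z. z" and zs=zs and p=Q] by simp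
  qed simp
  finally show ?thesis using \<rho> by (meson order_trans)
qed

subsection \<open>Single-letter exponents\<close>

lemma ent_cong:
  assumes "\<And>z w. f z = f w \<longleftrightarrow> g z = g w"
  shows "ent J f = ent J g"
proof -
  have "pmf (map_pmf f J) (f z) = pmf (map_pmf g J) (g z)" for z
    unfolding pmf_map by (rule arg_cong[where f="measure _"]) (auto simp: assms)
  thus ?thesis by (simp add: ent_def)
qed

lemma ent_map_pmf:
  fixes J :: "'z::finite pmf" and v :: "'z \<Rightarrow> 'y::finite"
  shows "ent (map_pmf v J) f = ent J (\<lambda>z. f (v z))"
  unfolding ent_def by (subst sum_pmf_map) (simp add: map_pmf_comp)

lemma ent_const: "ent J (\<lambda>_. c) = 0"
  by (simp add: ent_def map_pmf_const)

lemma ent_indep: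
  fixes J :: "'z::finite pmf"
  assumes "map_pmf (\<lambda>z. (f z, g z)) J = pair_pmf (map_pmf f J) (map_pmf g J)"
  shows "ent J (\<lambda>z. (f z, g z)) = ent J f + ent J g"
proof -
  have "pmf J z * log 2 (pmf (map_pmf (\<lambda>z. (f z, g z)) J) (f z, g z)) =
      pmf J z * log 2 (pmf (map_pmf f J) (f z)) + pmf J z * log 2 (pmf (map_pmf g J) (g z))" for z
  proof (cases "z \<in> set_pmf J")
    case True
    hence "pmf (map_pmf f J) (f z) > 0" "pmf (map_pmf g J) (g z) > 0"
      by (auto intro!: pmf_positive)
    thus ?thesis unfolding assms by (simp add: pmf_pair log_mult algebra_simps)
  qed (simp add: set_pmf_iff)
  thus ?thesis by (simp add: ent_def sum.distrib)
qed

text \<open>Relative entropy when \<open>q\<close> is the mass function of a pmf. Allowing any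
  function permits splitting off the factors of \<open>q\<close> one by one, down to the constant 1,
  which yields minus the entropy of \<open>V\<close>.\<close>

definition kl :: "'z::finite pmf \<Rightarrow> ('z \<Rightarrow> real) \<Rightarrow> real" where
  "kl V q = (\<Sum>z\<in>UNIV. pmf V z * (log 2 (pmf V z) - log 2 (q z)))"

abbreviation "side_of z \<equiv> fst (snd z)"
abbreviation "relay_of z \<equiv> fst (snd (snd z))"
abbreviation "quant_of z \<equiv> snd (snd (snd z))"

definition copies :: "('a, 's, 'r, 'h) view pmf \<Rightarrow> ('a \<times> ('a, 's, 'r, 'h) view \<times> 'r \<times> 'h) pmf" where
  "copies V = with_copies (map_pmf fst V) (map_pmf relay_of V) (map_pmf quant_of V) V"

abbreviation "gap f V \<equiv> kl V (pmf (map_pmf f (copies V)))"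

text \<open>Absolute continuity: the copies have the marginals of \<open>V\<close>, so they coincide
  with the true values with positive probability.\<close>

lemma set_pmf_wrong:
  assumes "f \<in> {wrong_input, wrong_quantized, wrong_all, wrong_relay}"
  shows "set_pmf V \<subseteq> set_pmf (map_pmf f (copies V))"
proof
  fix z assume z: "z \<in> set_pmf V"
  obtain a s r h where abc: "z = (a, s, r, h)" by (cases z)
  have "(a, z, r, h) \<in> set_pmf (copies V)"
    using z abc by (force simp: copies_def with_copies_def)
  moreover have "f (a, z, r, h) = z" using assms abc by auto
  ultimately show "z \<in> set_pmf (map_pmf f (copies V))" by force
qed

lemma nn_integral_of_bool_eq: "(\<integral>\<^sup>+x. of_bool (f x = y) \<partial>measure_pmf p) = ennreal (pmf (map_pmf f p) y)"
  unfolding emeasure_pmf_of_bool[symmetric] pmf_map measure_pmf.emeasure_eq_measure[symmetric]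
  by (simp add: vimage_def)

text \<open>One computation for all four patterns: \<open>s\<close> selects what is kept of the true
  view, and \<open>P\<close> and \<open>Q\<close> are an equality or constantly true, according to
  whether the copy of the relay input or of the quantized output is visible.\<close>

lemma pmf_with_copies:
  assumes f: "\<And>a' v' r' h'. f (a', v', r', h') = z \<longleftrightarrow> a' = a \<and> s v' = y \<and> P r' \<and> Q h'"
  shows "ennreal (pmf (map_pmf f (with_copies pa pr ph V)) z) = ennreal (pmf pa a * pmf (map_pmf s V) y) *
    ((\<integral>\<^sup>+r. of_bool (P r) \<partial>measure_pmf pr) * (\<integral>\<^sup>+h. of_bool (Q h) \<partial>measure_pmf ph))"
proof -
  have "ennreal (pmf (map_pmf f (with_copies pa pr ph V)) z) = emeasure (map_pmf f (with_copies pa pr ph V)) {z}"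
    by (simp add: emeasure_pmf_single del: emeasure_map_pmf)
  also have "\<dots> = (\<integral>\<^sup>+a'. of_bool (a' = a) * (\<integral>\<^sup>+v. of_bool (s v = y) * (\<integral>\<^sup>+r. of_bool (P r) * (\<integral>\<^sup>+h. of_bool (Q h)
      \<partial>ph) \<partial>pr) \<partial>V) \<partial>pa)"
    unfolding emeasure_map_with_copies singleton_iff f of_bool_conj by (simp add: nn_integral_cmult)
  also have "\<dots> = (\<integral>\<^sup>+a'. of_bool (a' = a) \<partial>pa) * ((\<integral>\<^sup>+v. of_bool (s v = y) \<partial>V) *
      ((\<integral>\<^sup>+r. of_bool (P r) \<partial>pr) * (\<integral>\<^sup>+h. of_bool (Q h) \<partial>ph)))"
    by (simp add: nn_integral_multc)
  also have "(\<integral>\<^sup>+a'. of_bool (a' = a) \<partial>pa) = ennreal (pmf pa a)"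
    using nn_integral_of_bool_eq[where f="\<lambda>x. x" and y=a and p=pa] by simp
  also have "(\<integral>\<^sup>+v. of_bool (s v = y) \<partial>V) = ennreal (pmf (map_pmf s V) y)"
    by (rule nn_integral_of_bool_eq)
  finally show ?thesis by (simp add: ennreal_mult mult.assoc)
qed

lemma nn_integral_of_bool_True: "(\<integral>\<^sup>+x. of_bool True \<partial>measure_pmf p) = 1"
  by simp

lemma nn_integral_of_bool_single: "(\<integral>\<^sup>+x. of_bool (x = y) \<partial>measure_pmf p) = ennreal (pmf p y)"
  using nn_integral_of_bool_eq[where f="\<lambda>x. x" and y=y and p=p] by simp

lemma pmf_wrong_input:
  "pmf (map_pmf wrong_input (copies V)) (a, s, r, h) = pmf (map_pmf fst V) a * pmf (map_pmf snd V) (s, r, h)"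
  using pmf_with_copies[of wrong_input "(a, s, r, h)" a snd "(s, r, h)" "\<lambda>_. True" "\<lambda>_. True"
      "map_pmf fst V" "map_pmf relay_of V" "map_pmf quant_of V" V,
      unfolded nn_integral_of_bool_True nn_integral_of_bool_single]
  by (force simp: copies_def)

lemma pmf_wrong_quantized:
  "pmf (map_pmf wrong_quantized (copies V)) (a, s, r, h) =
    pmf (map_pmf fst V) a * pmf (map_pmf (\<lambda>z. (side_of z, relay_of z)) V) (s, r) *
    pmf (map_pmf quant_of V) h"
  using pmf_with_copies[of wrong_quantized "(a, s, r, h)" a "\<lambda>z. (side_of z, relay_of z)" "(s, r)" "\<lambda>_. True" "\<lambda>x. x = h"
      "map_pmf fst V" "map_pmf relay_of V" "map_pmf quant_of V" V,
      unfolded nn_integral_of_bool_True nn_integral_of_bool_single]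
  by (force simp: copies_def ennreal_mult[symmetric])

lemma pmf_wrong_all:
  "pmf (map_pmf wrong_all (copies V)) (a, s, r, h) =
    pmf (map_pmf fst V) a * pmf (map_pmf side_of V) s * (pmf (map_pmf relay_of V) r *
    pmf (map_pmf quant_of V) h)"
  using pmf_with_copies[of wrong_all "(a, s, r, h)" a side_of s "\<lambda>x. x = r" "\<lambda>x. x = h"
      "map_pmf fst V" "map_pmf relay_of V" "map_pmf quant_of V" V,
      unfolded nn_integral_of_bool_True nn_integral_of_bool_single]
  by (force simp: copies_def ennreal_mult[symmetric])

lemma pmf_wrong_relay:
  "pmf (map_pmf wrong_relay (copies V)) (a, s, r, h) =
    pmf (map_pmf fst V) a * pmf (map_pmf (\<lambda>z. (side_of z, quant_of z)) V) (s, h) *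
    pmf (map_pmf relay_of V) r"
  using pmf_with_copies[of wrong_relay "(a, s, r, h)" a "\<lambda>z. (side_of z, quant_of z)" "(s, h)" "\<lambda>x. x = r" "\<lambda>_. True"
      "map_pmf fst V" "map_pmf relay_of V" "map_pmf quant_of V" V,
      unfolded nn_integral_of_bool_True nn_integral_of_bool_single]
  by (force simp: copies_def ennreal_mult[symmetric])

lemma kl_one: "kl V (\<lambda>_. 1) = - ent V (\<lambda>z. z)"
  by (simp add: kl_def ent_def)

text \<open>The logarithm turns the extra factor into a summand whose mean is minus the entropy of
  the marginal; positivity on the support justifies splitting the logarithm.\<close>

lemma kl_times_marginal:
  fixes V :: "'z::finite pmf"
  assumes "\<And>z. z \<in> set_pmf V \<Longrightarrow> q z > 0"
  shows "kl V (\<lambda>z. q z * pmf (map_pmf g V) (g z)) = kl V q + ent V g"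
proof -
  have "pmf V z * (log 2 (pmf V z) - log 2 (q z * pmf (map_pmf g V) (g z))) =
      pmf V z * (log 2 (pmf V z) - log 2 (q z)) - pmf V z * log 2 (pmf (map_pmf g V) (g z))" for z
  proof (cases "z \<in> set_pmf V")
    case True
    hence "q z > 0" "pmf (map_pmf g V) (g z) > 0" using assms by (auto intro!: pmf_positive)
    thus ?thesis by (simp add: log_mult algebra_simps)
  qed (simp add: set_pmf_iff)
  thus ?thesis by (simp add: kl_def ent_def sum_subtractf)
qed

lemma pmf_map_pos: "z \<in> set_pmf V \<Longrightarrow> pmf (map_pmf g V) (g z) > 0"
  by (auto intro!: pmf_positive)

lemma kl_wrong_input:
  "gap wrong_input V = ent V fst + ent V snd - ent V (\<lambda>z. z)"
proof -
  have "pmf (map_pmf wrong_input (copies V)) = (\<lambda>z. 1 * pmf (map_pmf fst V) (fst z) * pmf (map_pmf snd V) (snd z))"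
    by (auto simp: pmf_wrong_input fun_eq_iff)
  thus ?thesis by (simp only:) (subst kl_times_marginal, simp add: pmf_map_pos, subst kl_times_marginal, simp, simp add: kl_one)
qed

lemma kl_wrong_quantized:
  "gap wrong_quantized V = ent V fst + ent V (\<lambda>z. (side_of z, relay_of z))
     + ent V quant_of - ent V (\<lambda>z. z)"
proof -
  have "pmf (map_pmf wrong_quantized (copies V)) = (\<lambda>z. 1 * pmf (map_pmf fst V) (fst z)
      * pmf (map_pmf (\<lambda>z. (side_of z, relay_of z)) V) (side_of z, relay_of z)
      * pmf (map_pmf quant_of V) (quant_of z))"
    by (auto simp: pmf_wrong_quantized fun_eq_iff)
  thus ?thesis by (simp only:)
    (subst kl_times_marginal, simp add: pmf_map_pos pmf_map_pos[where g="\<lambda>z. (side_of z, relay_of z)"],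
     subst kl_times_marginal[where g="\<lambda>z. (side_of z, relay_of z)"], simp add: pmf_map_pos,
     subst kl_times_marginal, simp, simp add: kl_one)
qed

lemma kl_wrong_all:
  "gap wrong_all V = ent V fst + ent V side_of + ent V relay_of
     + ent V quant_of - ent V (\<lambda>z. z)"
proof -
  have "pmf (map_pmf wrong_all (copies V)) = (\<lambda>z. 1 * pmf (map_pmf fst V) (fst z)
      * pmf (map_pmf side_of V) (side_of z) * pmf (map_pmf relay_of V) (relay_of z)
      * pmf (map_pmf quant_of V) (quant_of z))" (is "_ = (\<lambda>z. 1 * ?a z * ?s z * ?r z * ?h z)")
    by (auto simp: pmf_wrong_all fun_eq_iff)
  hence "gap wrong_all V = kl V (\<lambda>z. 1 * ?a z * ?s z * ?r z * ?h z)"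
    by (simp only:)
  also have "\<dots> = kl V (\<lambda>z. 1 * ?a z * ?s z * ?r z) + ent V quant_of"
    by (rule kl_times_marginal) (intro mult_pos_pos pmf_map_pos, simp_all)
  also have "kl V (\<lambda>z. 1 * ?a z * ?s z * ?r z) = kl V (\<lambda>z. 1 * ?a z * ?s z) + ent V relay_of"
    by (rule kl_times_marginal) (intro mult_pos_pos pmf_map_pos, simp_all)
  also have "kl V (\<lambda>z. 1 * ?a z * ?s z) = kl V (\<lambda>z. 1 * ?a z) + ent V side_of"
    by (rule kl_times_marginal) (intro mult_pos_pos pmf_map_pos, simp_all)
  also have "kl V (\<lambda>z. 1 * ?a z) = kl V (\<lambda>_. 1) + ent V fst"
    by (rule kl_times_marginal) simp
  finally show ?thesis by (simp add: kl_one)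
qed

lemma kl_wrong_relay:
  "gap wrong_relay V = ent V fst + ent V (\<lambda>z. (side_of z, quant_of z))
     + ent V relay_of - ent V (\<lambda>z. z)"
proof -
  have "pmf (map_pmf wrong_relay (copies V)) = (\<lambda>z. 1 * pmf (map_pmf fst V) (fst z)
      * pmf (map_pmf (\<lambda>z. (side_of z, quant_of z)) V) (side_of z, quant_of z)
      * pmf (map_pmf relay_of V) (relay_of z))"
    by (auto simp: pmf_wrong_relay fun_eq_iff)
  thus ?thesis by (simp only:)
    (subst kl_times_marginal, simp add: pmf_map_pos pmf_map_pos[where g="\<lambda>z. (side_of z, quant_of z)"],
     subst kl_times_marginal[where g="\<lambda>z. (side_of z, quant_of z)"], simp add: pmf_map_pos,
     subst kl_times_marginal, simp, simp add: kl_one)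
qed

text \<open>The difference of the two sides is the conditional mutual information of the relay input and the
  quantized output given the side information.\<close>

lemma kl_exchange:
  fixes V :: "('a::finite, 's::finite, 'r::finite, 'h::finite) view pmf"
  shows "gap wrong_input V + gap wrong_all V \<le>
    gap wrong_quantized V + gap wrong_relay V"
proof -
  have "0 \<le> cond_mutual_info V relay_of quant_of side_of"
    by (rule cond_mutual_info_nonneg)
  also have "\<dots> = ent V (\<lambda>z. (quant_of z, side_of z)) + ent V (\<lambda>z. (relay_of z, side_of z))
      - ent V (\<lambda>z. (relay_of z, quant_of z, side_of z)) - ent V side_of"
    using cond_mutual_info_ent[of V relay_of "\<lambda>z. z" quant_of side_of] by simp
  also have "ent V (\<lambda>z. (quant_of z, side_of z)) = ent V (\<lambda>z. (side_of z, quant_of z))"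
    by (rule ent_cong) auto
  also have "ent V (\<lambda>z. (relay_of z, side_of z)) = ent V (\<lambda>z. (side_of z, relay_of z))"
    by (rule ent_cong) auto
  also have "ent V (\<lambda>z. (relay_of z, quant_of z, side_of z)) = ent V snd"
    by (rule ent_cong) (auto simp: prod_eq_iff)
  finally show ?thesis
    unfolding kl_wrong_input kl_wrong_all kl_wrong_quantized kl_wrong_relay by simp
qed

lemma pmf_bind_map_Pair: "pmf (bind_pmf p (\<lambda>x. map_pmf (Pair x) (f x))) (c, h) = pmf p c * pmf (f c) h"
proof -
  have "ennreal (pmf (bind_pmf p (\<lambda>x. map_pmf (Pair x) (f x))) (c, h)) = (\<integral>\<^sup>+x. emeasure (f x) {y. x = c \<and> y = h} \<partial>p)"
    unfolding emeasure_pmf_single[symmetric] by (simp add: vimage_def)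
  also have "\<dots> = (\<integral>\<^sup>+x. ennreal (pmf (f c) h) * indicator {c} x \<partial>p)"
    by (intro nn_integral_cong) (auto simp: indicator_def emeasure_pmf_single)
  also have "\<dots> = ennreal (pmf p c * pmf (f c) h)"
    by (simp add: nn_integral_cmult emeasure_pmf_single ennreal_mult mult.commute)
  finally show ?thesis by simp
qed

section \<open>The rates of the theorem as exponents\<close>

abbreviation coord_x1 where "coord_x1 \<equiv> \<lambda>(x1, x2, xr, y1, y2, yr, yh). x1"
abbreviation coord_x2 where "coord_x2 \<equiv> \<lambda>(x1, x2, xr, y1, y2, yr, yh). x2"
abbreviation coord_xr where "coord_xr \<equiv> \<lambda>(x1, x2, xr, y1, y2, yr, yh). xr"
abbreviation coord_y1 where "coord_y1 \<equiv> \<lambda>(x1, x2, xr, y1, y2, yr, yh). y1"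
abbreviation coord_y2 where "coord_y2 \<equiv> \<lambda>(x1, x2, xr, y1, y2, yr, yh). y2"
abbreviation coord_yr where "coord_yr \<equiv> \<lambda>(x1, x2, xr, y1, y2, yr, yh). yr"
abbreviation coord_yh where "coord_yh \<equiv> \<lambda>(x1, x2, xr, y1, y2, yr, yh). yh"

text \<open>Minus the conditional entropy of the quantized output given the relay's input and
  output, when \<open>J\<close> is the joint law built with \<open>q\<close>.\<close>

definition quantizer_log :: "('r \<Rightarrow> 'w \<Rightarrow> 'h pmf) \<Rightarrow> ('a::finite \<times> 'b::finite \<times> 'r::finite \<times> 'u::finite \<times> 'v::finite \<times> 'w::finite \<times> 'h::finite) pmf \<Rightarrow> real" where
  "quantizer_log q J = (\<Sum>z\<in>UNIV. pmf J z * log 2 (pmf (q (coord_xr z) (coord_yr z)) (coord_yh z)))"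

text \<open>The quantized output is drawn from \<open>q\<close> given (xr, yr) alone, and
  \<open>k\<close> reads these off \<open>f\<close>. The chain rule therefore adds the same
  conditional entropy for every such \<open>f\<close>.\<close>

lemma ent_markov:
  fixes q :: "'r::finite \<Rightarrow> 'w::finite \<Rightarrow> 'h::finite pmf" and pr :: "'r pmf" and p1 :: "'a::finite pmf" and p2 :: "'b::finite pmf"
    and W :: "'a \<times> 'b \<times> 'r \<Rightarrow> ('u::finite \<times> 'v::finite \<times> 'w) pmf"
  defines "J \<equiv> cf_joint p1 p2 pr W q"
  assumes k: "\<And>x1 x2 xr y1 y2 yr. k (f (x1, x2, xr, y1, y2, yr)) = (xr, yr)"
  shows "ent J (\<lambda>(x1, x2, xr, y1, y2, yr, yh). (f (x1, x2, xr, y1, y2, yr), yh)) =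
    ent J (\<lambda>(x1, x2, xr, y1, y2, yr, yh). f (x1, x2, xr, y1, y2, yr)) - quantizer_log q J"
proof -
  let ?f = "\<lambda>(x1, x2, xr, y1, y2, yr, yh :: 'h). f (x1, x2, xr, y1, y2, yr)"
  let ?g = "\<lambda>(x1, x2, xr, y1, y2, yr, yh :: 'h). (f (x1, x2, xr, y1, y2, yr), yh)"
  have k': "k (f (x1, x2, xr, y)) = (xr, snd (snd y))" for x1 x2 xr y
    by (cases y) (simp add: k)
  have g: "map_pmf ?g J = bind_pmf (map_pmf ?f J) (\<lambda>c. map_pmf (Pair c) (case_prod q (k c)))"
    unfolding J_def cf_joint_def
    by (simp add: map_bind_pmf bind_map_pmf bind_assoc_pmf bind_return_pmf map_pmf_def case_prod_unfold k')
  have "pmf J z * log 2 (pmf (map_pmf ?g J) (?g z)) =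
      pmf J z * log 2 (pmf (map_pmf ?f J) (?f z)) + pmf J z * log 2 (pmf (q (coord_xr z) (coord_yr z)) (coord_yh z))" for z
  proof (cases "z \<in> set_pmf J")
    case True
    obtain x1 x2 xr y1 y2 yr yh where z: "z = (x1, x2, xr, y1, y2, yr, yh)" by (cases z)
    have p: "pmf (map_pmf ?g J) (?g z) = pmf (map_pmf ?f J) (?f z) * pmf (q xr yr) yh"
      unfolding g z by (simp add: pmf_bind_map_Pair k)
    have "pmf (map_pmf ?g J) (?g z) > 0" "pmf (map_pmf ?f J) (?f z) > 0"
      using True by (intro pmf_map_pos; simp)+
    hence "pmf (q xr yr) yh > 0" unfolding p by (simp add: zero_less_mult_iff)
    with \<open>pmf (map_pmf ?f J) (?f z) > 0\<close> show ?thesis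
      unfolding p by (simp add: log_mult distrib_left z)
  qed (simp add: set_pmf_iff)
  thus ?thesis by (simp add: ent_def quantizer_log_def sum.distrib)
qed

text \<open>The mutual information of Yh with the pair (Xr, Yr), not conditioned on Xr, because the
  quantization codebook is generated without regard to the relay word.\<close>

definition quantization_rate :: "('xr \<Rightarrow> 'yr \<Rightarrow> 'yh pmf) \<Rightarrow>
    ('x1::finite \<times> 'x2::finite \<times> 'xr::finite \<times> 'y1::finite \<times> 'y2::finite \<times> 'yr::finite \<times> 'yh::finite) pmf \<Rightarrow> real" where
  "quantization_rate q J = ent J coord_yh + quantizer_log q J"

context
  fixes W :: "('x1::finite, 'x2::finite, 'xr::finite, 'y1::finite, 'y2::finite, 'yr::finite) twrc"
    and p1 :: "'x1 pmf" and p2 :: "'x2 pmf" and pr :: "'xr pmf"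
    and q :: "'xr \<Rightarrow> 'yr \<Rightarrow> 'yh::finite pmf"
    and J :: "('x1 \<times> 'x2 \<times> 'xr \<times> 'y1 \<times> 'y2 \<times> 'yr \<times> 'yh) pmf"
  defines "J \<equiv> cf_joint p1 p2 pr W q"
begin

lemma marginals:
  "map_pmf coord_x1 J = p1" "map_pmf coord_x2 J = p2" "map_pmf coord_xr J = pr"
  unfolding J_def cf_joint_def
  by (simp_all add: map_bind_pmf case_prod_unfold bind_return_pmf')

lemma ent_J_markov:
  assumes "\<And>x1 x2 xr y1 y2 yr. k (f (x1, x2, xr, y1, y2, yr)) = (xr, yr)"
  shows "ent J (\<lambda>(x1, x2, xr, y1, y2, yr, yh). (f (x1, x2, xr, y1, y2, yr), yh)) =
    ent J (\<lambda>(x1, x2, xr, y1, y2, yr, yh). f (x1, x2, xr, y1, y2, yr)) - quantizer_log q J"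
  unfolding J_def by (rule ent_markov[of k f, OF assms])

lemma ent_inputs:
  "ent J (\<lambda>(x1, x2, xr, y1, y2, yr, yh). (x1, (x2, xr))) = ent J coord_x1 + (ent J coord_x2 + ent J coord_xr)"
proof -
  have 0: "map_pmf (\<lambda>(x1, x2, xr, y1, y2, yr, yh). (x2, xr)) J = pair_pmf p2 pr"
    "map_pmf (\<lambda>(x1, x2, xr, y1, y2, yr, yh). (x1, (x2, xr))) J = pair_pmf p1 (pair_pmf p2 pr)"
    unfolding J_def cf_joint_def pair_pmf_def
    by (simp_all add: map_bind_pmf case_prod_unfold bind_return_pmf bind_assoc_pmf)
  have "ent J (\<lambda>z. (coord_x1 z, (\<lambda>(x1, x2, xr, y1, y2, yr, yh). (x2, xr)) z)) = ent J coord_x1 + ent J (\<lambda>(x1, x2, xr, y1, y2, yr, yh). (x2, xr))"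
    by (rule ent_indep) (use 0 marginals in \<open>simp add: case_prod_unfold\<close>)
  moreover have "ent J (\<lambda>z. (coord_x2 z, coord_xr z)) = ent J coord_x2 + ent J coord_xr"
    by (rule ent_indep) (use 0 marginals in \<open>simp add: case_prod_unfold\<close>)
  ultimately show ?thesis by (simp add: case_prod_unfold)
qed

lemma quantization_rate_nonneg: "0 \<le> quantization_rate q J"
proof -
  have "0 \<le> cond_mutual_info J coord_yh (\<lambda>z. (coord_xr z, coord_yr z)) (\<lambda>_. ())"
    by (rule cond_mutual_info_nonneg)
  also have "\<dots> = ent J (\<lambda>z. ((coord_xr z, coord_yr z), ())) + ent J (\<lambda>z. (coord_yh z, ()))
      - ent J (\<lambda>z. (coord_yh z, (coord_xr z, coord_yr z), ())) - ent J (\<lambda>_. ())"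
    using cond_mutual_info_ent[of J coord_yh "\<lambda>z. z" "\<lambda>z. (coord_xr z, coord_yr z)" "\<lambda>_. ()"] by simp
  also have "ent J (\<lambda>z. ((coord_xr z, coord_yr z), ())) = ent J (\<lambda>(x1, x2, xr, y1, y2, yr, yh). (xr, yr))"
    by (rule ent_cong) auto
  also have "ent J (\<lambda>z. (coord_yh z, ())) = ent J coord_yh"
    by (rule ent_cong) auto
  also have "ent J (\<lambda>z. (coord_yh z, (coord_xr z, coord_yr z), ())) = ent J (\<lambda>(x1, x2, xr, y1, y2, yr, yh). ((xr, yr), yh))"
    by (rule ent_cong) auto
  also have "\<dots> = ent J (\<lambda>(x1, x2, xr, y1, y2, yr, yh). (xr, yr)) - quantizer_log q J"
    using ent_J_markov[where f="\<lambda>(x1, x2, xr, y1, y2, yr). (xr, yr)" and k=id] by simp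
  finally show ?thesis by (simp add: ent_const quantization_rate_def)
qed

context
  fixes P :: "'w pmf" and X1 X2 Xr Y1 Y2 Yr Yh
  assumes joint: "map_pmf (\<lambda>w. (X1 w, X2 w, Xr w, Y1 w, Y2 w, Yr w, Yh w)) P = J"
begin

lemma cond_mutual_info_joint:
  fixes f :: "'x1 \<times> 'x2 \<times> 'xr \<times> 'y1 \<times> 'y2 \<times> 'yr \<times> 'yh \<Rightarrow> 'a::finite"
    and g :: "_ \<Rightarrow> 'b::finite" and h :: "_ \<Rightarrow> 'c::finite"
  defines "V \<equiv> \<lambda>w. (X1 w, X2 w, Xr w, Y1 w, Y2 w, Yr w, Yh w)"
  shows "cond_mutual_info P (\<lambda>w. f (V w)) (\<lambda>w. g (V w)) (\<lambda>w. h (V w)) =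
    ent J (\<lambda>z. (g z, h z)) + ent J (\<lambda>z. (f z, h z)) - ent J (\<lambda>z. (f z, g z, h z)) - ent J h"
  using cond_mutual_info_ent[of P f V g h] joint by (simp add: V_def)

text \<open>Independence of the inputs splits their entropies, and the Markov property eliminates
  Yr. In the second identity the entropy of Yh inside \<open>gap wrong_all V\<close> cancels the one
  inside the quantization rate.\<close>

lemma user2_rates:
  defines "V \<equiv> map_pmf (\<lambda>(x1, x2, xr, y1, y2, yr, yh). (x1, (x2, y2), xr, yh)) J"
  shows "cond_mutual_info P X1 (\<lambda>w. (Y2 w, Yh w)) (\<lambda>w. (X2 w, Xr w)) = gap wrong_input V"
    and "cond_mutual_info P (\<lambda>w. (X1 w, Xr w)) Y2 X2 - cond_mutual_info P Yh Yr (\<lambda>w. (X1 w, X2 w, Xr w, Y2 w))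
      = gap wrong_all V - quantization_rate q J"
proof -
  let ?srh = "ent J (\<lambda>(x1, x2, xr, y1, y2, yr, yh). ((x2, y2), xr, yh))"
  let ?all = "ent J (\<lambda>(x1, x2, xr, y1, y2, yr, yh). (x1, (x2, y2), xr, yh))"
  let ?s = "ent J (\<lambda>(x1, x2, xr, y1, y2, yr, yh). (x2, y2))"
  let ?Z = "ent J (\<lambda>(x1, x2, xr, y1, y2, yr, yh). (x1, x2, xr, y2))"
  let ?Zyr = "ent J (\<lambda>(x1, x2, xr, y1, y2, yr, yh). (x1, x2, xr, y2, yr))"
  let ?rr = "ent J (\<lambda>(x1, x2, xr, y1, y2, yr, yh). (x2, xr))"
  have "ent V fst = ent J coord_x1" "ent V side_of = ?s" "ent V snd = ?srh" "ent V (\<lambda>z. z) = ?all"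
    "ent V relay_of = ent J coord_xr" "ent V quant_of = ent J coord_yh"
    unfolding V_def ent_map_pmf by (rule ent_cong; force)+
  note V = this
  have i: "?rr = ent J coord_x2 + ent J coord_xr"
  proof -
    have "ent J (\<lambda>z. (coord_x1 z, (\<lambda>(x1, x2, xr, y1, y2, yr, yh). (x2, xr)) z)) = ent J coord_x1 + ?rr"
      by (rule ent_indep)
        (simp add: J_def cf_joint_def pair_pmf_def map_bind_pmf bind_map_pmf case_prod_unfold bind_return_pmf bind_assoc_pmf)
    thus ?thesis using ent_inputs by (simp add: case_prod_unfold)
  qed
  have e: "ent J (\<lambda>z. ((coord_y2 z, coord_yh z), (coord_x2 z, coord_xr z))) = ?srh"
    "ent J (\<lambda>z. (coord_x1 z, (coord_x2 z, coord_xr z))) = ent J (\<lambda>(x1, x2, xr, y1, y2, yr, yh). (x1, (x2, xr)))"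
    "ent J (\<lambda>z. (coord_x1 z, (coord_y2 z, coord_yh z), (coord_x2 z, coord_xr z))) = ?all"
    "ent J (\<lambda>z. (coord_x2 z, coord_xr z)) = ?rr" "ent J (\<lambda>z. (coord_y2 z, coord_x2 z)) = ?s"
    "ent J (\<lambda>z. ((coord_x1 z, coord_xr z), coord_x2 z)) = ent J (\<lambda>(x1, x2, xr, y1, y2, yr, yh). (x1, (x2, xr)))"
    "ent J (\<lambda>z. ((coord_x1 z, coord_xr z), coord_y2 z, coord_x2 z)) = ?Z"
    "ent J (\<lambda>z. (coord_yr z, coord_x1 z, coord_x2 z, coord_xr z, coord_y2 z)) = ?Zyr"
    "ent J (\<lambda>z. (coord_yh z, coord_x1 z, coord_x2 z, coord_xr z, coord_y2 z)) = ?all"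
    "ent J (\<lambda>z. (coord_yh z, coord_yr z, coord_x1 z, coord_x2 z, coord_xr z, coord_y2 z)) =
      ent J (\<lambda>(x1, x2, xr, y1, y2, yr, yh). ((x1, x2, xr, y2, yr), yh))"
    "ent J (\<lambda>z. (coord_x1 z, coord_x2 z, coord_xr z, coord_y2 z)) = ?Z"
    by (rule ent_cong; force)+
  have m: "ent J (\<lambda>(x1, x2, xr, y1, y2, yr, yh). ((x1, x2, xr, y2, yr), yh)) = ?Zyr - quantizer_log q J"
    using ent_J_markov[where f="\<lambda>(x1, x2, xr, y1, y2, yr). (x1, x2, xr, y2, yr)" and k="\<lambda>(x1, x2, xr, y2, yr). (xr, yr)"]
    by simp
  show "cond_mutual_info P X1 (\<lambda>w. (Y2 w, Yh w)) (\<lambda>w. (X2 w, Xr w)) = gap wrong_input V"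
    using cond_mutual_info_joint[where f=coord_x1 and g="\<lambda>z. (coord_y2 z, coord_yh z)" and h="\<lambda>z. (coord_x2 z, coord_xr z)"]
    unfolding e prod.case kl_wrong_input V i ent_inputs by linarith
  show "cond_mutual_info P (\<lambda>w. (X1 w, Xr w)) Y2 X2 - cond_mutual_info P Yh Yr (\<lambda>w. (X1 w, X2 w, Xr w, Y2 w))
      = gap wrong_all V - quantization_rate q J"
    using cond_mutual_info_joint[where f="\<lambda>z. (coord_x1 z, coord_xr z)" and g=coord_y2 and h=coord_x2]
      cond_mutual_info_joint[where f=coord_yh and g=coord_yr and h="\<lambda>z. (coord_x1 z, coord_x2 z, coord_xr z, coord_y2 z)"]
    unfolding e m prod.case kl_wrong_all V quantization_rate_def ent_inputs by linarith
qed

end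

end

text \<open>Follows from user 2 in the swapped channel: the view and the quantization rate carry
  over, and only the order of X1 and X2 in the condition has to be repaired.\<close>

lemma user1_rates:
  fixes W :: "('x1::finite, 'x2::finite, 'xr::finite, 'y1::finite, 'y2::finite, 'yr::finite) twrc"
    and q :: "'xr \<Rightarrow> 'yr \<Rightarrow> 'yh::finite pmf"
    and P :: "'w pmf" and X1 X2 Xr Y1 Y2 Yr Yh
  defines "J \<equiv> map_pmf (\<lambda>w. (X1 w, X2 w, Xr w, Y1 w, Y2 w, Yr w, Yh w)) P"
  assumes joint: "J = cf_joint p1 p2 pr W q"
  defines "V \<equiv> map_pmf (\<lambda>(x1, x2, xr, y1, y2, yr, yh). (x2, (x1, y1), xr, yh)) J"
  shows "cond_mutual_info P X2 (\<lambda>w. (Y1 w, Yh w)) (\<lambda>w. (X1 w, Xr w)) = gap wrong_input V"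
    and "cond_mutual_info P (\<lambda>w. (X2 w, Xr w)) Y1 X1 - cond_mutual_info P Yh Yr (\<lambda>w. (X1 w, X2 w, Xr w, Y1 w))
      = gap wrong_all V - quantization_rate q J"
proof -
  let ?sw = "\<lambda>(x1, x2, xr, y1, y2, yr, yh). (x2, x1, xr, y2, y1, yr, yh)"
  define J' where "J' = cf_joint p2 p1 pr (swap_channel W) q"
  have J': "J' = map_pmf ?sw J"
    unfolding J'_def joint by (rule cf_joint_swap)
  have joint': "map_pmf (\<lambda>w. (X2 w, X1 w, Xr w, Y2 w, Y1 w, Yr w, Yh w)) P = cf_joint p2 p1 pr (swap_channel W) q"
    using J' unfolding J'_def J_def by (simp add: map_pmf_comp)
  have V: "map_pmf (\<lambda>(x1, x2, xr, y1, y2, yr, yh). (x1, (x2, y2), xr, yh)) J' = V"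
    unfolding V_def J' by (simp add: map_pmf_comp case_prod_unfold)
  have "ent J' coord_yh = ent J coord_yh"
    unfolding J' ent_map_pmf by (rule ent_cong) auto
  moreover have "quantizer_log q J' = quantizer_log q J"
    unfolding quantizer_log_def J' by (subst sum_pmf_map) (simp add: case_prod_unfold)
  ultimately have r: "quantization_rate q J' = quantization_rate q J"
    by (simp add: quantization_rate_def)
  have Z: "cond_mutual_info P Yh Yr (\<lambda>w. (X2 w, X1 w, Xr w, Y1 w)) = cond_mutual_info P Yh Yr (\<lambda>w. (X1 w, X2 w, Xr w, Y1 w))"
  proof -
    have c: "ent J (\<lambda>z. (coord_yr z, (coord_x2 z, coord_x1 z, coord_xr z, coord_y1 z))) = ent J (\<lambda>z. (coord_yr z, (coord_x1 z, coord_x2 z, coord_xr z, coord_y1 z)))"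
      "ent J (\<lambda>z. (coord_yh z, (coord_x2 z, coord_x1 z, coord_xr z, coord_y1 z))) = ent J (\<lambda>z. (coord_yh z, (coord_x1 z, coord_x2 z, coord_xr z, coord_y1 z)))"
      "ent J (\<lambda>z. (coord_yh z, coord_yr z, (coord_x2 z, coord_x1 z, coord_xr z, coord_y1 z))) = ent J (\<lambda>z. (coord_yh z, coord_yr z, (coord_x1 z, coord_x2 z, coord_xr z, coord_y1 z)))"
      "ent J (\<lambda>z. (coord_x2 z, coord_x1 z, coord_xr z, coord_y1 z)) = ent J (\<lambda>z. (coord_x1 z, coord_x2 z, coord_xr z, coord_y1 z))"
      by (rule ent_cong; force)+
    show ?thesis
      using cond_mutual_info_joint[OF joint[unfolded J_def], where f=coord_yh and g=coord_yr and h="\<lambda>z. (coord_x1 z, coord_x2 z, coord_xr z, coord_y1 z)"]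
        cond_mutual_info_joint[OF joint[unfolded J_def], where f=coord_yh and g=coord_yr and h="\<lambda>z. (coord_x2 z, coord_x1 z, coord_xr z, coord_y1 z)"]
      unfolding joint[symmetric] c prod.case by linarith
  qed
  note u = user2_rates[OF joint', folded J'_def, unfolded V r Z]
  show "cond_mutual_info P X2 (\<lambda>w. (Y1 w, Yh w)) (\<lambda>w. (X1 w, Xr w)) = gap wrong_input V"
    by (rule u(1))
  show "cond_mutual_info P (\<lambda>w. (X2 w, Xr w)) Y1 X1 - cond_mutual_info P Yh Yr (\<lambda>w. (X1 w, X2 w, Xr w, Y1 w))
      = gap wrong_all V - quantization_rate q J"
    by (rule u(2))
qed

subsection \<open>Typical sets\<close>

abbreviation "wrong_patterns \<equiv> {wrong_input, wrong_quantized, wrong_all, wrong_relay}"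

text \<open>Typicality by likelihood ratios instead of empirical frequencies: exactly the four
  inequalities that the changes of measure need, each of which the true law violates with
  exponentially small probability.\<close>

definition typical :: "('a::finite \<times> ('b::finite \<times> 'y::finite) \<times> 'r::finite \<times> 'h::finite) pmf \<Rightarrow> real \<Rightarrow> nat \<Rightarrow>
    ('a list \<times> ('b list \<times> 'y list) \<times> 'r list \<times> 'h list) set" where
  "typical V \<epsilon> n = {z. \<forall>f\<in>wrong_patterns.
     2 powr (real n * (gap f V - \<epsilon>)) * pmf (map_pmf unzip4 (replicate_pmf n (map_pmf f (copies V)))) z
       \<le> pmf (map_pmf unzip4 (replicate_pmf n V)) z}"

abbreviation "atypical_mass V \<epsilon> n \<equiv> emeasure (map_pmf unzip4 (replicate_pmf n V)) (- typical V \<epsilon> n)"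

lemma typical_complement:
  assumes "\<epsilon> > 0"
  shows "\<exists>\<rho>. 0 < \<rho> \<and> \<rho> < 1 \<and> (\<forall>n. atypical_mass V \<epsilon> n \<le> ennreal (4 * \<rho> ^ n))"
proof -
  let ?d = "\<lambda>f. gap f V - \<epsilon>"
  let ?A = "\<lambda>f n. {z. pmf (map_pmf unzip4 (replicate_pmf n V)) z < 2 powr (real n * ?d f) * pmf (map_pmf unzip4 (replicate_pmf n (map_pmf f (copies V)))) z}"
  let ?P = "\<lambda>n. measure_pmf (map_pmf unzip4 (replicate_pmf n V))"
  have "\<forall>f\<in>wrong_patterns. \<exists>\<rho>. 0 < \<rho> \<and> \<rho> < 1 \<and> (\<forall>n. emeasure (?P n) (?A f n) \<le> ennreal (\<rho> ^ n))"
    by (rule ballI, rule typical_set_bound[OF inj_unzip4 set_pmf_wrong], assumption,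
        unfold kl_def, use assms in linarith)
  from bchoice[OF this] obtain r where
    r0: "\<forall>f\<in>wrong_patterns. 0 < r f \<and> r f < 1 \<and> (\<forall>n. emeasure (?P n) (?A f n) \<le> ennreal (r f ^ n))" ..
  note r = bspec[OF r0, THEN conjunct1] bspec[OF r0, THEN conjunct2, THEN conjunct1]
    bspec[OF r0, THEN conjunct2, THEN conjunct2, THEN spec]
  define \<rho> where "\<rho> = max (max (r wrong_input) (r wrong_quantized)) (max (r wrong_all) (r wrong_relay))"
  have "0 < r wrong_input" "r wrong_input < 1" "r wrong_quantized < 1" "r wrong_all < 1" "r wrong_relay < 1"
    by (rule r; simp only: insert_iff simp_thms)+
  hence \<rho>: "0 < \<rho>" "\<rho> < 1"
    unfolding \<rho>_def by (simp_all only: max_less_iff_conj less_max_iff_disj simp_thms)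
  have "r f \<le> \<rho>" if "f \<in> wrong_patterns" for f
    using that unfolding \<rho>_def by (elim insertE emptyE) (simp_all add: le_max_iff_disj)
  hence b: "emeasure (?P n) (?A f n) \<le> ennreal (\<rho> ^ n)" if "f \<in> wrong_patterns" for f n
    using that less_imp_le[OF r(1)[OF that]] by (intro order_trans[OF r(3)[OF that]] ennreal_leI power_mono)
  have "emeasure (?P n) (- typical V \<epsilon> n) \<le> ennreal (4 * \<rho> ^ n)" for n
  proof -
    have "- typical V \<epsilon> n = (?A wrong_input n \<union> ?A wrong_quantized n) \<union> (?A wrong_all n \<union> ?A wrong_relay n)"
      unfolding typical_def by auto
    hence "emeasure (?P n) (- typical V \<epsilon> n) = emeasure (?P n) ((?A wrong_input n \<union> ?A wrong_quantized n) \<union> (?A wrong_all n \<union> ?A wrong_relay n))"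
      by simp
    also have "\<dots> \<le> emeasure (?P n) (?A wrong_input n \<union> ?A wrong_quantized n) + emeasure (?P n) (?A wrong_all n \<union> ?A wrong_relay n)"
      by (rule emeasure_subadditive) (simp_all only: sets_measure_pmf UNIV_I)
    also have "\<dots> \<le> (emeasure (?P n) (?A wrong_input n) + emeasure (?P n) (?A wrong_quantized n)) + (emeasure (?P n) (?A wrong_all n) + emeasure (?P n) (?A wrong_relay n))"
      by (intro add_mono emeasure_subadditive) (simp_all only: sets_measure_pmf UNIV_I)
    also have "\<dots> \<le> (ennreal (\<rho> ^ n) + ennreal (\<rho> ^ n)) + (ennreal (\<rho> ^ n) + ennreal (\<rho> ^ n))"
      by (intro add_mono b) (simp_all only: insert_iff simp_thms)
    also have "\<dots> = ennreal (4 * \<rho> ^ n)"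
      using \<rho>(1) by (simp add: ennreal_plus[symmetric] del: ennreal_plus)
    finally show ?thesis .
  qed
  with \<rho> show ?thesis by blast
qed

text \<open>On the typical set the true law dominates the wrong one by the stated factor, and the
  true law has total mass 1.\<close>

lemma typical_wrong:
  assumes f: "f \<in> wrong_patterns" and f': "\<And>zs. f' (unzip_copies zs) = unzip4 (map f zs)"
  shows "emeasure (map_pmf f' (with_copies (replicate_pmf n (map_pmf fst V)) (replicate_pmf n (map_pmf relay_of V))
      (replicate_pmf n (map_pmf quant_of V)) (map_pmf unzip4 (replicate_pmf n V)))) (typical V \<epsilon> n)
    \<le> ennreal (2 powr - (real n * (gap f V - \<epsilon>)))"
  unfolding map_with_copies_block[OF f'] copies_def[symmetric] powr_minus_divide
  by (rule emeasure_pmf_density_le) (use f in \<open>auto simp: typical_def\<close>)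

definition block_accept :: "('r \<Rightarrow> 'w \<Rightarrow> 'h pmf) \<Rightarrow> 'h pmf \<Rightarrow> real \<Rightarrow> nat \<Rightarrow> 'r list \<Rightarrow> 'w list \<Rightarrow> 'h list \<Rightarrow> bool" where
  "block_accept q ph \<theta> n r w h \<longleftrightarrow> 2 powr (real n * \<theta>) * pmf (replicate_pmf n ph) h \<le> pmf (block_quantizer q r w) h"

text \<open>The relay tests only the lower bound. The upper bound belongs to the analysis: it makes
  a random codeword likely enough to be accepted for the covering argument.\<close>

definition block_close :: "('r \<Rightarrow> 'w \<Rightarrow> 'h pmf) \<Rightarrow> 'h pmf \<Rightarrow> real \<Rightarrow> real \<Rightarrow> nat \<Rightarrow> 'r list \<Rightarrow> 'w list \<Rightarrow> 'h list \<Rightarrow> bool" where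
  "block_close q ph \<theta> \<theta>' n r w h \<longleftrightarrow> block_accept q ph \<theta> n r w h \<and>
     pmf (block_quantizer q r w) h \<le> 2 powr (real n * \<theta>') * pmf (replicate_pmf n ph) h"

abbreviation "unquantized q ph R \<delta> n \<equiv>
  {(x1, x2, xr, y1, y2, yr, yh). \<not> block_close q ph (R - \<delta>) (R + \<delta>) n xr yr yh}"

text \<open>The log-likelihood ratio of test channel and codeword law has mean \<open>R\<close> per
  letter. Deviations by \<open>\<delta>\<close> in either direction are Chernoff events, the second
  one with the two functions exchanged.\<close>

lemma block_close_fails:
  fixes W :: "('x1::finite, 'x2::finite, 'xr::finite, 'y1::finite, 'y2::finite, 'yr::finite) twrc"
    and q :: "'xr \<Rightarrow> 'yr \<Rightarrow> 'yh::finite pmf" and p1 p2 pr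
  defines "J \<equiv> cf_joint p1 p2 pr W q"
  assumes \<delta>: "\<delta> > 0" and R: "R = quantization_rate q J" and ph: "ph = map_pmf coord_yh J"
  shows "\<exists>\<rho>. 0 < \<rho> \<and> \<rho> < 1 \<and> (\<forall>n. emeasure (block_joint n p1 p2 pr W q) (unquantized q ph R \<delta> n) \<le> ennreal (2 * \<rho> ^ n))"
proof -
  define \<alpha> where "\<alpha> = (\<lambda>z :: 'x1 \<times> 'x2 \<times> 'xr \<times> 'y1 \<times> 'y2 \<times> 'yr \<times> 'yh. pmf (q (coord_xr z) (coord_yr z)) (coord_yh z))"
  define \<beta> where "\<beta> = (\<lambda>z :: 'x1 \<times> 'x2 \<times> 'xr \<times> 'y1 \<times> 'y2 \<times> 'yr \<times> 'yh. pmf ph (coord_yh z))"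
  have pos: "\<alpha> z > 0" "\<beta> z > 0" if "z \<in> set_pmf J" for z
  proof -
    from that show "\<alpha> z > 0"
      unfolding \<alpha>_def J_def cf_joint_def by (auto intro!: pmf_positive)
    from that show "\<beta> z > 0"
      unfolding \<beta>_def ph by (rule pmf_map_pos)
  qed
  have E: "(\<Sum>z\<in>UNIV. pmf J z * (log 2 (\<alpha> z) - log 2 (\<beta> z))) = R"
    unfolding R quantization_rate_def quantizer_log_def ent_def \<alpha>_def \<beta>_def ph
    by (simp add: right_diff_distrib sum_subtractf)
  hence E': "(\<Sum>z\<in>UNIV. pmf J z * (log 2 (\<beta> z) - log 2 (\<alpha> z))) = - R"
    by (simp add: right_diff_distrib sum_subtractf)
  let ?P = "\<lambda>n. measure_pmf (replicate_pmf n J)"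
  let ?A = "\<lambda>n. {zs. prod_list (map \<alpha> zs) < 2 powr (real n * (R - \<delta>)) * prod_list (map \<beta> zs)}"
  let ?B = "\<lambda>n. {zs. prod_list (map \<beta> zs) < 2 powr (real n * (- (R + \<delta>))) * prod_list (map \<alpha> zs)}"
  from chernoff_log_ratio[where J=J and \<alpha>=\<alpha> and \<beta>=\<beta>, OF pos(1) pos(2), where d="R - \<delta>"] E \<delta>
  obtain \<rho>1 where \<rho>1: "0 < \<rho>1" "\<rho>1 < 1" "\<And>n. emeasure (?P n) (?A n) \<le> ennreal (\<rho>1 ^ n)" by auto
  from chernoff_log_ratio[where J=J and \<alpha>=\<beta> and \<beta>=\<alpha>, OF pos(2) pos(1), where d="- (R + \<delta>)"] E' \<delta>
  obtain \<rho>2 where \<rho>2: "0 < \<rho>2" "\<rho>2 < 1" "\<And>n. emeasure (?P n) (?B n) \<le> ennreal (\<rho>2 ^ n)" by auto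
  define \<rho> where "\<rho> = max \<rho>1 \<rho>2"
  have "emeasure (block_joint n p1 p2 pr W q) (unquantized q ph R \<delta> n) \<le> ennreal (2 * \<rho> ^ n)" for n
  proof -
    have "emeasure (block_joint n p1 p2 pr W q) (unquantized q ph R \<delta> n) =
      emeasure (?P n) {zs. \<not> block_close q ph (R - \<delta>) (R + \<delta>) n (map coord_xr zs) (map coord_yr zs) (map coord_yh zs)}"
      unfolding cf_joint_block J_def by (simp add: vimage_def unzip7_def)
    also have "\<dots> \<le> emeasure (?P n) (?A n \<union> ?B n)"
    proof (intro emeasure_mono_AE, unfold AE_measure_pmf_iff, intro ballI impI)
      fix zs assume "zs \<in> set_pmf (replicate_pmf n J)"
      hence n: "length zs = n" by (rule length_replicate_pmf)
      assume nc: "zs \<in> {zs. \<not> block_close q ph (R - \<delta>) (R + \<delta>) n (map coord_xr zs) (map coord_yr zs) (map coord_yh zs)}"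
      have h: "pmf (replicate_pmf n ph) (map coord_yh zs) = prod_list (map \<beta> zs)"
        unfolding \<beta>_def by (rule pmf_replicate_pmf[OF n])
      have "zip (map coord_xr zs) (map coord_yr zs) = map (\<lambda>z. (coord_xr z, coord_yr z)) zs"
        by (induction zs) auto
      hence a: "pmf (block_quantizer q (map coord_xr zs) (map coord_yr zs)) (map coord_yh zs) = prod_list (map \<alpha> zs)"
        unfolding block_quantizer_def \<alpha>_def by (simp only: pmf_prod_channel prod.case)
      have "prod_list (map \<alpha> zs) < 2 powr (real n * (R - \<delta>)) * prod_list (map \<beta> zs) \<or>
          2 powr (real n * (R + \<delta>)) * prod_list (map \<beta> zs) < prod_list (map \<alpha> zs)"
        using nc unfolding block_close_def block_accept_def mem_Collect_eq h a by auto
      thus "zs \<in> ?A n \<union> ?B n"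
      proof
        assume "2 powr (real n * (R + \<delta>)) * prod_list (map \<beta> zs) < prod_list (map \<alpha> zs)"
        hence "2 powr (real n * (- (R + \<delta>))) * (2 powr (real n * (R + \<delta>)) * prod_list (map \<beta> zs)) < 2 powr (real n * (- (R + \<delta>))) * prod_list (map \<alpha> zs)"
          by (rule mult_strict_left_mono) simp
        moreover have "2 powr (real n * (- (R + \<delta>))) * 2 powr (real n * (R + \<delta>)) = 1"
          by (simp add: powr_add[symmetric] algebra_simps)
        ultimately show ?thesis unfolding mult.assoc[symmetric] by (simp only: mult_1 mem_Collect_eq Un_iff simp_thms)
      qed simp
    qed simp
    also have "\<dots> \<le> emeasure (?P n) (?A n) + emeasure (?P n) (?B n)"
      by (rule emeasure_subadditive) simp_all
    also have "\<dots> \<le> ennreal (\<rho>1 ^ n) + ennreal (\<rho>2 ^ n)"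
      by (intro add_mono \<rho>1 \<rho>2)
    also have "\<dots> \<le> ennreal (\<rho> ^ n) + ennreal (\<rho> ^ n)"
      using \<rho>1 \<rho>2 by (intro add_mono ennreal_leI power_mono) (auto simp: \<rho>_def)
    also have "\<dots> = ennreal (2 * \<rho> ^ n)"
      using \<rho>1 by (simp add: \<rho>_def ennreal_plus[symmetric] del: ennreal_plus)
    finally show ?thesis .
  qed
  moreover have "0 < \<rho>" "\<rho> < 1" using \<rho>1 \<rho>2 by (auto simp: \<rho>_def)
  ultimately show ?thesis by blast
qed

text \<open>With weight 1/(N * B) for each of the N functions, the weighted sum has mean at most 1.
  At a point where it is at most 1, so is every summand.\<close>

lemma exists_simultaneous_bounds:
  fixes fs :: "(('x \<Rightarrow> ennreal) \<times> real) list"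
  assumes "\<And>f B. (f, B) \<in> set fs \<Longrightarrow> B > 0 \<and> (\<integral>\<^sup>+x. f x \<partial>measure_pmf p) \<le> ennreal B"
  shows "\<exists>x\<in>set_pmf p. \<forall>(f, B)\<in>set fs. f x \<le> ennreal (real (length fs) * B)"
proof (cases "fs = []")
  case False
  let ?N = "length fs"
  have N: "real ?N > 0" using False by simp
  let ?w = "\<lambda>i. ennreal (1 / (real ?N * snd (fs ! i)))"
  have fs: "snd (fs ! i) > 0" "(\<integral>\<^sup>+x. fst (fs ! i) x \<partial>p) \<le> ennreal (snd (fs ! i))" if "i < ?N" for i
    using assms[of "fst (fs ! i)" "snd (fs ! i)"] nth_mem[OF that] by auto
  have "(\<integral>\<^sup>+x. (\<Sum>i<?N. ?w i * fst (fs ! i) x) \<partial>p) = (\<Sum>i<?N. ?w i * (\<integral>\<^sup>+x. fst (fs ! i) x \<partial>p))"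
    by (simp add: nn_integral_sum nn_integral_cmult)
  also have "\<dots> \<le> (\<Sum>i<?N. ennreal (1 / real ?N))"
  proof (intro sum_mono)
    fix i assume "i \<in> {..<?N}"
    hence i: "i < ?N" by simp
    have "?w i * (\<integral>\<^sup>+x. fst (fs ! i) x \<partial>p) \<le> ?w i * ennreal (snd (fs ! i))"
      by (intro mult_left_mono fs i) simp
    also have "\<dots> = ennreal (1 / real ?N)"
      using fs(1)[OF i] N by (simp add: ennreal_mult[symmetric])
    finally show "?w i * (\<integral>\<^sup>+x. fst (fs ! i) x \<partial>p) \<le> ennreal (1 / real ?N)" .
  qed
  also have "\<dots> = 1"
    using N by (simp add: ennreal_of_nat_eq_real_of_nat ennreal_mult[symmetric])
  finally obtain x where x: "x \<in> set_pmf p" "(\<Sum>i<?N. ?w i * fst (fs ! i) x) \<le> 1"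
    using exists_le_nn_integral_pmf by blast
  have "f x \<le> ennreal (real ?N * B)" if "(f, B) \<in> set fs" for f B
  proof -
    from that obtain i where i: "i < ?N" "fs ! i = (f, B)" by (auto simp: in_set_conv_nth)
    have B: "B > 0" using fs(1)[OF i(1)] i(2) by simp
    have "?w i * fst (fs ! i) x \<le> (\<Sum>i<?N. ?w i * fst (fs ! i) x)"
      by (rule member_le_sum) (use i in auto)
    with x(2) have "ennreal (1 / (real ?N * B)) * f x \<le> 1" by (simp add: i(2) order_trans)
    hence "ennreal (real ?N * B) * (ennreal (1 / (real ?N * B)) * f x) \<le> ennreal (real ?N * B) * 1"
      by (rule mult_left_mono) simp
    moreover have "ennreal (real ?N * B) * ennreal (1 / (real ?N * B)) = 1"
      using B N by (simp add: ennreal_mult[symmetric])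
    ultimately show ?thesis by (simp flip: mult.assoc)
  qed
  with x(1) show ?thesis by blast
qed (use set_pmf_not_empty[of p] in auto)

definition codebook_size :: "real \<Rightarrow> nat \<Rightarrow> nat" where
  "codebook_size \<theta> n = nat \<lceil>2 powr (real n * \<theta>)\<rceil>"

lemma codebook_size_bounds:
  "2 powr (real n * \<theta>) \<le> real (codebook_size \<theta> n)"
  "\<theta> \<ge> 0 \<Longrightarrow> real (codebook_size \<theta> n) \<le> 2 * 2 powr (real n * \<theta>)"
proof -
  have "0 < 2 powr (real n * \<theta>)" by simp
  hence p: "0 \<le> \<lceil>2 powr (real n * \<theta>)\<rceil>" by linarith
  show "2 powr (real n * \<theta>) \<le> real (codebook_size \<theta> n)"
    unfolding codebook_size_def by (rule real_nat_ceiling_ge)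
  assume "\<theta> \<ge> 0"
  hence "1 \<le> 2 powr (real n * \<theta>)" by (simp add: ge_one_powr_ge_zero)
  moreover have "real (codebook_size \<theta> n) = of_int \<lceil>2 powr (real n * \<theta>)\<rceil>"
    unfolding codebook_size_def using p by simp
  moreover have "of_int \<lceil>2 powr (real n * \<theta>)\<rceil> < 2 powr (real n * \<theta>) + 1" by linarith
  ultimately show "real (codebook_size \<theta> n) \<le> 2 * 2 powr (real n * \<theta>)" by linarith
qed

text \<open>
  The exponent \<open>min \<dots>\<close> is the rate at which a path through wrong messages dies out; the weight
  \<open>2 powr - (n * k)\<close> of a wrong index is chosen to make this true for every transition.
\<close>

definition path_exponent :: "real \<Rightarrow> ('a::finite, 's::finite, 'r::finite, 'h::finite) view pmf \<Rightarrow> real" where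
  "path_exponent R V = min (gap wrong_input V) (gap wrong_all V - R)"

definition weight_exponent :: "real \<Rightarrow> ('a::finite, 's::finite, 'r::finite, 'h::finite) view pmf \<Rightarrow> real" where
  "weight_exponent R V = gap wrong_relay V - path_exponent R V"

text \<open>The 2 counts the two sides of \<open>block_close\<close>. The 8 is the rounding factor 2
  of the codebook size times the 4 conditions of typicality, and 2 powr (3 * \<delta>) is the price
  L/t per letter.\<close>

definition miss_bound :: "real \<Rightarrow> real \<Rightarrow> real \<Rightarrow> nat \<Rightarrow> real" where
  "miss_bound \<rho> \<rho>' \<delta> n = 2 * \<rho>' ^ n + exp (- (2 powr (real n * \<delta>))) + 8 * (2 powr (3 * \<delta>) * \<rho>) ^ n"

text \<open>The exponent R + 2\<delta> of the codebook exceeds R + \<delta>, so covering fails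
  doubly exponentially rarely. It exceeds R - \<delta> by 3\<delta>, which is at most \<epsilon>.
  Each cost loses one \<epsilon> to typicality and at most another to the codebook; the 4 is the
  rounding factor 2 for each of two summands.\<close>

lemma expected_block_costs:
  fixes V :: "('a::finite \<times> ('b::finite \<times> 'y::finite) \<times> 'r::finite \<times> 'h::finite) pmf"
    and q :: "'r \<Rightarrow> 'w::finite \<Rightarrow> 'h pmf" and n :: nat and R \<epsilon> \<delta> :: real
    and U :: "('a list \<times> ('b list \<times> 'y list) \<times> 'r list \<times> 'w list) pmf"
  defines "ph \<equiv> map_pmf quant_of V" and "pa \<equiv> map_pmf fst V"
    and "pr \<equiv> map_pmf relay_of V"
  defines "L \<equiv> codebook_size (R + 2 * \<delta>) n" and "\<kappa> \<equiv> 2 powr - (real n * weight_exponent R V)"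
  defines "g \<equiv> pick (block_accept q ph (R - \<delta>) n) L" and "S \<equiv> typical V \<epsilon> n"
  assumes U: "quantize (block_quantizer q) U = map_pmf unzip4 (replicate_pmf n V)"
    and R: "R \<ge> 0" and \<delta>: "\<delta> > 0" "3 * \<delta> \<le> \<epsilon>"
    and \<rho>': "\<rho>' > 0" "(\<integral>\<^sup>+(a, s, r, w). emeasure (block_quantizer q r w) {h. \<not> block_close q ph (R - \<delta>) (R + \<delta>) n r w h} \<partial>U) \<le> ennreal (2 * \<rho>' ^ n)"
    and \<rho>: "\<rho> > 0" "atypical_mass V \<epsilon> n \<le> ennreal (4 * \<rho> ^ n)"
  shows "(\<integral>\<^sup>+c. miss_cost S (g c) c U \<partial>codebook_pmf L (replicate_pmf n ph)) \<le> ennreal (miss_bound \<rho> \<rho>' \<delta> n)" (is "?miss \<le> _")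
    and "(\<integral>\<^sup>+c. leave_cost (ennreal \<kappa>) L S (g c) c (replicate_pmf n pa) U \<partial>codebook_pmf L (replicate_pmf n ph))
      \<le> ennreal (4 * 2 powr - (real n * (path_exponent R V - 2 * \<epsilon>)))" (is "?leave \<le> _")
    and "(\<integral>\<^sup>+c. return_cost (ennreal \<kappa>) L S (g c) c (replicate_pmf n pa) (replicate_pmf n pr) U \<partial>codebook_pmf L (replicate_pmf n ph))
      \<le> ennreal (\<kappa> * (4 * 2 powr - (real n * (path_exponent R V - 2 * \<epsilon>))))" (is "?return \<le> _")
proof -
  let ?V = "with_copies (replicate_pmf n pa) (replicate_pmf n pr) (replicate_pmf n ph) (quantize (block_quantizer q) U)"
  let ?v = "\<lambda>d. 2 powr - (real n * (d - \<epsilon>))" and ?w = "\<lambda>d. 2 * 2 powr - (real n * (d - 2 * \<epsilon>))"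
  let ?D = "\<lambda>f. gap f V"
  let ?lam = "path_exponent R V" and ?k = "weight_exponent R V"
  let ?t = "2 powr (real n * (R - \<delta>))" and ?t' = "2 powr (real n * (R + \<delta>))"
  have T: "\<And>r w h. block_accept q ph (R - \<delta>) n r w h \<Longrightarrow> ?t * pmf (replicate_pmf n ph) h \<le> pmf (block_quantizer q r w) h"
    by (simp add: block_accept_def)
  have T': "\<And>r w h. block_close q ph (R - \<delta>) (R + \<delta>) n r w h \<Longrightarrow>
      block_accept q ph (R - \<delta>) n r w h \<and> pmf (block_quantizer q r w) h \<le> ?t' * pmf (replicate_pmf n ph) h"
    by (simp add: block_close_def)
  have L: "2 powr (real n * (R + 2 * \<delta>)) \<le> real L" "real L \<le> 2 * 2 powr (real n * (R + 2 * \<delta>))"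
    using codebook_size_bounds[where \<theta>="R + 2 * \<delta>" and n=n] R \<delta>(1) unfolding L_def by auto
  have Lt: "real L / ?t \<le> 2 * 2 powr (real n * (3 * \<delta>))"
  proof -
    have "real L / ?t \<le> 2 * 2 powr (real n * (R + 2 * \<delta>)) / ?t"
      using L(2) by (intro divide_right_mono) auto
    also have "\<dots> = 2 * (2 powr (real n * (R + 2 * \<delta>)) / ?t)" by simp
    also have "2 powr (real n * (R + 2 * \<delta>)) / ?t = 2 powr (real n * (3 * \<delta>))"
      by (subst powr_diff[symmetric]) (simp add: algebra_simps)
    finally show ?thesis .
  qed
  have Lt': "2 powr (real n * \<delta>) \<le> real L / ?t'"
  proof -
    have "2 powr (real n * \<delta>) = 2 powr (real n * (R + 2 * \<delta>)) / ?t'"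
      by (subst powr_diff[symmetric]) (simp add: algebra_simps)
    also have "\<dots> \<le> real L / ?t'" using L(1) by (intro divide_right_mono) auto
    finally show ?thesis .
  qed
  have pow: "2 powr (real n * (3 * \<delta>)) = (2 powr (3 * \<delta>)) ^ n"
    by (simp add: powr_power mult.commute)
  have "?miss \<le>
     (\<integral>\<^sup>+(a, s, r, w). emeasure (block_quantizer q r w) {h. \<not> block_close q ph (R - \<delta>) (R + \<delta>) n r w h} \<partial>U)
      + ennreal (exp (- (real L / ?t'))) + ennreal (real L / ?t) * emeasure (quantize (block_quantizer q) U) (- S)"
    unfolding g_def by (rule expected_miss_cost[OF _ _ T T']) auto
  also have "\<dots> \<le> ennreal (2 * \<rho>' ^ n) + ennreal (exp (- (2 powr (real n * \<delta>)))) + ennreal (2 * 2 powr (real n * (3 * \<delta>))) * ennreal (4 * \<rho> ^ n)"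
    unfolding U S_def using Lt Lt' by (intro add_mono mult_mono ennreal_leI \<rho>(2) \<rho>'(2)) auto
  also have "\<dots> = ennreal (miss_bound \<rho> \<rho>' \<delta> n)"
    using \<rho>(1) \<rho>'(1) unfolding miss_bound_def pow
    by (simp add: ennreal_mult[symmetric] ennreal_plus[symmetric] power_mult_distrib mult_ac del: ennreal_plus)
  finally show "?miss \<le> ennreal (miss_bound \<rho> \<rho>' \<delta> n)" .
  have le\<delta>: "real n * (3 * \<delta>) \<le> real n * \<epsilon>" "real n * (2 * \<delta>) \<le> real n * \<epsilon>" using \<delta> by (auto intro!: mult_left_mono)
  \<comment> \<open>The fourth relation is the definition of the weight. For the third,
    \<open>kl_exchange\<close> bounds the right side below by D wrong_input + (D wrong_all - R) -
    lam. Since lam is the smaller of these two terms, what remains is the larger.\<close>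
  have lam: "?lam \<le> ?D wrong_input" "?lam \<le> ?D wrong_all - R" "?lam \<le> ?k + ?D wrong_quantized - R"
    "?k + ?lam = ?D wrong_relay"
    using kl_exchange[of V] unfolding path_exponent_def weight_exponent_def by (auto simp: min_def)
  have w: "ennreal (real L / ?t) * ennreal (?v d) \<le> ennreal (?w d)" for d
  proof -
    have "real L / ?t * ?v d \<le> (2 * 2 powr (real n * \<epsilon>)) * ?v d"
    proof (intro mult_right_mono)
      show "real L / ?t \<le> 2 * 2 powr (real n * \<epsilon>)"
        by (rule order_trans[OF Lt mult_left_mono[OF powr_mono[OF le\<delta>(1)]]]) simp_all
    qed simp
    also have "\<dots> = ?w d"
      by (simp add: powr_add[symmetric] algebra_simps)
    finally show ?thesis by (simp add: ennreal_mult[symmetric] ennreal_leI)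
  qed
  have Lq: "ennreal \<kappa> * (of_nat L * ennreal (?v d)) \<le> ennreal (?w (?k + d - R))" for d
  proof -
    have "\<kappa> * (real L * ?v d) \<le> \<kappa> * ((2 * 2 powr (real n * (R + 2 * \<delta>))) * ?v d)"
      using L(2) by (intro mult_left_mono mult_right_mono) (auto simp: \<kappa>_def)
    also have "\<dots> = 2 * 2 powr (- (real n * (?k + d - R - \<epsilon>)) + real n * (2 * \<delta>))"
      unfolding \<kappa>_def by (simp add: powr_add[symmetric] algebra_simps)
    also have "\<dots> \<le> ?w (?k + d - R)"
      using le\<delta>(2) by (intro mult_left_mono powr_mono) (auto simp: algebra_simps)
    finally show ?thesis
      by (simp add: ennreal_mult[symmetric] ennreal_leI ennreal_of_nat_eq_real_of_nat \<kappa>_def)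
  qed
  have mono: "?w d \<le> ?w d'" if "d' \<le> d" for d d'
    using that by (intro mult_left_mono powr_mono) (auto intro!: mult_left_mono)
  have "?leave \<le>
    ennreal (real L / ?t) * emeasure (map_pmf wrong_input ?V) S
      + ennreal \<kappa> * (of_nat L * emeasure (map_pmf wrong_quantized ?V) S)"
    unfolding g_def by (rule expected_leave_cost[OF _ T]) auto
  also have "\<dots> \<le> ennreal (real L / ?t) * ennreal (?v (?D wrong_input))
      + ennreal \<kappa> * (of_nat L * ennreal (?v (?D wrong_quantized)))"
    unfolding U S_def pa_def pr_def ph_def
    by (intro add_mono mult_left_mono typical_wrong wrong_block) auto
  also have "\<dots> \<le> ennreal (?w ?lam) + ennreal (?w ?lam)"
    by (intro add_mono order_trans[OF w] order_trans[OF Lq] ennreal_leI mono lam)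
  also have "\<dots> = ennreal (4 * 2 powr - (real n * (?lam - 2 * \<epsilon>)))"
    by (simp add: ennreal_plus[symmetric] del: ennreal_plus)
  finally show "?leave
      \<le> ennreal (4 * 2 powr - (real n * (?lam - 2 * \<epsilon>)))" .
  have "?return \<le>
    ennreal (real L / ?t) * emeasure (map_pmf wrong_relay ?V) S
      + ennreal \<kappa> * (of_nat L * emeasure (map_pmf wrong_all ?V) S)"
    unfolding g_def by (rule expected_return_cost[OF _ T]) auto
  also have "\<dots> \<le> ennreal (real L / ?t) * ennreal (?v (?D wrong_relay))
      + ennreal \<kappa> * (of_nat L * ennreal (?v (?D wrong_all)))"
    unfolding U S_def pa_def pr_def ph_def
    by (intro add_mono mult_left_mono typical_wrong wrong_block) auto
  also have "\<dots> \<le> ennreal (?w (?k + ?lam)) + ennreal (?w (?k + ?lam))"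
    using lam by (intro add_mono order_trans[OF w] order_trans[OF Lq] ennreal_leI mono) auto
  also have "\<dots> = ennreal (\<kappa> * (4 * 2 powr - (real n * (?lam - 2 * \<epsilon>))))"
    unfolding \<kappa>_def by (simp add: ennreal_plus[symmetric] powr_add[symmetric] algebra_simps del: ennreal_plus)
  finally show "?return
      \<le> ennreal (\<kappa> * (4 * 2 powr - (real n * (?lam - 2 * \<epsilon>))))" .
qed

subsection \<open>Vanishing error probability\<close>

lemma set_block_code_pmf:
  assumes "C \<in> set_pmf (block_code_pmf M1 M2 L (replicate_pmf n p1) (replicate_pmf n p2) (replicate_pmf n pr)
      (replicate n da) (replicate n db) (replicate n dr))"
  shows "length (fst C m) = n" "length (fst (snd C) m) = n" "length (snd (snd C) l) = n"
proof -
  have *: "length (f x) = n" if "f \<in> set_pmf (Pi_pmf A (replicate n d) (\<lambda>_. replicate_pmf n p))" "finite A"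
    for f :: "nat \<Rightarrow> 'z list" and x A d p
    using that by (cases "x \<in> A") (auto simp: set_Pi_pmf PiE_dflt_def dest!: length_replicate_pmf)
  from assms show "length (fst C m) = n" "length (fst (snd C) m) = n" "length (snd (snd C) l) = n"
    unfolding block_code_pmf_def by (auto intro!: *)
qed

text \<open>At rate 0 there is a single message and hence no wrong one. Otherwise 24 = 6 * 4
  combines the six simultaneous bounds with the constant of the one-block costs, 2 powr (b * R) pays
  for at most b letters outside the blocks, and the weight enters only once, as |k|.\<close>

definition tail_bound :: "nat \<Rightarrow> real \<Rightarrow> real \<Rightarrow> real \<Rightarrow> nat \<Rightarrow> real" where
  "tail_bound b R d k n = (if R = 0 then 0 else
     2 * 24 ^ b * 2 powr (real b * R) * 2 powr - (real n * (real b * (d - R) - \<bar>k\<bar>)))"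

lemma decoding_bound_le:
  assumes M: "M = nat \<lceil>2 powr (real N * R)\<rceil>" and N: "N \<le> b * n + b" and R: "R \<ge> 0" and \<mu>: "\<mu> \<ge> 0"
  shows "decoding_bound b M (ennreal \<mu>) (2 powr - (real n * k)) (ennreal (24 * 2 powr - (real n * d)))
    \<le> ennreal (real b * \<mu> + tail_bound b R d k n)"
proof -
  let ?T = "(1 / 2 powr - (real n * k) + 1) * (24 * 2 powr - (real n * d)) ^ b"
  have "decoding_bound b M (ennreal \<mu>) (2 powr - (real n * k)) (ennreal (24 * 2 powr - (real n * d))) =
      ennreal (real b * \<mu> + real (M - 1) * ?T)"
    using \<mu> unfolding decoding_bound_def ennreal_of_nat_eq_real_of_nat
    by (simp add: ennreal_mult[symmetric] ennreal_plus[symmetric] ennreal_power del: ennreal_plus)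
  also have "\<dots> \<le> ennreal (real b * \<mu> + tail_bound b R d k n)"
  proof (intro ennreal_leI add_left_mono)
    show "real (M - 1) * ?T \<le> tail_bound b R d k n"
    proof (cases "R = 0")
      case True
      hence "M = 1" using M by simp
      thus ?thesis using True by (simp add: tail_bound_def)
    next
      case False
      have "0 < 2 powr (real N * R)" by simp
      hence "real (M - 1) \<le> 2 powr (real N * R)" unfolding M by linarith
      moreover have "real N \<le> real (b * n + b)"
        using N by (simp only: of_nat_le_iff)
      hence "2 powr (real N * R) \<le> 2 powr (real (b * n + b) * R)"
        by (intro powr_mono mult_right_mono R) simp_all
      ultimately have m: "real (M - 1) \<le> 2 powr (real (b * n + b) * R)" by (rule order_trans)
      have "1 / 2 powr - (real n * k) = 2 powr (real n * k)"
        by (simp add: powr_minus divide_inverse)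
      also have "\<dots> \<le> 2 powr (real n * \<bar>k\<bar>)"
        by (intro powr_mono mult_left_mono) auto
      finally have k: "1 / 2 powr - (real n * k) + 1 \<le> 2 * 2 powr (real n * \<bar>k\<bar>)"
        using ge_one_powr_ge_zero[of 2 "real n * \<bar>k\<bar>"] by simp
      have e: "(24 * 2 powr - (real n * d)) ^ b = 24 ^ b * 2 powr - (real n * d * real b)"
        by (simp add: power_mult_distrib powr_power mult_ac)
      have "real (M - 1) * ?T \<le> 2 powr (real (b * n + b) * R) * ((2 * 2 powr (real n * \<bar>k\<bar>)) * (24 ^ b * 2 powr - (real n * d * real b)))"
        unfolding e by (intro mult_mono m k order_refl) auto
      also have "2 powr (real (b * n + b) * R) * ((2 * 2 powr (real n * \<bar>k\<bar>)) * (24 ^ b * 2 powr - (real n * d * real b))) =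
         2 * 24 ^ b * (2 powr (real (b * n + b) * R) * 2 powr (real n * \<bar>k\<bar>) * 2 powr - (real n * d * real b))"
        by simp
      also have "2 powr (real (b * n + b) * R) * 2 powr (real n * \<bar>k\<bar>) * 2 powr - (real n * d * real b) =
          2 powr (real b * R) * 2 powr - (real n * (real b * (d - R) - \<bar>k\<bar>))"
        unfolding powr_add[symmetric] by (rule arg_cong[where f="\<lambda>x. 2 powr x"]) (simp add: algebra_simps)
      finally show ?thesis using False by (simp add: tail_bound_def mult.assoc)
    qed
  qed
  finally show ?thesis .
qed

lemma tail_bound_tendsto:
  assumes "R = 0 \<or> \<bar>k\<bar> < real b * (d - R)"
  shows "tail_bound b R d k \<longlonglongrightarrow> 0"
proof (cases "R = 0")
  case True
  hence "tail_bound b R d k = (\<lambda>_. 0)" by (simp add: tail_bound_def fun_eq_iff)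
  thus ?thesis by simp
next
  case False
  define g where "g = real b * (d - R) - \<bar>k\<bar>"
  have "g > 0" using assms False by (simp add: g_def)
  hence "2 powr - g < (1 :: real)" by (simp add: powr_less_one)
  hence "(\<lambda>n. 2 * 24 ^ b * 2 powr (real b * R) * (2 powr - g) ^ n) \<longlonglongrightarrow> 2 * 24 ^ b * 2 powr (real b * R) * 0"
    by (intro tendsto_mult_left LIMSEQ_power_zero) simp
  moreover have "(2 powr - g) ^ n = 2 powr - (real n * g)" for n
    by (simp add: powr_power mult.commute)
  ultimately show ?thesis using False unfolding tail_bound_def g_def by simp
qed

lemma miss_bound_tendsto:
  assumes "0 < \<rho>" "2 powr (3 * \<delta>) * \<rho> < 1" "0 < \<rho>'" "\<rho>' < 1" "\<delta> > 0"
  shows "miss_bound \<rho> \<rho>' \<delta> \<longlonglongrightarrow> 0"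
proof -
  have "(\<lambda>n. exp (- (2 powr (real n * \<delta>)))) \<longlonglongrightarrow> 0"
    using \<open>\<delta> > 0\<close> by real_asymp
  moreover have "(\<lambda>n. 2 * \<rho>' ^ n) \<longlonglongrightarrow> 2 * 0" "(\<lambda>n. 8 * (2 powr (3 * \<delta>) * \<rho>) ^ n) \<longlonglongrightarrow> 8 * 0"
    using assms by (intro tendsto_mult_left LIMSEQ_power_zero; simp)+
  ultimately have "(\<lambda>n. 2 * \<rho>' ^ n + exp (- (2 powr (real n * \<delta>))) + 8 * (2 powr (3 * \<delta>) * \<rho>) ^ n) \<longlonglongrightarrow> 2 * 0 + 0 + 8 * 0"
    by (intro tendsto_add)
  thus ?thesis unfolding miss_bound_def by simp
qed

lemma exists_small_exponent:
  fixes \<rho> \<epsilon> :: real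
  assumes "0 < \<rho>" "\<rho> < 1" "\<epsilon> > 0"
  shows "\<exists>\<delta>>0. 3 * \<delta> \<le> \<epsilon> \<and> 2 powr (3 * \<delta>) * \<rho> < 1"
proof -
  define \<delta> where "\<delta> = min (\<epsilon> / 3) (log 2 (1 / \<rho>) / 6)"
  have l: "log 2 (1 / \<rho>) > 0" using assms by simp
  have "2 powr (3 * \<delta>) < 2 powr (log 2 (1 / \<rho>))"
    using l by (intro powr_less_mono) (auto simp: \<delta>_def)
  also have "\<dots> = 1 / \<rho>" using assms by simp
  finally have "2 powr (3 * \<delta>) * \<rho> < 1" using assms by (simp add: field_simps)
  moreover have "\<delta> > 0" "3 * \<delta> \<le> \<epsilon>" using l assms by (auto simp: \<delta>_def)
  ultimately show ?thesis by blast
qed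

lemma filterlim_div_const_nat:
  assumes "b > (0 :: nat)"
  shows "filterlim (\<lambda>N. N div b) sequentially sequentially"
  unfolding filterlim_at_top eventually_sequentially
proof
  fix K
  have "\<forall>N\<ge>K * b. K \<le> N div b" using assms by (auto simp: less_eq_div_iff_mult_less_eq)
  thus "\<exists>N0. \<forall>N\<ge>N0. K \<le> N div b" by blast
qed

lemma miss_bound_pos: "0 < \<rho> \<Longrightarrow> 0 < \<rho>' \<Longrightarrow> 0 < miss_bound \<rho> \<rho>' \<delta> n"
  unfolding miss_bound_def by (intro add_pos_pos mult_pos_pos zero_less_power) simp_all

lemma block_quantizer_event_swap:
  "emeasure (cf_joint p2 p1 pr (swap_channel W') q') {(x1, x2, xr, y1, y2, yr, yh). Q xr yr yh} =
    emeasure (cf_joint p1 p2 pr W' q') {(x1, x2, xr, y1, y2, yr, yh). Q xr yr yh}"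
  unfolding cf_joint_swap by (simp add: vimage_def case_prod_unfold)

context
  fixes W :: "('x1::finite, 'x2::finite, 'xr::finite, 'y1::finite, 'y2::finite, 'yr::finite) twrc"
    and p1 :: "'x1 pmf" and p2 :: "'x2 pmf" and pr :: "'xr pmf"
    and q :: "'xr \<Rightarrow> 'yr \<Rightarrow> 'yh::finite pmf" and J V1 V2 and R :: real
  defines "J \<equiv> cf_joint p1 p2 pr W q"
    and "V1 \<equiv> map_pmf (\<lambda>(x1, x2, xr, y1, y2, yr, yh). (x2, (x1, y1), xr, yh)) J"
    and "V2 \<equiv> map_pmf (\<lambda>(x1, x2, xr, y1, y2, yr, yh). (x1, (x2, y2), xr, yh)) J"
    and "R \<equiv> quantization_rate q J"
begin

lemma view_marginals:
  "map_pmf fst V1 = p2" "map_pmf relay_of V1 = pr" "map_pmf quant_of V1 = map_pmf coord_yh J"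
  "map_pmf fst V2 = p1" "map_pmf relay_of V2 = pr" "map_pmf quant_of V2 = map_pmf coord_yh J"
  using marginals[of p1 p2 pr W q] unfolding V1_def V2_def map_pmf_comp J_def
  by (simp_all add: case_prod_unfold)

lemma block_views:
  "quantize (block_quantizer q) (side_law (replicate_pmf n p2) (replicate_pmf n p1) (replicate_pmf n pr) (swap_channel (block_channel W))) =
    map_pmf unzip4 (replicate_pmf n V1)"
  "quantize (block_quantizer q) (side_law (replicate_pmf n p1) (replicate_pmf n p2) (replicate_pmf n pr) (block_channel W)) =
    map_pmf unzip4 (replicate_pmf n V2)"
  unfolding quantize_side_law cf_joint_swap cf_joint_block V1_def V2_def replicate_map_pmf map_pmf_comp J_def
  by (rule map_pmf_cong[OF refl]; simp add: unzip7_def unzip4_def case_prod_unfold o_def)+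

text \<open>The quantization codebook is chosen first, since the costs that drive the chain are
  those for a fixed codebook; the block codes are derandomized afterwards.\<close>

lemma exists_code:
  assumes \<rho>: "\<rho> > 0"
      "atypical_mass V1 \<epsilon> n \<le> ennreal (4 * \<rho> ^ n)"
      "atypical_mass V2 \<epsilon> n \<le> ennreal (4 * \<rho> ^ n)"
    and \<rho>': "\<rho>' > 0" "emeasure (block_joint n p1 p2 pr W q)
     (unquantized q (map_pmf coord_yh J) R \<delta> n) \<le> ennreal (2 * \<rho>' ^ n)"
    and \<delta>: "\<delta> > 0" "3 * \<delta> \<le> \<epsilon>" and N: "b * n \<le> N" "N \<le> b * n + b" and R12: "R1 \<ge> 0" "R2 \<ge> 0"
  shows "\<exists>C. is_code N R1 R2 C \<and> error_prob W N R1 R2 C \<le>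
      2 * (real b * (6 * miss_bound \<rho> \<rho>' \<delta> n))
      + tail_bound b R2 (path_exponent R V1 - 2 * \<epsilon>) (weight_exponent R V1) n
      + tail_bound b R1 (path_exponent R V2 - 2 * \<epsilon>) (weight_exponent R V2) n"
proof -
  define L where "L = codebook_size (R + 2 * \<delta>) n"
  define ph where "ph = map_pmf coord_yh J"
  define g where "g = pick (block_accept q ph (R - \<delta>) n) L"
  define S1 where "S1 = typical V1 \<epsilon> n"
  define S2 where "S2 = typical V2 \<epsilon> n"
  define \<kappa>1 where "\<kappa>1 = 2 powr - (real n * weight_exponent R V1)"
  define \<kappa>2 where "\<kappa>2 = 2 powr - (real n * weight_exponent R V2)"
  define \<mu> where "\<mu> = miss_bound \<rho> \<rho>' \<delta> n"
  define a1 where "a1 = 4 * 2 powr - (real n * (path_exponent R V1 - 2 * \<epsilon>))"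
  define a2 where "a2 = 4 * 2 powr - (real n * (path_exponent R V2 - 2 * \<epsilon>))"
  define M1 where "M1 = nat \<lceil>2 powr (real N * R1)\<rceil>"
  define M2 where "M2 = nat \<lceil>2 powr (real N * R2)\<rceil>"
  let ?p1n = "replicate_pmf n p1" and ?p2n = "replicate_pmf n p2" and ?prn = "replicate_pmf n pr"
  let ?U1 = "side_law ?p2n ?p1n ?prn (swap_channel (block_channel W))"
  let ?U2 = "side_law ?p1n ?p2n ?prn (block_channel W)"
  let ?D = "decoding_bound b M2 (ennreal (6 * \<mu>)) \<kappa>1 (ennreal (6 * a1)) + decoding_bound b M1 (ennreal (6 * \<mu>)) \<kappa>2 (ennreal (6 * a2))"
  let ?T1 = "tail_bound b R2 (path_exponent R V1 - 2 * \<epsilon>) (weight_exponent R V1) n" and ?T2 = "tail_bound b R1 (path_exponent R V2 - 2 * \<epsilon>) (weight_exponent R V2) n"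
  have R: "R \<ge> 0" unfolding R_def J_def by (rule quantization_rate_nonneg)
  have \<mu>: "\<mu> > 0" unfolding \<mu>_def using \<rho>(1) \<rho>'(1) by (rule miss_bound_pos)
  note c1 = expected_block_costs[OF block_views(1), where R=R and \<delta>=\<delta> and \<epsilon>=\<epsilon> and \<rho>=\<rho> and \<rho>'=\<rho>',
      unfolded view_marginals side_law_quantizer_event block_quantizer_event_swap, OF R \<delta> \<rho>' \<rho>(1,2),
      folded ph_def L_def, folded g_def S1_def \<kappa>1_def \<mu>_def a1_def]
  note c2 = expected_block_costs[OF block_views(2), where R=R and \<delta>=\<delta> and \<epsilon>=\<epsilon> and \<rho>=\<rho> and \<rho>'=\<rho>',
      unfolded view_marginals side_law_quantizer_event, OF R \<delta> \<rho>' \<rho>(1,3),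
      folded ph_def L_def, folded g_def S2_def \<kappa>2_def \<mu>_def a2_def]
  \<comment> \<open>Three costs for each user must be small for the same codebook, since the relay
    serves both users with it; the six bounds are the source of the factors 6.\<close>
  let ?fs = "[(\<lambda>c. miss_cost S1 (g c) c ?U1, \<mu>), (\<lambda>c. leave_cost \<kappa>1 L S1 (g c) c ?p2n ?U1, a1),
     (\<lambda>c. return_cost \<kappa>1 L S1 (g c) c ?p2n ?prn ?U1, \<kappa>1 * a1),
     (\<lambda>c. miss_cost S2 (g c) c ?U2, \<mu>), (\<lambda>c. leave_cost \<kappa>2 L S2 (g c) c ?p1n ?U2, a2),
     (\<lambda>c. return_cost \<kappa>2 L S2 (g c) c ?p1n ?prn ?U2, \<kappa>2 * a2)]"
  have pos: "a1 > 0" "a2 > 0" "\<kappa>1 > 0" "\<kappa>2 > 0"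
    by (simp_all add: a1_def a2_def \<kappa>1_def \<kappa>2_def)
  have "\<exists>c\<in>set_pmf (codebook_pmf L (replicate_pmf n ph)). \<forall>(f, B)\<in>set ?fs. f c \<le> ennreal (real (length ?fs) * B)"
    by (rule exists_simultaneous_bounds) (use pos \<mu> c1 c2 in auto)
  then obtain c where c: "\<forall>(f, B)\<in>set ?fs. f c \<le> ennreal (6 * B)" by auto
  have g: "g c r w \<le> L" for r w unfolding g_def by (rule pick_le)
  have M: "M1 > 0" "M2 > 0"
  proof -
    have "0 < 2 powr (real N * R1)" "0 < 2 powr (real N * R2)" by simp_all
    thus "M1 > 0" "M2 > 0" unfolding M1_def M2_def by linarith+
  qed
  let ?cp = "block_code_pmf M1 M2 L ?p1n ?p2n ?prn
      (replicate n undefined) (replicate n undefined) (replicate n undefined)"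
  have "\<exists>cs\<in>set_pmf (replicate_pmf b ?cp).
    average_block_error (block_channel W) (g c) M1 M2 L S1 S2 c cs
    \<le> ?D"
    by (rule block_code_exists) (use c g pos M in \<open>simp_all add: ennreal_mult'[symmetric] mult.left_commute\<close>)
  then obtain cs where cs: "cs \<in> set_pmf (replicate_pmf b ?cp)"
    and err: "average_block_error (block_channel W) (g c) M1 M2 L S1 S2 c cs
    \<le> ?D"
    by blast
  have len: "length cs = b" "set cs \<subseteq> set_pmf ?cp"
    using cs by (auto simp: set_replicate_pmf)
  have msg: "messages N R1 = {1..M1}" "messages N R2 = {1..M2}"
    unfolding messages_def M1_def M2_def by simp_all
  let ?C = "cf_code M1 M2 L S1 S2 c (g c) n cs"
  have "ennreal (error_prob W N R1 R2 ?C) \<le> ?D"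
  proof (rule order_trans[OF error_prob_cf_code err])
    show "length cs * n \<le> N" using len N by simp
    show "length (fst C m) = n" "length (fst (snd C) m) = n" "length (snd (snd C) l) = n" if "C \<in> set cs" for C m l
      by (rule set_block_code_pmf[OF subsetD[OF len(2) that]])+
  qed (rule msg M g)+
  also have "\<dots> \<le> ennreal (real b * (6 * \<mu>) + ?T1)
      + ennreal (real b * (6 * \<mu>) + ?T2)"
    using decoding_bound_le[OF M2_def N(2) R12(2), of "6 * \<mu>" "weight_exponent R V1" "path_exponent R V1 - 2 * \<epsilon>"]
      decoding_bound_le[OF M1_def N(2) R12(1), of "6 * \<mu>" "weight_exponent R V2" "path_exponent R V2 - 2 * \<epsilon>"] \<mu>
    by (intro add_mono) (simp_all add: a1_def a2_def \<kappa>1_def \<kappa>2_def)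
  also have "\<dots> = ennreal (2 * (real b * (6 * \<mu>)) + ?T1 + ?T2)"
  proof -
    have "0 \<le> tail_bound b R' d k n" for R' d k by (simp add: tail_bound_def)
    thus ?thesis using \<mu> by (subst ennreal_plus[symmetric]) (auto simp: algebra_simps)
  qed
  finally have "error_prob W N R1 R2 ?C \<le> 2 * (real b * (6 * \<mu>)) + ?T1 + ?T2"
    using \<mu> by (subst (asm) ennreal_le_iff) (auto simp: tail_bound_def intro!: add_nonneg_nonneg)
  moreover have "is_code N R1 R2 ?C" by (rule is_code_cf_code[OF msg M])
  ultimately show ?thesis unfolding \<mu>_def by blast
qed

lemma vanishing_rates:
  assumes R12: "R1 \<ge> 0" "R2 \<ge> 0" and r1: "R1 = 0 \<or> R1 < path_exponent R V2" and r2: "R2 = 0 \<or> R2 < path_exponent R V1"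
  shows "(R1, R2) \<in> vanishing_error_rates W"
proof -
  \<comment> \<open>A quarter of the smaller rate gap: the loss 2\<epsilon> in the exponent leaves
    at least half of it. A rate 0 imposes no constraint.\<close>
  define \<epsilon> where "\<epsilon> = min (if R1 = 0 then 1 else (path_exponent R V2 - R1) / 4) (if R2 = 0 then 1 else (path_exponent R V1 - R2) / 4)"
  have \<epsilon>: "\<epsilon> > 0" "R1 = 0 \<or> 0 < path_exponent R V2 - 2 * \<epsilon> - R1" "R2 = 0 \<or> 0 < path_exponent R V1 - 2 * \<epsilon> - R2"
  proof -
    show "\<epsilon> > 0" using r1 r2 by (auto simp: \<epsilon>_def)
    have "R1 = 0 \<or> \<epsilon> \<le> (path_exponent R V2 - R1) / 4" "R2 = 0 \<or> \<epsilon> \<le> (path_exponent R V1 - R2) / 4"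
      by (auto simp: \<epsilon>_def min_def)
    thus "R1 = 0 \<or> 0 < path_exponent R V2 - 2 * \<epsilon> - R1" "R2 = 0 \<or> 0 < path_exponent R V1 - 2 * \<epsilon> - R2"
      using r1 r2 by auto
  qed
  have ex: "\<exists>b. R' = 0 \<or> \<bar>k\<bar> < real b * (d - R')" if "R' = 0 \<or> 0 < d - R'" for R' d k
    using that reals_Archimedean3[of "d - R'"] by blast
  obtain b1 where b1: "R1 = 0 \<or> \<bar>weight_exponent R V2\<bar> < real b1 * (path_exponent R V2 - 2 * \<epsilon> - R1)"
    using ex \<epsilon>(2) by blast
  obtain b2 where b2: "R2 = 0 \<or> \<bar>weight_exponent R V1\<bar> < real b2 * (path_exponent R V1 - 2 * \<epsilon> - R2)"
    using ex \<epsilon>(3) by blast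
  \<comment> \<open>Enough blocks for both users to amortize the weight, and at least one, so that N
    div b tends to infinity.\<close>
  define b where "b = Suc (max b1 b2)"
  have grow: "R' = 0 \<or> \<bar>k\<bar> < real b * (d - R')" if "R' = 0 \<or> \<bar>k\<bar> < real b' * (d - R')" "R' = 0 \<or> 0 < d - R'" "b' \<le> b" for R' k d b'
  proof (cases "R' = 0")
    case False
    hence "\<bar>k\<bar> < real b' * (d - R')" using that by simp
    also have "\<dots> \<le> real b * (d - R')" using that False by (intro mult_right_mono) auto
    finally show ?thesis ..
  qed simp
  have t1: "tail_bound b R1 (path_exponent R V2 - 2 * \<epsilon>) (weight_exponent R V2) \<longlonglongrightarrow> 0"
    by (rule tail_bound_tendsto, rule grow[OF b1 \<epsilon>(2)]) (simp add: b_def)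
  have t2: "tail_bound b R2 (path_exponent R V1 - 2 * \<epsilon>) (weight_exponent R V1) \<longlonglongrightarrow> 0"
    by (rule tail_bound_tendsto, rule grow[OF b2 \<epsilon>(3)]) (simp add: b_def)
  obtain \<rho>1 where \<rho>1: "0 < \<rho>1" "\<rho>1 < 1"
    "\<And>n. atypical_mass V1 \<epsilon> n \<le> ennreal (4 * \<rho>1 ^ n)"
    using typical_complement[OF \<epsilon>(1)] by blast
  obtain \<rho>2 where \<rho>2: "0 < \<rho>2" "\<rho>2 < 1"
    "\<And>n. atypical_mass V2 \<epsilon> n \<le> ennreal (4 * \<rho>2 ^ n)"
    using typical_complement[OF \<epsilon>(1)] by blast
  define \<rho> where "\<rho> = max \<rho>1 \<rho>2"
  have \<rho>: "0 < \<rho>" "\<rho> < 1" using \<rho>1 \<rho>2 by (auto simp: \<rho>_def)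
  have "4 * \<rho>1 ^ n \<le> 4 * \<rho> ^ n" "4 * \<rho>2 ^ n \<le> 4 * \<rho> ^ n" for n
    using \<rho>1(1) \<rho>2(1) by (auto simp: \<rho>_def intro!: mult_left_mono power_mono)
  hence typical_bound: "atypical_mass V1 \<epsilon> n \<le> ennreal (4 * \<rho> ^ n)"
    "atypical_mass V2 \<epsilon> n \<le> ennreal (4 * \<rho> ^ n)" for n
    by (meson \<rho>1(3) \<rho>2(3) ennreal_leI order_trans)+
  \<comment> \<open>The decay rate \<open>\<rho>\<close> of atypicality was fixed by \<epsilon>
    alone, so \<delta> may be adapted to it. The rate \<open>\<rho>'\<close> found next depends on
    \<delta>, but is not multiplied by the codebook overhead.\<close>
  obtain \<delta> where \<delta>: "\<delta> > 0" "3 * \<delta> \<le> \<epsilon>" "2 powr (3 * \<delta>) * \<rho> < 1"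
    using exists_small_exponent[OF \<rho> \<epsilon>(1)] by blast
  obtain \<rho>' where \<rho>': "0 < \<rho>'" "\<rho>' < 1"
    "\<And>n. emeasure (block_joint n p1 p2 pr W q)
     (unquantized q (map_pmf coord_yh J) R \<delta> n) \<le> ennreal (2 * \<rho>' ^ n)"
    using block_close_fails[OF \<delta>(1), of R q p1 p2 pr W "map_pmf coord_yh J"] unfolding R_def J_def by blast
  define B where "B = (\<lambda>n. 2 * (real b * (6 * miss_bound \<rho> \<rho>' \<delta> n))
      + tail_bound b R2 (path_exponent R V1 - 2 * \<epsilon>) (weight_exponent R V1) n
      + tail_bound b R1 (path_exponent R V2 - 2 * \<epsilon>) (weight_exponent R V2) n)"
  have "\<exists>C. is_code N R1 R2 C \<and> error_prob W N R1 R2 C \<le> B (N div b)" for N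
    unfolding B_def
  proof (rule exists_code[OF \<rho>(1) typical_bound \<rho>'(1) \<rho>'(3) \<delta>(1,2) _ _ R12])
    show "b * (N div b) \<le> N" by simp
    have "N mod b < b" by (simp add: b_def)
    thus "N \<le> b * (N div b) + b" using mult_div_mod_eq[of b N] by linarith
  qed
  then obtain C where C: "\<And>N. is_code N R1 R2 (C N)" "\<And>N. error_prob W N R1 R2 (C N) \<le> B (N div b)"
    by metis
  have "B \<longlonglongrightarrow> 2 * (real b * (6 * 0)) + 0 + 0"
    unfolding B_def by (intro tendsto_intros t1 t2 miss_bound_tendsto \<rho> \<rho>' \<delta>)
  hence B: "(\<lambda>N. B (N div b)) \<longlonglongrightarrow> 0"
    using filterlim_compose[OF _ filterlim_div_const_nat[of b]] by (simp add: b_def)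
  have "(\<lambda>N. error_prob W N R1 R2 (C N)) \<longlonglongrightarrow> 0"
  proof (rule tendsto_sandwich[OF _ _ tendsto_const B])
    show "\<forall>\<^sub>F N in sequentially. 0 \<le> error_prob W N R1 R2 (C N)"
      by (intro always_eventually allI) (simp add: error_prob_def)
    show "\<forall>\<^sub>F N in sequentially. error_prob W N R1 R2 (C N) \<le> B (N div b)"
      by (intro always_eventually allI C(2))
  qed
  with C(1) R12 show ?thesis unfolding vanishing_error_rates_def by blast
qed

end

theorem theorem3:
  fixes W :: "('x1::finite, 'x2::finite, 'xr::finite, 'y1::finite, 'y2::finite, 'yr::finite) twrc"
    and p1 :: "'x1 pmf" and p2 :: "'x2 pmf" and pr :: "'xr pmf"
    and q :: "'xr \<Rightarrow> 'yr \<Rightarrow> 'yh::finite pmf"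
    and P :: "'w pmf"
    and X1 :: "'w \<Rightarrow> 'x1" and X2 :: "'w \<Rightarrow> 'x2" and Xr :: "'w \<Rightarrow> 'xr"
    and Y1 :: "'w \<Rightarrow> 'y1" and Y2 :: "'w \<Rightarrow> 'y2" and Yr :: "'w \<Rightarrow> 'yr" and Yh :: "'w \<Rightarrow> 'yh"
    and R1 R2 :: real
  assumes joint:
      "map_pmf (\<lambda>w. (X1 w, X2 w, Xr w, Y1 w, Y2 w, Yr w, Yh w)) P = cf_joint p1 p2 pr W q"
    and compress1:
      "cond_mutual_info P Yh Yr (\<lambda>w. (X1 w, X2 w, Xr w, Y1 w)) \<le> cond_mutual_info P Xr Y1 X1"
    and compress2:
      "cond_mutual_info P Yh Yr (\<lambda>w. (X1 w, X2 w, Xr w, Y2 w)) \<le> cond_mutual_info P Xr Y2 X2"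
    and nonneg: "R1 \<ge> 0" "R2 \<ge> 0"
    and rate1:
      "R1 \<le> min
         (cond_mutual_info P X1 (\<lambda>w. (Y2 w, Yh w)) (\<lambda>w. (X2 w, Xr w)))
         (cond_mutual_info P (\<lambda>w. (X1 w, Xr w)) Y2 X2
           - cond_mutual_info P Yh Yr (\<lambda>w. (X1 w, X2 w, Xr w, Y2 w)))"
    and rate2:
      "R2 \<le> min
         (cond_mutual_info P X2 (\<lambda>w. (Y1 w, Yh w)) (\<lambda>w. (X1 w, Xr w)))
         (cond_mutual_info P (\<lambda>w. (X2 w, Xr w)) Y1 X1
           - cond_mutual_info P Yh Yr (\<lambda>w. (X1 w, X2 w, Xr w, Y1 w)))"
  shows "achievable W R1 R2"
proof -
  define J where "J = cf_joint p1 p2 pr W q"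
  define R where "R = quantization_rate q J"
  define V1 where "V1 = map_pmf (\<lambda>(x1, x2, xr, y1, y2, yr, yh). (x2, (x1, y1), xr, yh)) J"
  define V2 where "V2 = map_pmf (\<lambda>(x1, x2, xr, y1, y2, yr, yh). (x1, (x2, y2), xr, yh)) J"
  have r1: "R1 \<le> path_exponent R V2"
    using rate1 unfolding user2_rates[OF joint] path_exponent_def R_def V2_def J_def .
  have r2: "R2 \<le> path_exponent R V1"
    using rate2 unfolding user1_rates[OF joint] joint path_exponent_def R_def V1_def J_def .
  have "\<exists>y\<in>vanishing_error_rates W. dist y (R1, R2) < e" if "e > 0" for e
  proof
    \<comment> \<open>Each rate becomes zero or strictly smaller than its exponent, the two cases
      covered by \<open>vanishing_rates\<close>, and moves by at most e/4.\<close>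
    define S1 where "S1 = max 0 (R1 - e / 4)"
    define S2 where "S2 = max 0 (R2 - e / 4)"
    show "(S1, S2) \<in> vanishing_error_rates W"
      by (rule vanishing_rates[of S1 S2 q p1 p2 pr W, folded J_def, folded R_def V1_def V2_def])
        (use r1 r2 that in \<open>auto simp: S1_def S2_def\<close>)
    have "dist (S1, S2) (R1, R2) \<le> dist S1 R1 + dist S2 R2"
      by (simp add: dist_prod_def sqrt_sum_squares_le_sum)
    also have "\<dots> < e"
      using that nonneg by (auto simp: S1_def S2_def dist_real_def max_def)
    finally show "dist (S1, S2) (R1, R2) < e" .
  qed
  thus ?thesis unfolding achievable_def closure_approachable by blast
qed

end
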